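(* Let $\Bbbk$ be a field of characteristic $2$, $\mathsf C$ a small category and $\mathcal A:\mathsf C\to\mathsf{Alg}_\Bbbk$ a functor to associative (not necessarily unital) $\Bbbk$-algebras. Then the squaring map $\operatorname{Sq}(f)=f\mathbin{\bar\circ}f$ induces a function $H^k(\mathcal A,\mathcal A)\to H^{2k-1}(\mathcal A,\mathcal A)$ on Hochschild cohomology (for every $k$).
   Context: $B_p\mathsf C$ is the set of strings $\boldsymbol\phi=(\phi_1,\dots,\phi_p)$, $x_0\xleftarrow{\phi_1}x_1\leftarrow\dots\xleftarrow{\phi_p}x_p$ in $\mathsf C$ (objects if $p=0$); $\phi_{k,l}=\phi_{k+1}\circ\dots\circ\phi_l:x_l\to x_k$ (identity if $k=l$). $C^{p,q}(\mathcal A,\mathcal A)=\prod_{\boldsymbol\phi\in B_p\mathsf C}\operatorname{Hom}_\Bbbk(\mathcal A(x_p)^{\otimes q},\mathcal A(x_0))$; the component at $\boldsymbol\phi$ is $f[\boldsymbol\phi]$. Elements of total degree $k$ are sums of $f\in C^{p,q}$ with $p+q=k$. All formulas below are in characteristic $2$ (so signs are omitted). Coboundary $\delta=\delta^{\mathrm S}+\delta^{\mathrm H}$; for $f\in C^{p,q}$: $\delta^{\mathrm S}f\in C^{p+1,q}$, $(\delta^{\mathrm S}f)[\boldsymbol\phi]=\sum_{i=0}^{p+1}\mathcal A[\phi_{0,\varepsilon_i(0)}]\circ f[\phi_{\varepsilon_i(0),\varepsilon_i(1)},\dots,\phi_{\varepsilon_i(p-1),\varepsilon_i(p)}]\circ\mathcal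 A[\phi_{\varepsilon_i(p),p+1}]^{\otimes q}$, where $\varepsilon_i:\{0,\dots,p\}\to\{0,\dots,p+1\}$ is the strictly increasing map omitting $i$ (if $p=0$, the argument of $f$ is the object $x_{\varepsilon_i(0)}$); $\delta^{\mathrm H}f\in C^{p,q+1}$, $(\delta^{\mathrm H}f)[\boldsymbol\phi](a_1,\dots,a_{q+1})=\mathcal A[\phi_{0,p}](a_1)\,f[\boldsymbol\phi](a_2,\dots,a_{q+1})+\sum_{i=1}^qf[\boldsymbol\phi](a_1,\dots,a_ia_{i+1},\dots,a_{q+1})+f[\boldsymbol\phi](a_1,\dots,a_q)\,\mathcal A[\phi_{0,p}](a_{q+1})$. $H^\bullet(\mathcal A,\mathcal A)$ is the cohomology of the total complex with coboundary $\delta$. The composition product $\bar\circ$ is bilinear, and for $f\in C^{p_1,q_1}$, $g\in C^{p_2,q_2}$, $f\mathbin{\bar\circ}g=u+v$ where: $u\in C^{p_1+p_2,\,q_1+q_2-1}$, $$u[\boldsymbol\phi]=\sum_{i=1}^{q_1}f[\phi_1,\dots,\phi_{p_1}]\circ\bigl(\mathcal A[\phi_{p_1,p_1+p_2}]^{\otimes(i-1)}\otimes g[\phi_{p_1+1},\dots,\phi_{p_1+p_2}]\otimes\mathcal A[\phi_{p_1,p_1+p_2}]^{\otimes(q_1-i)}\bigr)$$ (for $p_1=0$ the argument of $f$ is the object $x_0$; for $p_2=0$ the argument of $g$ is $x_{p_1}$); and $v=0$ if $p_1=0$ or $p_2=0$, while otherwise $v\in C^{p',q_1+q_2}$ with $p'=p_1+p_2-1$,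 $$v[\boldsymbol\phi](a_1,\dots,a_{q_1+q_2})=\sum_{k=1}^{p_1}\mathcal A[\phi_{0,k-1}]\bigl(g[\phi_k,\dots,\phi_{k+p_2-1}](\mathcal A[\phi_{k+p_2-1,p'}]a_1,\dots,\mathcal A[\phi_{k+p_2-1,p'}]a_{q_2})\bigr)\cdot f[\phi_1,\dots,\phi_{k-1},\phi_{k-1,k+p_2-1},\phi_{k+p_2},\dots,\phi_{p'}](a_{q_2+1},\dots,a_{q_2+q_1}).$$ "Induces a function on cohomology" means that if $\delta f=0$ with $f$ of total degree $k$ then $\operatorname{Sq}(f)$ is a cocycle of total degree $2k-1$ whose cohomology class depends only on the class of $f$. *)

theory Defs
  imports "HOL-Algebra.Algebra"
begin

section \<open>Algebras, small categories, diagrams of algebras\<close>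

definition ring_characteristic :: "('k, 'r) ring_scheme \<Rightarrow> nat" where
  "ring_characteristic R = group.ord (add_monoid R) \<one>\<^bsub>R\<^esub>"

text \<open>An associative, not necessarily unital and not necessarily commutative algebra over a
  field. The record type has a field \<open>one\<close>, about which nothing is assumed and which is never
  used.\<close>

locale assoc_algebra = field R + module R M for R (structure) and M (structure) +
  assumes mult_closed:
      "\<lbrakk>x \<in> carrier M; y \<in> carrier M\<rbrakk> \<Longrightarrow> x \<otimes>\<^bsub>M\<^esub> y \<in> carrier M"
    and mult_assoc:
      "\<lbrakk>x \<in> carrier M; y \<in> carrier M; z \<in> carrier M\<rbrakk> \<Longrightarrow>
        (x \<otimes>\<^bsub>M\<^esub> y) \<otimes>\<^bsub>M\<^esub> z = x \<otimes>\<^bsub>M\<^esub> (y \<otimes>\<^bsub>M\<^esub> z)"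
    and mult_l_distr:
      "\<lbrakk>x \<in> carrier M; y \<in> carrier M; z \<in> carrier M\<rbrakk> \<Longrightarrow>
        (x \<oplus>\<^bsub>M\<^esub> y) \<otimes>\<^bsub>M\<^esub> z = x \<otimes>\<^bsub>M\<^esub> z \<oplus>\<^bsub>M\<^esub> y \<otimes>\<^bsub>M\<^esub> z"
    and mult_r_distr:
      "\<lbrakk>x \<in> carrier M; y \<in> carrier M; z \<in> carrier M\<rbrakk> \<Longrightarrow>
        x \<otimes>\<^bsub>M\<^esub> (y \<oplus>\<^bsub>M\<^esub> z) = x \<otimes>\<^bsub>M\<^esub> y \<oplus>\<^bsub>M\<^esub> x \<otimes>\<^bsub>M\<^esub> z"
    and smult_mult_l:
      "\<lbrakk>c \<in> carrier R; x \<in> carrier M; y \<in> carrier M\<rbrakk> \<Longrightarrow>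
        (c \<odot>\<^bsub>M\<^esub> x) \<otimes>\<^bsub>M\<^esub> y = c \<odot>\<^bsub>M\<^esub> (x \<otimes>\<^bsub>M\<^esub> y)"
    and smult_mult_r:
      "\<lbrakk>c \<in> carrier R; x \<in> carrier M; y \<in> carrier M\<rbrakk> \<Longrightarrow>
        x \<otimes>\<^bsub>M\<^esub> (c \<odot>\<^bsub>M\<^esub> y) = c \<odot>\<^bsub>M\<^esub> (x \<otimes>\<^bsub>M\<^esub> y)"

definition algebra_hom ::
    "'k ring \<Rightarrow> ('k, 'a) module \<Rightarrow> ('k, 'b) module \<Rightarrow> ('a \<Rightarrow> 'b) set" where
  "algebra_hom K M N = {h. h \<in> carrier M \<rightarrow> carrier N \<and>
     (\<forall>x\<in>carrier M. \<forall>y\<in>carrier M. h (x \<oplus>\<^bsub>M\<^esub> y) = h x \<oplus>\<^bsub>N\<^esub> h y) \<and>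
     (\<forall>c\<in>carrier K. \<forall>x\<in>carrier M. h (c \<odot>\<^bsub>M\<^esub> x) = c \<odot>\<^bsub>N\<^esub> h x) \<and>
     (\<forall>x\<in>carrier M. \<forall>y\<in>carrier M. h (x \<otimes>\<^bsub>M\<^esub> y) = h x \<otimes>\<^bsub>N\<^esub> h y)}"

text \<open>\<open>Comp C f g\<close> is \<open>f \<circ> g\<close>, defined when \<open>Dom C f = Cod C g\<close>.\<close>

record ('o, 'm) category =
  Obj :: "'o set"
  Arr :: "'m set"
  Dom :: "'m \<Rightarrow> 'o"
  Cod :: "'m \<Rightarrow> 'o"
  Id :: "'o \<Rightarrow> 'm"
  Comp :: "'m \<Rightarrow> 'm \<Rightarrow> 'm"

locale small_category =
  fixes C :: "('o, 'm) category"
  assumes Dom_closed: "f \<in> Arr C \<Longrightarrow> Dom C f \<in> Obj C"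
    and Cod_closed: "f \<in> Arr C \<Longrightarrow> Cod C f \<in> Obj C"
    and Id_closed: "x \<in> Obj C \<Longrightarrow> Id C x \<in> Arr C"
    and Dom_Id: "x \<in> Obj C \<Longrightarrow> Dom C (Id C x) = x"
    and Cod_Id: "x \<in> Obj C \<Longrightarrow> Cod C (Id C x) = x"
    and Comp_closed:
      "\<lbrakk>f \<in> Arr C; g \<in> Arr C; Dom C f = Cod C g\<rbrakk> \<Longrightarrow> Comp C f g \<in> Arr C"
    and Dom_Comp:
      "\<lbrakk>f \<in> Arr C; g \<in> Arr C; Dom C f = Cod C g\<rbrakk> \<Longrightarrow> Dom C (Comp C f g) = Dom C g"
    and Cod_Comp:
      "\<lbrakk>f \<in> Arr C; g \<in> Arr C; Dom C f = Cod C g\<rbrakk> \<Longrightarrow> Cod C (Comp C f g) = Cod C f"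
    and Comp_Id_left: "f \<in> Arr C \<Longrightarrow> Comp C (Id C (Cod C f)) f = f"
    and Comp_Id_right: "f \<in> Arr C \<Longrightarrow> Comp C f (Id C (Dom C f)) = f"
    and Comp_assoc:
      "\<lbrakk>f \<in> Arr C; g \<in> Arr C; h \<in> Arr C; Dom C f = Cod C g; Dom C g = Cod C h\<rbrakk> \<Longrightarrow>
        Comp C (Comp C f g) h = Comp C f (Comp C g h)"

record ('o, 'm, 'k, 'a) diagram =
  Alg :: "'o \<Rightarrow> ('k, 'a) module"
  Map :: "'m \<Rightarrow> 'a \<Rightarrow> 'a"

locale algebra_functor = field K + small_category C
  for K :: "'k ring" and C :: "('o, 'm) category" +
  fixes A :: "('o, 'm, 'k, 'a) diagram"
  assumes Alg_algebra: "x \<in> Obj C \<Longrightarrow> assoc_algebra K (Alg A x)"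
    and Map_hom:
      "f \<in> Arr C \<Longrightarrow> Map A f \<in> algebra_hom K (Alg A (Dom C f)) (Alg A (Cod C f))"
    and Map_Id: "\<lbrakk>x \<in> Obj C; a \<in> carrier (Alg A x)\<rbrakk> \<Longrightarrow> Map A (Id C x) a = a"
    and Map_Comp:
      "\<lbrakk>f \<in> Arr C; g \<in> Arr C; Dom C f = Cod C g; a \<in> carrier (Alg A (Dom C g))\<rbrakk> \<Longrightarrow>
        Map A (Comp C f g) a = Map A f (Map A g a)"


section \<open>Strings of composable arrows\<close>

text \<open>A string \<open>x\<^sub>0 \<leftarrow> x\<^sub>1 \<leftarrow> \<dots> \<leftarrow> x\<^sub>p\<close> is encoded as the pair of the object \<open>x\<^sub>0\<close> and the list
  \<open>[\<phi>\<^sub>1, \<dots>, \<phi>\<^sub>p]\<close>. The first component is redundant for \<open>p > 0\<close>; for \<open>p = 0\<close> it is the object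
  that the string consists of.\<close>

type_synonym ('o, 'm) str = "'o \<times> 'm list"

fun composable_from :: "('o, 'm) category \<Rightarrow> 'o \<Rightarrow> 'm list \<Rightarrow> bool" where
  "composable_from C x [] \<longleftrightarrow> x \<in> Obj C"
| "composable_from C x (f # fs) \<longleftrightarrow> f \<in> Arr C \<and> Cod C f = x \<and> composable_from C (Dom C f) fs"

definition strings :: "('o, 'm) category \<Rightarrow> nat \<Rightarrow> ('o, 'm) str set" where
  "strings C p = {\<phi>. length (snd \<phi>) = p \<and> composable_from C (fst \<phi>) (snd \<phi>)}"

definition vertex :: "('o, 'm) category \<Rightarrow> ('o, 'm) str \<Rightarrow> nat \<Rightarrow> 'o" where
  "vertex C \<phi> i = (if i = 0 then fst \<phi> else Dom C (snd \<phi> ! (i - 1)))"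

fun compose_from :: "('o, 'm) category \<Rightarrow> 'o \<Rightarrow> 'm list \<Rightarrow> 'm" where
  "compose_from C x [] = Id C x"
| "compose_from C x (f # fs) = Comp C f (compose_from C (Dom C f) fs)"

text \<open>\<open>sub_arrow C \<phi> k l\<close> is \<open>\<phi>\<^bsub>k,l\<^esub> = \<phi>\<^bsub>k+1\<^esub> \<circ> \<dots> \<circ> \<phi>\<^sub>l : x\<^sub>l \<rightarrow> x\<^sub>k\<close>, and
  \<open>sub_string C \<phi> k l\<close> is \<open>(\<phi>\<^bsub>k+1\<^esub>, \<dots>, \<phi>\<^sub>l)\<close>, the object \<open>x\<^sub>k\<close> if \<open>k = l\<close>.\<close>

definition sub_arrow :: "('o, 'm) category \<Rightarrow> ('o, 'm) str \<Rightarrow> nat \<Rightarrow> nat \<Rightarrow> 'm" where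
  "sub_arrow C \<phi> k l = compose_from C (vertex C \<phi> k) (take (l - k) (drop k (snd \<phi>)))"

definition sub_string :: "('o, 'm) category \<Rightarrow> ('o, 'm) str \<Rightarrow> nat \<Rightarrow> nat \<Rightarrow> ('o, 'm) str" where
  "sub_string C \<phi> k l = (vertex C \<phi> k, take (l - k) (drop k (snd \<phi>)))"

definition omit :: "nat \<Rightarrow> nat \<Rightarrow> nat" where
  "omit i j = (if j < i then j else Suc j)"

text \<open>The \<open>p\<close>-string \<open>(\<phi>\<^bsub>\<epsilon>(0),\<epsilon>(1)\<^esub>, \<dots>, \<phi>\<^bsub>\<epsilon>(p-1),\<epsilon>(p)\<^esub>)\<close>, the object \<open>x\<^bsub>\<epsilon>(0)\<^esub>\<close> if \<open>p = 0\<close>.\<close>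

definition reindex ::
    "('o, 'm) category \<Rightarrow> nat \<Rightarrow> (nat \<Rightarrow> nat) \<Rightarrow> ('o, 'm) str \<Rightarrow> ('o, 'm) str" where
  "reindex C p \<epsilon> \<phi> =
     (vertex C \<phi> (\<epsilon> 0), map (\<lambda>j. sub_arrow C \<phi> (\<epsilon> j) (\<epsilon> (Suc j))) [0..<p])"

text \<open>The string \<open>(\<phi>\<^sub>1, \<dots>, \<phi>\<^sub>k, \<phi>\<^bsub>k,l\<^esub>, \<phi>\<^bsub>l+1\<^esub>, \<dots>, \<phi>\<^sub>p)\<close>, where \<open>p\<close> is the length of \<open>\<phi>\<close>.\<close>

definition contract ::
    "('o, 'm) category \<Rightarrow> nat \<Rightarrow> nat \<Rightarrow> ('o, 'm) str \<Rightarrow> ('o, 'm) str" where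
  "contract C k l \<phi> = (fst \<phi>, take k (snd \<phi>) @ [sub_arrow C \<phi> k l] @ drop l (snd \<phi>))"


section \<open>The Hochschild bicomplex\<close>

text \<open>\<open>Hom(M\<^sup>\<otimes>\<^sup>q, N)\<close> is represented by the \<open>K\<close>-multilinear maps of \<open>q\<close> arguments, given as an
  argument list of length \<open>q\<close>; for \<open>q = 0\<close> this is \<open>Hom(K, N) = N\<close>. Maps are extensional (equal
  to \<open>undefined\<close> off their domain), so that equality of functions is equality of cochains.\<close>

definition tuples :: "('k, 'a) module \<Rightarrow> nat \<Rightarrow> 'a list set" where
  "tuples M q = {as. length as = q \<and> set as \<subseteq> carrier M}"

definition multilinear_maps ::
    "'k ring \<Rightarrow> nat \<Rightarrow> ('k, 'a) module \<Rightarrow> ('k, 'b) module \<Rightarrow> ('a list \<Rightarrow> 'b) set" where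
  "multilinear_maps K q M N = {h \<in> tuples M q \<rightarrow>\<^sub>E carrier N.
     \<forall>as\<in>tuples M q. \<forall>i<q.
       (\<forall>x\<in>carrier M. \<forall>y\<in>carrier M.
          h (as[i := x \<oplus>\<^bsub>M\<^esub> y]) = h (as[i := x]) \<oplus>\<^bsub>N\<^esub> h (as[i := y])) \<and>
       (\<forall>c\<in>carrier K. \<forall>x\<in>carrier M.
          h (as[i := c \<odot>\<^bsub>M\<^esub> x]) = c \<odot>\<^bsub>N\<^esub> h (as[i := x]))}"

type_synonym ('o, 'm, 'a) cochain = "('o, 'm) str \<Rightarrow> 'a list \<Rightarrow> 'a"

definition cochains ::
    "'k ring \<Rightarrow> ('o, 'm) category \<Rightarrow> ('o, 'm, 'k, 'a) diagram \<Rightarrow> nat \<Rightarrow> nat \<Rightarrow>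
     ('o, 'm, 'a) cochain set" where
  "cochains K C A p q =
     (\<Pi>\<^sub>E \<phi>\<in>strings C p. multilinear_maps K q (Alg A (vertex C \<phi> p)) (Alg A (vertex C \<phi> 0)))"

definition mk_cochain ::
    "('o, 'm) category \<Rightarrow> ('o, 'm, 'k, 'a) diagram \<Rightarrow> nat \<Rightarrow> nat \<Rightarrow>
     ('o, 'm, 'a) cochain \<Rightarrow> ('o, 'm, 'a) cochain" where
  "mk_cochain C A p q f = (\<lambda>\<phi>\<in>strings C p. \<lambda>as\<in>tuples (Alg A (vertex C \<phi> p)) q. f \<phi> as)"

definition zero_cochain ::
    "('o, 'm) category \<Rightarrow> ('o, 'm, 'k, 'a) diagram \<Rightarrow> nat \<Rightarrow> nat \<Rightarrow> ('o, 'm, 'a) cochain" where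
  "zero_cochain C A p q = mk_cochain C A p q (\<lambda>\<phi> as. \<zero>\<^bsub>Alg A (vertex C \<phi> 0)\<^esub>)"

definition add_cochain ::
    "('o, 'm) category \<Rightarrow> ('o, 'm, 'k, 'a) diagram \<Rightarrow> nat \<Rightarrow> nat \<Rightarrow>
     ('o, 'm, 'a) cochain \<Rightarrow> ('o, 'm, 'a) cochain \<Rightarrow> ('o, 'm, 'a) cochain" where
  "add_cochain C A p q f g =
     mk_cochain C A p q (\<lambda>\<phi> as. f \<phi> as \<oplus>\<^bsub>Alg A (vertex C \<phi> 0)\<^esub> g \<phi> as)"

text \<open>The simplicial and the Hochschild coboundary of \<open>f \<in> C\<^bsup>p,q\<^esup>\<close>, in the sign-free form that
  is valid in characteristic 2. The entries \<open>a\<^sub>1, a\<^sub>2, \<dots>\<close> of an argument list \<open>as\<close> are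
  \<open>as ! 0, as ! 1, \<dots>\<close>.\<close>

definition delta_S ::
    "('o, 'm) category \<Rightarrow> ('o, 'm, 'k, 'a) diagram \<Rightarrow> nat \<Rightarrow> nat \<Rightarrow>
     ('o, 'm, 'a) cochain \<Rightarrow> ('o, 'm, 'a) cochain" where
  "delta_S C A p q f = mk_cochain C A (Suc p) q (\<lambda>\<phi> as.
     \<Oplus>\<^bsub>Alg A (vertex C \<phi> 0)\<^esub> i \<in> {0..Suc p}.
       Map A (sub_arrow C \<phi> 0 (omit i 0))
         (f (reindex C p (omit i) \<phi>)
            (map (Map A (sub_arrow C \<phi> (omit i p) (Suc p))) as)))"

definition delta_H ::
    "('o, 'm) category \<Rightarrow> ('o, 'm, 'k, 'a) diagram \<Rightarrow> nat \<Rightarrow> nat \<Rightarrow>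
     ('o, 'm, 'a) cochain \<Rightarrow> ('o, 'm, 'a) cochain" where
  "delta_H C A p q f = mk_cochain C A p (Suc q) (\<lambda>\<phi> as.
     let B = Alg A (vertex C \<phi> 0); T = Map A (sub_arrow C \<phi> 0 p) in
       T (as ! 0) \<otimes>\<^bsub>B\<^esub> f \<phi> (drop 1 as)
       \<oplus>\<^bsub>B\<^esub> (\<Oplus>\<^bsub>B\<^esub> i \<in> {1..q}.
             f \<phi> (take (i - 1) as @ [as ! (i - 1) \<otimes>\<^bsub>Alg A (vertex C \<phi> p)\<^esub> as ! i] @ drop (i + 1) as))
       \<oplus>\<^bsub>B\<^esub> f \<phi> (take q as) \<otimes>\<^bsub>B\<^esub> T (as ! q))"

text \<open>The components of bidegree \<open>(p\<^sub>1 + p\<^sub>2, q\<^sub>1 + q\<^sub>2 - 1)\<close> and \<open>(p\<^sub>1 + p\<^sub>2 - 1, q\<^sub>1 + q\<^sub>2)\<close> of the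
  composition product of \<open>f \<in> C\<^bsup>p\<^sub>1,q\<^sub>1\<^esup>\<close> and \<open>g \<in> C\<^bsup>p\<^sub>2,q\<^sub>2\<^esup>\<close>. They are only used for
  \<open>q\<^sub>1 + q\<^sub>2 > 0\<close> and for \<open>p\<^sub>1, p\<^sub>2 > 0\<close> respectively: otherwise the component does not contribute.\<close>

definition comp_u ::
    "('o, 'm) category \<Rightarrow> ('o, 'm, 'k, 'a) diagram \<Rightarrow> nat \<Rightarrow> nat \<Rightarrow> nat \<Rightarrow> nat \<Rightarrow>
     ('o, 'm, 'a) cochain \<Rightarrow> ('o, 'm, 'a) cochain \<Rightarrow> ('o, 'm, 'a) cochain" where
  "comp_u C A p1 q1 p2 q2 f g = mk_cochain C A (p1 + p2) (q1 + q2 - 1) (\<lambda>\<phi> as.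
     let T = Map A (sub_arrow C \<phi> p1 (p1 + p2)) in
     \<Oplus>\<^bsub>Alg A (vertex C \<phi> 0)\<^esub> i \<in> {1..q1}.
       f (sub_string C \<phi> 0 p1)
         (map T (take (i - 1) as)
          @ [g (sub_string C \<phi> p1 (p1 + p2)) (take q2 (drop (i - 1) as))]
          @ map T (drop (i - 1 + q2) as)))"

definition comp_v ::
    "('o, 'm) category \<Rightarrow> ('o, 'm, 'k, 'a) diagram \<Rightarrow> nat \<Rightarrow> nat \<Rightarrow> nat \<Rightarrow> nat \<Rightarrow>
     ('o, 'm, 'a) cochain \<Rightarrow> ('o, 'm, 'a) cochain \<Rightarrow> ('o, 'm, 'a) cochain" where
  "comp_v C A p1 q1 p2 q2 f g = mk_cochain C A (p1 + p2 - 1) (q1 + q2) (\<lambda>\<phi> as.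
     let B = Alg A (vertex C \<phi> 0); p' = p1 + p2 - 1 in
     \<Oplus>\<^bsub>B\<^esub> k \<in> {1..p1}.
       Map A (sub_arrow C \<phi> 0 (k - 1))
         (g (sub_string C \<phi> (k - 1) (k + p2 - 1))
            (map (Map A (sub_arrow C \<phi> (k + p2 - 1) p')) (take q2 as)))
       \<otimes>\<^bsub>B\<^esub> f (contract C (k - 1) (k + p2 - 1) \<phi>) (drop q2 as))"


section \<open>The total complex and its cohomology\<close>

text \<open>A cochain of total degree \<open>k\<close> is the family of its bihomogeneous components, which vanish
  unless \<open>p + q = k\<close>. There are no nonzero ones for \<open>k < 0\<close>.\<close>

type_synonym ('o, 'm, 'a) total_cochain = "nat \<Rightarrow> nat \<Rightarrow> ('o, 'm, 'a) cochain"

definition total_cochains ::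
    "'k ring \<Rightarrow> ('o, 'm) category \<Rightarrow> ('o, 'm, 'k, 'a) diagram \<Rightarrow> int \<Rightarrow>
     ('o, 'm, 'a) total_cochain set" where
  "total_cochains K C A k = {F. \<forall>p q.
     F p q \<in> cochains K C A p q \<and> (int p + int q \<noteq> k \<longrightarrow> F p q = zero_cochain C A p q)}"

definition total_zero ::
    "('o, 'm) category \<Rightarrow> ('o, 'm, 'k, 'a) diagram \<Rightarrow> ('o, 'm, 'a) total_cochain" where
  "total_zero C A = (\<lambda>p q. zero_cochain C A p q)"

definition total_add ::
    "('o, 'm) category \<Rightarrow> ('o, 'm, 'k, 'a) diagram \<Rightarrow>
     ('o, 'm, 'a) total_cochain \<Rightarrow> ('o, 'm, 'a) total_cochain \<Rightarrow> ('o, 'm, 'a) total_cochain" where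
  "total_add C A F G = (\<lambda>p q. add_cochain C A p q (F p q) (G p q))"

definition delta ::
    "('o, 'm) category \<Rightarrow> ('o, 'm, 'k, 'a) diagram \<Rightarrow>
     ('o, 'm, 'a) total_cochain \<Rightarrow> ('o, 'm, 'a) total_cochain" where
  "delta C A F = (\<lambda>p q. add_cochain C A p q
     (case p of 0 \<Rightarrow> zero_cochain C A p q | Suc p' \<Rightarrow> delta_S C A p' q (F p' q))
     (case q of 0 \<Rightarrow> zero_cochain C A p q | Suc q' \<Rightarrow> delta_H C A p q' (F p q')))"

text \<open>The bilinear extension of the composition product: the component of bidegree \<open>(p, q)\<close>
  collects the contributions of all pairs of components of \<open>F\<close> and \<open>G\<close>.\<close>

definition comp_product ::
    "('o, 'm) category \<Rightarrow> ('o, 'm, 'k, 'a) diagram \<Rightarrow>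
     ('o, 'm, 'a) total_cochain \<Rightarrow> ('o, 'm, 'a) total_cochain \<Rightarrow> ('o, 'm, 'a) total_cochain" where
  "comp_product C A F G = (\<lambda>p q. mk_cochain C A p q (\<lambda>\<phi> as.
     let B = Alg A (vertex C \<phi> 0) in
     finsum B (\<lambda>(p1, q1, p2, q2). comp_u C A p1 q1 p2 q2 (F p1 q1) (G p2 q2) \<phi> as)
       {(p1, q1, p2, q2). p1 + p2 = p \<and> q1 + q2 = q + 1}
     \<oplus>\<^bsub>B\<^esub>
     finsum B (\<lambda>(p1, q1, p2, q2). comp_v C A p1 q1 p2 q2 (F p1 q1) (G p2 q2) \<phi> as)
       {(p1, q1, p2, q2). p1 > 0 \<and> p2 > 0 \<and> p1 + p2 = p + 1 \<and> q1 + q2 = q}))"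

definition Sq ::
    "('o, 'm) category \<Rightarrow> ('o, 'm, 'k, 'a) diagram \<Rightarrow>
     ('o, 'm, 'a) total_cochain \<Rightarrow> ('o, 'm, 'a) total_cochain" where
  "Sq C A F = comp_product C A F F"

text \<open>The additive group of cocycles, written as a (multiplicative) group record so that the
  quotient \<open>Mod\<close> applies.\<close>

definition cocycles ::
    "'k ring \<Rightarrow> ('o, 'm) category \<Rightarrow> ('o, 'm, 'k, 'a) diagram \<Rightarrow> int \<Rightarrow>
     ('o, 'm, 'a) total_cochain monoid" where
  "cocycles K C A k =
     \<lparr>carrier = {F \<in> total_cochains K C A k. delta C A F = total_zero C A},
      monoid.mult = total_add C A, one = total_zero C A\<rparr>"

definition coboundaries ::
    "'k ring \<Rightarrow> ('o, 'm) category \<Rightarrow> ('o, 'm, 'k, 'a) diagram \<Rightarrow> int \<Rightarrow>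
     ('o, 'm, 'a) total_cochain set" where
  "coboundaries K C A k = delta C A ` total_cochains K C A (k - 1)"

definition cohomology ::
    "'k ring \<Rightarrow> ('o, 'm) category \<Rightarrow> ('o, 'm, 'k, 'a) diagram \<Rightarrow> int \<Rightarrow>
     ('o, 'm, 'a) total_cochain set monoid" where
  "cohomology K C A k = cocycles K C A k Mod coboundaries K C A k"

definition cohomology_class ::
    "'k ring \<Rightarrow> ('o, 'm) category \<Rightarrow> ('o, 'm, 'k, 'a) diagram \<Rightarrow> int \<Rightarrow>
     ('o, 'm, 'a) total_cochain \<Rightarrow> ('o, 'm, 'a) total_cochain set" where
  "cohomology_class K C A k F = coboundaries K C A k #>\<^bsub>cocycles K C A k\<^esub> F"

end

theory Submission
  imports Defs "HOL-Library.Z2"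
begin

text \<open>Let \<open>\<smile>\<close> be the cup product. In characteristic 2,
  \<open>\<delta>(F \<circ> G) = \<delta>F \<circ> G + F \<circ> \<delta>G + F \<smile> G + G \<smile> F\<close>: the component \<open>u\<close> moves the factor \<open>G\<close> of
  \<open>F \<smile> G\<close> past the arguments of \<open>F\<close>, the component \<open>v\<close> moves it past the arrows of \<open>F\<close>, and the mixed
  product in between arises from both and cancels. So \<open>\<delta>(F \<circ> F) = 0\<close> for a cocycle \<open>F\<close>, and since \<open>\<delta>\<close>
  is a derivation of \<open>\<smile>\<close> with \<open>\<delta>\<delta> = 0\<close>,
  \<open>Sq(F + \<delta>h) = Sq(F) + \<delta>(F \<circ> h + h \<circ> F + h \<circ> \<delta>h + h \<smile> h)\<close>.

  The identities are verified after composing with the additive maps from an algebra to the field with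
  two elements, which separate points. All sums are then sums of bits, over the ways to cut the word of
  arrows or of arguments, or to multiply two adjacent letters of it.\<close>


section \<open>Sums over words in characteristic 2\<close>

text \<open>Faces and one-sided multiplications act on the value of a cochain. Testing
  \<open>Map A f v\<close> with \<chi> is testing \<open>v\<close> with the composite of \<chi> and
  \<open>Map A f\<close>, so such an operation is absorbed by the additive map. This is why \<chi>
  is an argument of every evaluation: \<open>DS\<close> and \<open>DH\<close> become operators on
  arbitrary bit-valued formulas and can be applied to \<open>cup_val\<close>, \<open>u_val\<close>
  and \<open>v_val\<close> directly. Additive maps prove equations only; that a formula defines a
  cochain is a separate matter of \<open>K\<close>-multilinearity.

  The obstacle is the component \<open>v\<close>. It contracts a nonempty string only, so the faces
  of its inner cochain that end at a bare object have no partner in it. These leftovers telescope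
  along the string, and the two ends of the telescope are exactly the summands that the two products
  arising from \<open>v\<close> would otherwise lack.

  Degrees are kept apart from the identities. These hold for arbitrary families of components;
  homogeneity is checked afterwards, as vanishing off a total length.\<close>

lemma bit_add_same [simp]: "(a::bit) + a = 0" "(a::bit) + (a + b) = b"
  by (cases a; cases b; simp)+

declare add_bit_eq_xor [simp del] \<comment> \<open>it turns sums of bits into case distinctions\<close>

text \<open>The recursion passes the first letter on to the summand, so identities follow by
  induction on the word with an arbitrary summand. Index arithmetic is confined to the comparison
  with indexed sums.\<close>

primrec split_sum :: "('a list \<Rightarrow> 'a list \<Rightarrow> bit) \<Rightarrow> 'a list \<Rightarrow> bit" where
  "split_sum h [] = h [] []"
| "split_sum h (x # xs) = h [] (x # xs) + split_sum (\<lambda>a. h (x # a)) xs"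

fun pair_sum :: "('a \<Rightarrow> 'a \<Rightarrow> 'a) \<Rightarrow> ('a list \<Rightarrow> bit) \<Rightarrow> 'a list \<Rightarrow> bit" where
  "pair_sum m h (x # y # zs) = h (m x y # zs) + pair_sum m (\<lambda>w. h (x # w)) (y # zs)"
| "pair_sum m h xs = 0"

text \<open>The value 0 at the empty word matches the zero cochains in \<open>delta\<close>: an
  object has no simplicial faces, an empty argument list no Hochschild faces.\<close>

fun head_sum :: "('a \<Rightarrow> 'a list \<Rightarrow> bit) \<Rightarrow> 'a list \<Rightarrow> bit" where
  "head_sum h [] = 0"
| "head_sum h (x # xs) = h x xs"

definition last_sum :: "('a list \<Rightarrow> 'a \<Rightarrow> bit) \<Rightarrow> 'a list \<Rightarrow> bit" where
  "last_sum h xs = (if xs = [] then 0 else h (butlast xs) (last xs))"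

lemma last_sum_Nil [simp]: "last_sum h [] = 0"
  by (simp add: last_sum_def)

lemma last_sum_snoc [simp]: "last_sum h (xs @ [x]) = h xs x"
  by (simp add: last_sum_def)

lemma last_sum_Cons:
  "last_sum h (x # xs) = (if xs = [] then h [] x else last_sum (\<lambda>ys. h (x # ys)) xs)"
  by (simp add: last_sum_def)

text \<open>The hypothesis receives the decomposition of the word; composability of the factors and
  the types of the arguments are later read off from it.\<close>

lemma split_sum_cong:
  "(\<And>a b. xs = a @ b \<Longrightarrow> h a b = h' a b) \<Longrightarrow> split_sum h xs = split_sum h' xs"
proof (induction xs arbitrary: h h')
  case (Cons x xs)
  have "split_sum (\<lambda>a. h (x # a)) xs = split_sum (\<lambda>a. h' (x # a)) xs"
    using Cons.prems[of "x # _"] by (intro Cons.IH) simp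
  then show ?case using Cons.prems[of "[]"] by simp
qed simp

lemma pair_sum_cong:
  "(\<And>l x y r. xs = l @ x # y # r \<Longrightarrow> h (l @ m x y # r) = h' (l @ m' x y # r)) \<Longrightarrow>
     pair_sum m h xs = pair_sum m' h' xs"
proof (induction m h xs arbitrary: h' rule: pair_sum.induct)
  case (1 m h x y zs)
  have "h (m x y # zs) = h' (m' x y # zs)"
    using "1.prems"[of "[]"] by simp
  moreover have "pair_sum m (\<lambda>w. h (x # w)) (y # zs) = pair_sum m' (\<lambda>w. h' (x # w)) (y # zs)"
    using "1.prems"[of "x # _"] by (intro "1.IH") simp
  ultimately show ?case by simp
qed auto

lemma head_sum_cong:
  "(\<And>x b. xs = x # b \<Longrightarrow> h x b = h' x b) \<Longrightarrow> head_sum h xs = head_sum h' xs"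
  by (cases xs) auto

lemma last_sum_cong:
  "(\<And>b x. xs = b @ [x] \<Longrightarrow> h b x = h' b x) \<Longrightarrow> last_sum h xs = last_sum h' xs"
  by (cases xs rule: rev_cases) auto

lemma split_sum_add: "split_sum (\<lambda>a b. h a b + k a b) xs = split_sum h xs + split_sum k xs"
  by (induction xs arbitrary: h k) (simp_all add: ac_simps)

lemma pair_sum_add: "pair_sum m (\<lambda>w. h w + k w) xs = pair_sum m h xs + pair_sum m k xs"
proof (induction xs arbitrary: h k rule: induct_list012)
  case (3 x y zs)
  show ?case using "3.IH"(2)[of "\<lambda>w. h (x # w)" "\<lambda>w. k (x # w)"] by (simp add: ac_simps)
qed simp_all

lemma head_sum_add: "head_sum (\<lambda>a b. h a b + k a b) xs = head_sum h xs + head_sum k xs"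
  by (cases xs) simp_all

lemma last_sum_add: "last_sum (\<lambda>a b. h a b + k a b) xs = last_sum h xs + last_sum k xs"
  by (cases xs rule: rev_cases) simp_all

lemmas word_sum_add = split_sum_add pair_sum_add head_sum_add last_sum_add

lemma split_sum_0 [simp]: "split_sum (\<lambda>a b. 0) xs = 0"
  by (induction xs) simp_all

lemma pair_sum_0 [simp]: "pair_sum m (\<lambda>w. 0) xs = 0"
  by (induction m "\<lambda>w::'a list. 0::bit" xs rule: pair_sum.induct) simp_all

lemma head_sum_0 [simp]: "head_sum (\<lambda>a b. 0) xs = 0"
  by (cases xs) simp_all

lemma last_sum_0 [simp]: "last_sum (\<lambda>a b. 0) xs = 0"
  by (simp add: last_sum_def)

section \<open>Interchanging sums over two independent words\<close>

lemma split_split_swap: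
  "split_sum (\<lambda>a b. split_sum (h a b) ys) xs = split_sum (\<lambda>c d. split_sum (\<lambda>a b. h a b c d) xs) ys"
  by (induction ys arbitrary: h) (simp_all add: split_sum_add)

lemma split_pair_swap:
  "split_sum (\<lambda>a b. pair_sum m (h a b) ys) xs = pair_sum m (\<lambda>w. split_sum (\<lambda>a b. h a b w) xs) ys"
proof (induction ys arbitrary: h rule: induct_list012)
  case (3 y z zs)
  from "3.IH"(2)[of "\<lambda>a b w. h a b (y # w)"] show ?case by (simp add: split_sum_add)
qed simp_all

lemma pair_pair_swap:
  "pair_sum m (\<lambda>w. pair_sum m' (h w) ys) xs = pair_sum m' (\<lambda>v. pair_sum m (\<lambda>w. h w v) xs) ys"
proof (induction ys arbitrary: h rule: induct_list012)
  case (3 y z zs)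
  from "3.IH"(2)[of "\<lambda>w v. h w (y # v)"] show ?case by (simp add: pair_sum_add)
qed simp_all

lemma split_head_swap:
  "split_sum (\<lambda>a b. head_sum (h a b) ys) xs = head_sum (\<lambda>c d. split_sum (\<lambda>a b. h a b c d) xs) ys"
  by (cases ys) simp_all

lemma split_last_swap:
  "split_sum (\<lambda>a b. last_sum (h a b) ys) xs = last_sum (\<lambda>c d. split_sum (\<lambda>a b. h a b c d) xs) ys"
  by (cases ys rule: rev_cases) simp_all

lemma pair_head_swap:
  "pair_sum m (\<lambda>a. head_sum (h a) ys) xs = head_sum (\<lambda>c d. pair_sum m (\<lambda>a. h a c d) xs) ys"
  by (cases ys) simp_all

lemma pair_last_swap:
  "pair_sum m (\<lambda>a. last_sum (h a) ys) xs = last_sum (\<lambda>c d. pair_sum m (\<lambda>a. h a c d) xs) ys"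
  by (cases ys rule: rev_cases) simp_all

text \<open>Moving the cut over one letter turns the last letter of the first word into the first
  letter of the second. On either side, the one cut without such a letter contributes 0.\<close>

lemma split_sum_last_head:
  "split_sum (\<lambda>a b. last_sum (\<lambda>a' x. h a' x b) a) xs = split_sum (\<lambda>a b. head_sum (h a) b) xs"
proof (induction xs arbitrary: h)
  case (Cons x xs)
  show ?case
  proof (cases xs)
    case (Cons y ys)
    then show ?thesis using Cons.IH[of "\<lambda>a. h (x # a)"] Cons
      by (simp add: last_sum_Cons if_distrib[of "\<lambda>z. z + _"])
  qed (simp add: last_sum_Cons)
qed simp

lemma head_split:
  "head_sum (\<lambda>x. split_sum (h x)) xs = split_sum (\<lambda>a b. head_sum (\<lambda>x a'. h x a' b) a) xs"
  by (cases xs) simp_all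

lemma last_split:
  "last_sum (\<lambda>xs' x. split_sum (\<lambda>a b. h a b x) xs') xs =
     split_sum (\<lambda>a b. last_sum (\<lambda>b' x. h a b' x) b) xs"
proof (induction xs arbitrary: h)
  case (Cons x xs)
  show ?case
    using Cons.IH[of "\<lambda>a. h (x # a)"]
    by (cases xs rule: rev_cases) (simp_all add: last_sum_Cons)
qed simp

text \<open>A cut of a contracted word never passes through the new letter, so the contracted pair
  lies entirely in one of the two words.\<close>

lemma pair_split:
  "pair_sum m (split_sum h) xs =
     split_sum (\<lambda>a b. pair_sum m (\<lambda>a'. h a' b) a + pair_sum m (h a) b) xs"
proof (induction xs arbitrary: h rule: induct_list012)
  case (3 x y zs)
  show ?case using "3.IH"(2)[of "\<lambda>a. h (x # a)"]
    by (simp add: pair_sum_add split_sum_add ac_simps)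
qed simp_all

text \<open>The terms \<open>mid\<close> cancel: a letter next to the cut ends the first word of one cut and starts the
  second word of the next.\<close>

lemma cut_leibniz:
  "head_sum (\<lambda>x. split_sum (h x)) xs + last_sum (\<lambda>xs' x. split_sum (\<lambda>a b. l a b x) xs') xs +
     pair_sum m (split_sum k) xs =
   split_sum (\<lambda>a b.
     head_sum (\<lambda>x a'. h x a' b) a + last_sum (\<lambda>a' x. mid a' x b) a + pair_sum m (\<lambda>a'. k a' b) a +
     (head_sum (mid a) b + last_sum (l a) b + pair_sum m (k a) b)) xs"
  unfolding head_split last_split pair_split by (simp add: word_sum_add split_sum_last_head ac_simps)

lemma split_sum_if_Nil:
  "split_sum (\<lambda>a b. if a = [] then h a b else 0) xs = h [] xs"
  "split_sum (\<lambda>a b. if b = [] then h a b else 0) xs = h xs []"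
  by (induction xs arbitrary: h) simp_all

section \<open>Words with a marked letter\<close>

lemma head_sum_append:
  "head_sum k (a @ v # c) = head_sum (\<lambda>x a'. k x (a' @ v # c)) a + (if a = [] then k v c else 0)"
  by (cases a) simp_all

lemma last_sum_append:
  "last_sum k (a @ v # c) = last_sum (\<lambda>c' x. k (a @ v # c') x) c + (if c = [] then k a v else 0)"
  by (cases c rule: rev_cases) (simp_all add: last_sum_def butlast_append)

text \<open>The marked letter \<open>v\<close> will be the value of an inserted cochain or a
  composite arrow. The last two sums are the products that involve it: there the faces of the outer
  cochain meet those of the inner one.\<close>

lemma pair_sum_append:
  "pair_sum m k (a @ v # c) =
     pair_sum m (\<lambda>a'. k (a' @ v # c)) a + pair_sum m (\<lambda>c'. k (a @ v # c')) c +
     last_sum (\<lambda>a' x. k (a' @ m x v # c)) a + head_sum (\<lambda>y c'. k (a @ m v y # c')) c"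
proof (induction a arbitrary: k rule: induct_list012)
  case 1
  show ?case by (cases c) (simp_all add: ac_simps)
next
  case (2 x)
  show ?case by (cases c) (simp_all add: last_sum_Cons ac_simps)
next
  case (3 x y zs)
  show ?case using "3.IH"(2)[of "\<lambda>w. k (x # w)"]
    by (simp add: last_sum_Cons ac_simps)
qed

text \<open>Multiplicativity of \<open>t\<close> is asked for letters of the word only, because a
  structure map is a homomorphism only on a carrier.\<close>

lemma pair_sum_map:
  assumes "\<And>x y. x \<in> set a \<Longrightarrow> y \<in> set a \<Longrightarrow> m (t x) (t y) = t (m' x y)"
  shows "pair_sum m k (map t a) = pair_sum m' (\<lambda>w. k (map t w)) a"
proof -
  have "pair_sum m k (map t a) = pair_sum m' (\<lambda>w. k (map t w)) a"
    if "\<And>l x y r. a = l @ x # y # r \<Longrightarrow> m (t x) (t y) = t (m' x y)"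
    using that
  proof (induction a arbitrary: k rule: induct_list012)
    case (3 x y zs)
    have "pair_sum m (\<lambda>w. k (t x # w)) (map t (y # zs)) = pair_sum m' (\<lambda>w. k (map t (x # w))) (y # zs)"
      using "3.IH"(2)[of "\<lambda>w. k (t x # w)"] "3.prems"[of "x # _"] by simp
    then show ?case using "3.prems"[of "[]"] by simp
  qed simp_all
  then show ?thesis using assms by simp
qed

lemma head_sum_map: "head_sum k (map t a) = head_sum (\<lambda>x a'. k (t x) (map t a')) a"
  by (cases a) simp_all

lemma last_sum_map: "last_sum k (map t a) = last_sum (\<lambda>a' x. k (map t a') (t x)) a"
  by (cases a rule: rev_cases) simp_all

section \<open>Two successive faces of a word: the simplicial identities modulo 2\<close>

lemma head_pair:
  "pair_sum m (head_sum k) xs =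
     head_sum (\<lambda>x. pair_sum m (k x)) xs + head_sum (\<lambda>x. head_sum (\<lambda>y. k (m x y))) xs"
proof (cases xs)
  case (Cons x ys)
  then show ?thesis by (cases ys) (simp_all add: ac_simps)
qed simp

lemma last_pair:
  "pair_sum m (last_sum k) xs =
     last_sum (\<lambda>xs' x. pair_sum m (\<lambda>w. k w x) xs') xs +
     last_sum (\<lambda>xs' y. last_sum (\<lambda>zs x. k zs (m x y)) xs') xs"
proof (induction xs arbitrary: k rule: induct_list012)
  case (3 x y zs)
  then show ?case
  proof (cases zs)
    case (Cons z zs')
    then show ?thesis
      using "3.IH"(2)[of "\<lambda>w. k (x # w)"]
      by (simp add: last_sum_Cons pair_sum_add last_sum_add ac_simps)
  qed (simp add: last_sum_Cons)
qed (simp_all add: last_sum_Cons)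

lemma head_last:
  "head_sum (\<lambda>x. last_sum (\<lambda>m y. k x m y)) xs = last_sum (\<lambda>xs' y. head_sum (\<lambda>x m. k x m y) xs') xs"
  by (cases xs; cases "tl xs" rule: rev_cases) (auto simp: last_sum_Cons last_sum_def)

text \<open>Two disjoint contractions occur in both orders and cancel; the two ways to contract
  three consecutive letters agree by associativity and cancel as well.\<close>

lemma pair_pair:
  assumes "\<And>l x y z r. xs = l @ x # y # z # r \<Longrightarrow> m (m x y) z = m x (m y z)"
  shows "pair_sum m (pair_sum m h) xs = 0"
  using assms
proof (induction xs arbitrary: h rule: induct_list012)
  case (3 x y zs)
  show ?case
  proof (cases zs)
    case (Cons z zs')
    have IH: "pair_sum m (\<lambda>w. pair_sum m (\<lambda>v. h (x # v)) w) (y # zs) = 0"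
      using "3.prems"[of "x # _"] by (intro "3.IH"(2)) simp
    \<comment> \<open>A pair in \<open>x # w\<close> either contains \<open>x\<close>, and then
      involves only the head of \<open>w\<close>, or lies in \<open>w\<close>, where induction
      applies.\<close>
    have "pair_sum m (\<lambda>w. pair_sum m h (x # w)) (y # zs) =
      pair_sum m (\<lambda>w. head_sum (\<lambda>a b. h (m x a # b)) w + pair_sum m (\<lambda>v. h (x # v)) w) (y # zs)"
    proof (rule pair_sum_cong)
      fix l u v r
      show "pair_sum m h (x # l @ m u v # r) =
          head_sum (\<lambda>a b. h (m x a # b)) (l @ m u v # r) +
          pair_sum m (\<lambda>w. h (x # w)) (l @ m u v # r)"
        by (cases l) simp_all
    qed
    also have "\<dots> = pair_sum m (head_sum (\<lambda>a b. h (m x a # b))) (y # zs)"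
      by (simp add: pair_sum_add IH)
    finally show ?thesis
      using Cons "3.prems"[of "[]" x y z zs'] by (simp add: head_pair)
  qed simp
qed simp_all

section \<open>Comparison with indexed sums\<close>

lemma split_sum_conv: "split_sum h xs = (\<Sum>i\<in>{0..length xs}. h (take i xs) (drop i xs))"
proof (induction xs arbitrary: h)
  case (Cons x xs)
  show ?case
    unfolding split_sum.simps Cons.IH length_Cons sum.atLeast0_atMost_Suc_shift by simp
qed simp

lemma pair_sum_conv:
  "pair_sum m h xs =
     (\<Sum>i\<in>{1..length xs - 1}. h (take (i - 1) xs @ m (xs ! (i - 1)) (xs ! i) # drop (i + 1) xs))"
proof -
  have "pair_sum m h xs =
     (\<Sum>i<length xs - 1. h (take i xs @ m (xs ! i) (xs ! Suc i) # drop (i + 2) xs))"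
  proof (induction xs arbitrary: h rule: induct_list012)
    case (3 x y zs)
    from "3.IH"(2)[of "\<lambda>w. h (x # w)"] show ?case
      by (simp add: sum.lessThan_Suc_shift del: sum.lessThan_Suc)
  qed simp_all
  also have "\<dots> =
     (\<Sum>i\<in>{1..length xs - 1}. h (take (i - 1) xs @ m (xs ! (i - 1)) (xs ! i) # drop (i + 1) xs))"
    by (rule sum.reindex_bij_witness[of _ "\<lambda>i. i - 1" Suc]) auto
  finally show ?thesis .
qed

lemma head_head_swap:
  "head_sum (\<lambda>a b. head_sum (h a b) ys) xs = head_sum (\<lambda>c d. head_sum (\<lambda>a b. h a b c d) xs) ys"
  by (cases xs; cases ys) simp_all

lemma head_last_swap:
  "head_sum (\<lambda>a b. last_sum (h a b) ys) xs = last_sum (\<lambda>c d. head_sum (\<lambda>a b. h a b c d) xs) ys"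
  by (cases xs) simp_all

lemma last_last_swap:
  "last_sum (\<lambda>a b. last_sum (h a b) ys) xs = last_sum (\<lambda>c d. last_sum (\<lambda>a b. h a b c d) xs) ys"
  by (simp add: last_sum_def)

lemma split_sum_map: "split_sum h (map t xs) = split_sum (\<lambda>a b. h (map t a) (map t b)) xs"
  by (induction xs arbitrary: h) simp_all

text \<open>Both components of the composition product need three words: the arguments before,
  inside and after an inserted cochain, or the arrows before, inside and after a contracted
  string.\<close>

definition split3_sum :: "('a list \<Rightarrow> 'a list \<Rightarrow> 'a list \<Rightarrow> bit) \<Rightarrow> 'a list \<Rightarrow> bit" where
  "split3_sum h = split_sum (\<lambda>a. split_sum (h a))"

lemma split3_sum_cong:
  "(\<And>a b c. xs = a @ b @ c \<Longrightarrow> h a b c = h' a b c) \<Longrightarrow> split3_sum h xs = split3_sum h' xs"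
  unfolding split3_sum_def by (intro split_sum_cong) auto

lemma split3_sum_add:
  "split3_sum (\<lambda>a b c. h a b c + k a b c) xs = split3_sum h xs + split3_sum k xs"
  by (simp add: split3_sum_def split_sum_add ext[OF split_sum_add])

lemma split3_sum_map:
  "split3_sum h (map t xs) = split3_sum (\<lambda>a b c. h (map t a) (map t b) (map t c)) xs"
  by (simp add: split3_sum_def split_sum_map ext[OF split_sum_map])

lemma split3_split_swap:
  "split3_sum (\<lambda>a b c. split_sum (h a b c) ys) xs = split_sum (\<lambda>d e. split3_sum (\<lambda>a b c. h a b c d e) xs) ys"
  by (simp only: split3_sum_def ext[OF split_split_swap[of _ ys]] split_split_swap[of _ ys])

lemma split3_head_swap:
  "split3_sum (\<lambda>a b c. head_sum (h a b c) ys) xs = head_sum (\<lambda>d e. split3_sum (\<lambda>a b c. h a b c d e) xs) ys"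
  by (simp only: split3_sum_def split_head_swap ext[OF split_head_swap])

lemma split3_last_swap:
  "split3_sum (\<lambda>a b c. last_sum (h a b c) ys) xs = last_sum (\<lambda>d e. split3_sum (\<lambda>a b c. h a b c d e) xs) ys"
  by (simp only: split3_sum_def split_last_swap ext[OF split_last_swap])

lemma split3_pair_swap:
  "split3_sum (\<lambda>a b c. pair_sum m (h a b c) ys) xs = pair_sum m (\<lambda>w. split3_sum (\<lambda>a b c. h a b c w) xs) ys"
  by (simp only: split3_sum_def split_pair_swap ext[OF split_pair_swap])

lemma head_split3:
  "head_sum (\<lambda>x. split3_sum (h x)) xs = split3_sum (\<lambda>a b c. head_sum (\<lambda>x a'. h x a' b c) a) xs"
  unfolding split3_sum_def head_split ext[OF split_head_swap] ..

lemma last_split3: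
  "last_sum (\<lambda>xs' x. split3_sum (\<lambda>a b c. h a b c x) xs') xs =
     split3_sum (\<lambda>a b c. last_sum (\<lambda>c' x. h a b c' x) c) xs"
  unfolding split3_sum_def last_split ..

lemma pair_split3:
  "pair_sum m (split3_sum h) xs = split3_sum (\<lambda>a b c. pair_sum m (\<lambda>a'. h a' b c) a +
     (pair_sum m (\<lambda>b'. h a b' c) b + pair_sum m (h a b) c)) xs"
  by (simp add: split3_sum_def pair_split ext[OF pair_split] split_sum_add
    ext[OF split_sum_add] split_pair_swap ext[OF split_pair_swap])

lemma split3_last_head1:
  "split3_sum (\<lambda>a b c. last_sum (\<lambda>a' x. k a' x b c) a) xs =
     split3_sum (\<lambda>a b c. head_sum (\<lambda>x b'. k a x b' c) b) xs"
  by (simp add: split3_sum_def split_sum_last_head head_split ext[OF split_last_swap])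

lemma split3_last_head2:
  "split3_sum (\<lambda>a b c. last_sum (\<lambda>b' x. k a b' x c) b) xs =
     split3_sum (\<lambda>a b c. head_sum (\<lambda>x c'. k a b x c') c) xs"
  by (simp add: split3_sum_def ext[OF split_sum_last_head])

lemma split3_sum_if_Nil:
  "split3_sum (\<lambda>a b c. if a = [] then h b c else 0) xs = split_sum h xs"
  "split3_sum (\<lambda>a b c. if b = [] then h a c else 0) xs = split_sum h xs"
  "split3_sum (\<lambda>a b c. if c = [] then h a b else 0) xs = split_sum h xs"
proof -
  have "split3_sum (\<lambda>a b c. if a = [] then h b c else 0) xs =
      split_sum (\<lambda>a r. if a = [] then split_sum h r else 0) xs"
    unfolding split3_sum_def by (intro split_sum_cong) simp
  then show "split3_sum (\<lambda>a b c. if a = [] then h b c else 0) xs = split_sum h xs"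
    by (simp add: split_sum_if_Nil)
qed (simp_all add: split3_sum_def split_sum_if_Nil ext[OF split_sum_if_Nil(1)] ext[OF split_sum_if_Nil(2)])

text \<open>This is the condition that the inner cochain in \<open>v\<close> has at least one arrow.
  The same condition on the outer cochain holds automatically, since its string contains the
  composite arrow.\<close>

definition on_nonempty :: "'a list \<Rightarrow> bit \<Rightarrow> bit" where
  "on_nonempty b v = (if b = [] then 0 else v)"

lemma on_nonempty_add: "on_nonempty b (u + v) = on_nonempty b u + on_nonempty b v"
  by (simp add: on_nonempty_def)

lemma split_sum_on_nonempty:
  "split_sum (\<lambda>a b. on_nonempty a (h a b)) xs = split_sum h xs + h [] xs"
  "split_sum (\<lambda>a b. on_nonempty b (h a b)) xs = split_sum h xs + h xs []"
proof -
  have "split_sum (\<lambda>a b. on_nonempty a (h a b)) xs =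
      split_sum (\<lambda>a b. h a b + (if a = [] then h a b else 0)) xs"
    by (intro split_sum_cong) (simp add: on_nonempty_def)
  then show "split_sum (\<lambda>a b. on_nonempty a (h a b)) xs = split_sum h xs + h [] xs"
    by (simp add: split_sum_add split_sum_if_Nil)
  have "split_sum (\<lambda>a b. on_nonempty b (h a b)) xs =
      split_sum (\<lambda>a b. h a b + (if b = [] then h a b else 0)) xs"
    by (intro split_sum_cong) (simp add: on_nonempty_def)
  then show "split_sum (\<lambda>a b. on_nonempty b (h a b)) xs = split_sum h xs + h xs []"
    by (simp add: split_sum_add split_sum_if_Nil)
qed

text \<open>A middle word of exactly one letter amounts to marking a letter of the word.\<close>

lemma split3_head_single:
  "split3_sum (\<lambda>a b c. head_sum (\<lambda>x b'. if b' = [] then k a x c else 0) b) xs =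
     split_sum (\<lambda>a. head_sum (k a)) xs"
proof -
  have "split_sum (\<lambda>b c. head_sum (\<lambda>x b'. if b' = [] then k a x c else 0) b) = head_sum (k a)" for a
    by (rule ext) (simp add: head_split[symmetric] ext[OF split_sum_if_Nil(1)])
  then show ?thesis by (simp add: split3_sum_def)
qed

lemma split3_last_single:
  "split3_sum (\<lambda>a b c. last_sum (\<lambda>b' x. if b' = [] then k a x c else 0) b) xs =
     split_sum (\<lambda>a. head_sum (k a)) xs"
proof -
  have "split3_sum (\<lambda>a b c. last_sum (\<lambda>b' x. if b' = [] then k a x c else 0) b) xs =
      split3_sum (\<lambda>a b c. if b = [] then head_sum (k a) c else 0) xs"
    unfolding split3_last_head2 by (intro split3_sum_cong) simp
  then show ?thesis by (simp add: split3_sum_if_Nil)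
qed

text \<open>The last letter of the first word moves into the middle word, which was nonempty and so
  has now at least two letters. The sum over all nonempty middle words is therefore off by those
  with a single letter.\<close>

lemma split3_last_on_nonempty:
  "split3_sum (\<lambda>a b c. on_nonempty b (last_sum (\<lambda>a' x. k a' x b c) a)) xs =
     split3_sum (\<lambda>a b c. head_sum (\<lambda>x b'. k a x b' c) b) xs + split_sum (\<lambda>a. head_sum (\<lambda>x. k a x [])) xs"
proof -
  have "split3_sum (\<lambda>a b c. on_nonempty b (last_sum (\<lambda>a' x. k a' x b c) a)) xs =
      split3_sum (\<lambda>a b c. last_sum (\<lambda>a' x. k a' x b c + (if b = [] then k a' x [] c else 0)) a) xs"
    by (intro split3_sum_cong) (simp add: on_nonempty_def last_sum_add)
  then show ?thesis
    by (simp only: last_sum_add split3_sum_add split3_last_head1 split3_head_single)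
qed

lemma split3_head_on_nonempty:
  "split3_sum (\<lambda>a b c. on_nonempty b (head_sum (\<lambda>x c'. k a x b c') c)) xs =
     split3_sum (\<lambda>a b c. last_sum (\<lambda>b' x. k a x b' c) b) xs + split_sum (\<lambda>a. head_sum (\<lambda>x. k a x [])) xs"
proof -
  have "split3_sum (\<lambda>a b c. on_nonempty b (head_sum (\<lambda>x c'. k a x b c') c)) xs =
      split3_sum (\<lambda>a b c. head_sum (\<lambda>x c'. k a x b c' + (if b = [] then k a x [] c' else 0)) c) xs"
    by (intro split3_sum_cong) (simp add: on_nonempty_def head_sum_add)
  then show ?thesis
    by (simp only: head_sum_add split3_sum_add split3_last_head2[symmetric] split3_last_single)
qed

text \<open>The first sum runs over all cuts with nonempty first word, the second over all cuts with
  nonempty second word. Every inner cut occurs in both.\<close>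

lemma split_telescope:
  "split_sum (\<lambda>a. head_sum (\<lambda>x b. w (a @ [x]) b)) xs + split_sum (\<lambda>a. head_sum (\<lambda>x b. w a (x # b))) xs =
     w [] xs + w xs []"
proof (induction xs arbitrary: w)
  case (Cons x xs)
  from Cons.IH[of "\<lambda>a. w (x # a)"] show ?case by (simp add: ac_simps)
qed simp

text \<open>A model of the Hochschild coboundary of an insertion: \<open>t\<close> is the structure
  map, \<open>g\<close> the inner cochain, and \<open>L\<close>, \<open>R\<close>, \<open>N\<close>
  the outer cochain with a letter multiplied from the left, from the right, or not at all.
  Everything cancels in pairs except for the outer faces that hit the letter \<open>g b\<close>,
  which happens for empty \<open>a\<close> or empty \<open>c\<close>.\<close>

lemma insertion_leibniz:
  assumes t: "\<And>x y. x \<in> set as \<Longrightarrow> y \<in> set as \<Longrightarrow> my (t x) (t y) = t (mz x y)"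
  shows "head_sum (\<lambda>x. split3_sum (\<lambda>a b c. L (t x) (map t a @ g b # map t c))) as +
    last_sum (\<lambda>bs x. split3_sum (\<lambda>a b c. R (map t a @ g b # map t c) (t x)) bs) as +
    pair_sum mz (split3_sum (\<lambda>a b c. N (map t a @ g b # map t c))) as +
    split3_sum (\<lambda>a b c. head_sum L (map t a @ g b # map t c) + last_sum R (map t a @ g b # map t c) +
      pair_sum my N (map t a @ g b # map t c)) as +
    split3_sum (\<lambda>a b c. head_sum (\<lambda>x b'. N (map t a @ my (t x) (g b') # map t c)) b +
      last_sum (\<lambda>b' x. N (map t a @ my (g b') (t x) # map t c)) b +
      pair_sum mz (\<lambda>b'. N (map t a @ g b' # map t c)) b) as =
    split_sum (\<lambda>b c. L (g b) (map t c)) as + split_sum (\<lambda>a b. R (map t a) (g b)) as"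
proof -
  \<comment> \<open>A product in the extended word involves either two outer letters or the inserted
    one. In the second case the outer factor is moved over the cut, which yields the outer faces of
    \<open>g\<close>.\<close>
  have P: "split3_sum (\<lambda>a b c. pair_sum my N (map t a @ g b # map t c)) as =
    split3_sum (\<lambda>a b c. pair_sum mz (\<lambda>a'. N (map t a' @ g b # map t c)) a +
      pair_sum mz (\<lambda>c'. N (map t a @ g b # map t c')) c +
      last_sum (\<lambda>a' x. N (map t a' @ my (t x) (g b) # map t c)) a +
      head_sum (\<lambda>x c'. N (map t a @ my (g b) (t x) # map t c')) c) as"
    unfolding pair_sum_append head_sum_map last_sum_map
    by (intro split3_sum_cong arg_cong2[where f = "(+)"] pair_sum_map refl) (auto intro!: t)
  have L: "split3_sum (\<lambda>a b c. head_sum L (map t a @ g b # map t c)) as =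
    split3_sum (\<lambda>a b c. head_sum (\<lambda>x a'. L (t x) (map t a' @ g b # map t c)) a) as +
    split_sum (\<lambda>b c. L (g b) (map t c)) as"
    by (simp add: head_sum_append head_sum_map split3_sum_add split3_sum_if_Nil)
  have R: "split3_sum (\<lambda>a b c. last_sum R (map t a @ g b # map t c)) as =
    split3_sum (\<lambda>a b c. last_sum (\<lambda>c' x. R (map t a @ g b # map t c') (t x)) c) as +
    split_sum (\<lambda>a b. R (map t a) (g b)) as"
    by (simp add: last_sum_append last_sum_map split3_sum_add split3_sum_if_Nil)
  show ?thesis
    unfolding head_split3 last_split3 pair_split3
    by (simp only: split3_sum_add P L R split3_last_head1 split3_last_head2 ac_simps bit_add_same add_0 add_0_right)
qed


section \<open>Characters of abelian groups of exponent two\<close>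

text \<open>Such a group is a vector space over the field with two elements, and \<chi> is a linear
  functional not killing \<open>x\<close>. It is obtained as the indicator of the complement of a
  maximal subgroup avoiding \<open>x\<close>.\<close>

lemma exponent_two_character:
  fixes G (structure)
  assumes "abelian_group G" and exp2: "\<And>a. a \<in> carrier G \<Longrightarrow> a \<oplus> a = \<zero>"
    and x: "x \<in> carrier G" "x \<noteq> \<zero>"
  shows "\<exists>\<chi> :: 'a \<Rightarrow> bit. (\<forall>a\<in>carrier G. \<forall>b\<in>carrier G. \<chi> (a \<oplus> b) = \<chi> a + \<chi> b) \<and> \<chi> x = 1"
proof -
  interpret abelian_group G by fact
  \<comment> \<open>Closure under sums already makes these sets subgroups, as every element is its
    own inverse.\<close>
  define S where "S = {H. \<zero> \<in> H \<and> H \<subseteq> carrier G \<and> (\<forall>a\<in>H. \<forall>b\<in>H. a \<oplus> b \<in> H) \<and> x \<notin> H}"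
  have "\<exists>M\<in>S. \<forall>H\<in>S. M \<subseteq> H \<longrightarrow> H = M"
  proof (rule subset_Zorn_nonempty)
    show "S \<noteq> {}" using x unfolding S_def by (auto intro!: exI[of _ "{\<zero>}"])
    fix CC assume CC: "CC \<noteq> {}" "subset.chain S CC"
    then have sub: "\<And>H. H \<in> CC \<Longrightarrow> H \<in> S" by (auto simp: subset.chain_def)
    have "a \<oplus> b \<in> \<Union>CC" if ab: "a \<in> \<Union>CC" "b \<in> \<Union>CC" for a b
    proof -
      obtain H1 H2 where H: "H1 \<in> CC" "H2 \<in> CC" "a \<in> H1" "b \<in> H2"
        using ab by blast
      then have "H1 \<subseteq> H2 \<or> H2 \<subseteq> H1" using CC(2) by (simp add: subset_chain_def)
      then obtain H where "H \<in> CC" "a \<in> H" "b \<in> H" using H by blast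
      then show ?thesis using sub unfolding S_def by blast
    qed
    then show "\<Union>CC \<in> S" using CC(1) sub unfolding S_def by blast
  qed
  then obtain M where M: "M \<in> S" and max: "\<And>H. H \<in> S \<Longrightarrow> M \<subseteq> H \<Longrightarrow> H = M" by blast
  have M0: "\<zero> \<in> M" and MG: "\<And>a. a \<in> M \<Longrightarrow> a \<in> carrier G" and xM: "x \<notin> M"
    and Madd: "\<And>a b. a \<in> M \<Longrightarrow> b \<in> M \<Longrightarrow> a \<oplus> b \<in> M"
    using M unfolding S_def by auto
  have cancel: "a \<oplus> (a \<oplus> b) = b" if "a \<in> carrier G" "b \<in> carrier G" for a b
    using that exp2 by (simp flip: a_assoc)
  \<comment> \<open>\<open>M\<close> together with its translate by \<open>y\<close> is a strictly
    larger subgroup, so by maximality it contains \<open>x\<close>. Hence every element outside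
    \<open>M\<close> lies in the coset of \<open>x\<close>, and \<open>M\<close> has index
    2.\<close>
  have outside: "x \<oplus> y \<in> M" if y: "y \<in> carrier G" "y \<notin> M" for y
  proof -
    let ?H = "M \<union> (\<oplus>) y ` M"
    have "a \<oplus> b \<in> ?H" if "a \<in> ?H" "b \<in> ?H" for a b
    proof -
      have 1: "(y \<oplus> u) \<oplus> v = y \<oplus> (u \<oplus> v)" "u \<oplus> (y \<oplus> v) = y \<oplus> (u \<oplus> v)"
        "(y \<oplus> u) \<oplus> (y \<oplus> v) = u \<oplus> v" if "u \<in> M" "v \<in> M" for u v
        using that y MG cancel exp2 by (auto simp: a_ac)
      show ?thesis using that Madd by (auto simp: 1)
    qed
    then have "?H \<in> S" if "x \<notin> ?H"
      using M0 MG y that unfolding S_def by auto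
    moreover have "y \<in> ?H" using M0 y by (auto intro!: image_eqI[of _ _ \<zero>])
    ultimately have "x \<in> ?H" using max y by blast
    then obtain u where "u \<in> M" "x = y \<oplus> u" using xM by auto
    moreover have "(y \<oplus> u) \<oplus> y = u" using y MG \<open>u \<in> M\<close> cancel exp2 by (simp add: a_ac)
    ultimately show ?thesis by simp
  qed
  define \<chi> :: "'a \<Rightarrow> bit" where "\<chi> = (\<lambda>a. of_bool (a \<notin> M))"
  have "\<chi> (a \<oplus> b) = \<chi> a + \<chi> b" if ab: "a \<in> carrier G" "b \<in> carrier G" for a b
  proof -
    have sum: "(x \<oplus> a) \<oplus> (x \<oplus> b) = a \<oplus> b" "a \<oplus> (a \<oplus> b) = b" "(a \<oplus> b) \<oplus> b = a"
      using ab x cancel exp2 by (auto simp: a_ac)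
    have "a \<oplus> b \<in> M" if "a \<notin> M" "b \<notin> M"
      using Madd[OF outside outside, OF ab(1) that(1) ab(2) that(2)] by (simp only: sum)
    moreover have "b \<in> M" if "a \<in> M" "a \<oplus> b \<in> M"
      using Madd[OF that] by (simp only: sum)
    moreover have "a \<in> M" if "b \<in> M" "a \<oplus> b \<in> M"
      using Madd[OF that(2,1)] by (simp only: sum)
    ultimately have "a \<oplus> b \<in> M \<longleftrightarrow> (a \<in> M \<longleftrightarrow> b \<in> M)"
      using Madd by blast
    then show ?thesis by (auto simp: \<chi>_def)
  qed
  then show ?thesis using xM by (intro exI[of _ \<chi>]) (auto simp: \<chi>_def)
qed


section \<open>Strings and structure maps\<close>

text \<open>\<open>e \<chi> x s as\<close> stands for the value of a cochain at the string \<open>(x, s)\<close> and the arguments \<open>as\<close>, tested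
  with \<open>\<chi>\<close>.\<close>

type_synonym ('o, 'm, 'a) evaluation = "('a \<Rightarrow> bit) \<Rightarrow> 'o \<Rightarrow> 'm list \<Rightarrow> 'a list \<Rightarrow> bit"

text \<open>The last vertex of a string, in a recursive form that splits along concatenation, unlike
  the indexed \<open>vertex\<close>.\<close>

primrec tgt :: "('o, 'm) category \<Rightarrow> 'o \<Rightarrow> 'm list \<Rightarrow> 'o" where
  "tgt C x [] = x"
| "tgt C x (f # s) = tgt C (Dom C f) s"

lemma tgt_append [simp]: "tgt C x (s @ s') = tgt C (tgt C x s) s'"
  by (induction s arbitrary: x) simp_all

lemma vertex_tgt: "i \<le> length s \<Longrightarrow> vertex C (x, s) i = tgt C x (take i s)"
proof (induction s arbitrary: x i)
  case (Cons f s)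
  have "vertex C (x, f # s) (Suc j) = vertex C (Dom C f, s) j" for j
    by (cases j) (simp_all add: vertex_def)
  then show ?case using Cons by (cases i) (simp_all add: vertex_def[of _ _ 0])
qed (simp add: vertex_def)

lemma sub_string_eq:
  "k \<le> length s \<Longrightarrow> sub_string C (x, s) k l = (tgt C x (take k s), take (l - k) (drop k s))"
  by (simp add: sub_string_def vertex_tgt)

lemma sub_arrow_eq:
  "k \<le> length s \<Longrightarrow>
     sub_arrow C (x, s) k l = compose_from C (tgt C x (take k s)) (take (l - k) (drop k s))"
  by (simp add: sub_arrow_def vertex_tgt)

context small_category
begin

lemma composable_Obj: "composable_from C x s \<Longrightarrow> x \<in> Obj C"
  by (cases s) (auto simp: Cod_closed)

lemma composable_append [simp]:
  "composable_from C x (s @ s') \<longleftrightarrow> composable_from C x s \<and> composable_from C (tgt C x s) s'"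
  by (induction s arbitrary: x) (auto dest: composable_Obj)

lemma composable_tgt_Obj: "composable_from C x s \<Longrightarrow> tgt C x s \<in> Obj C"
  by (induction s arbitrary: x) auto

lemma compose_from_props:
  assumes "composable_from C x s"
  shows "compose_from C x s \<in> Arr C" "Dom C (compose_from C x s) = tgt C x s"
    "Cod C (compose_from C x s) = x"
proof -
  have "compose_from C x s \<in> Arr C \<and> Dom C (compose_from C x s) = tgt C x s \<and>
      Cod C (compose_from C x s) = x"
    using assms by (induction s arbitrary: x) (auto simp: Id_closed Dom_Id Cod_Id Comp_closed Dom_Comp Cod_Comp)
  then show "compose_from C x s \<in> Arr C" "Dom C (compose_from C x s) = tgt C x s"
    "Cod C (compose_from C x s) = x" by auto
qed

lemma compose_from_append:
  "composable_from C x (s @ s') \<Longrightarrow>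
     compose_from C x (s @ s') = Comp C (compose_from C x s) (compose_from C (tgt C x s) s')"
proof (induction s arbitrary: x)
  case Nil
  then show ?case
    using Comp_Id_left[of "compose_from C x s'"] compose_from_props[of x s'] by simp
next
  case (Cons f s)
  then show ?case
    using Comp_assoc[of f "compose_from C (Dom C f) s" "compose_from C (tgt C (Dom C f) s) s'"]
      compose_from_props by auto
qed

end


section \<open>Characters and cochains of a diagram\<close>

locale char2_diagram = algebra_functor K C A
  for K :: "'k ring" and C :: "('o, 'm) category" and A :: "('o, 'm, 'k, 'a) diagram" +
  assumes char2: "ring_characteristic K = 2"
begin

abbreviation cA :: "'o \<Rightarrow> 'a set" where "cA x \<equiv> carrier (Alg A x)"

text \<open>As a fold this turns concatenation into composition without side conditions. It agrees
  with the map of the composite arrow only on the carrier at the source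
  (\<open>Map_compose_from\<close>).\<close>

abbreviation T :: "'m list \<Rightarrow> 'a \<Rightarrow> 'a" where "T \<equiv> foldr (Map A)"

abbreviation prod_at ("_ \<cdot>\<^bsub>_\<^esub> _" [70, 0, 71] 70) where
  "a \<cdot>\<^bsub>x\<^esub> b \<equiv> a \<otimes>\<^bsub>Alg A x\<^esub> b"

abbreviation composable :: "'o \<Rightarrow> 'm list \<Rightarrow> bool" where "composable \<equiv> composable_from C"

abbreviation tg :: "'o \<Rightarrow> 'm list \<Rightarrow> 'o" where "tg \<equiv> tgt C"

lemma Alg_module: "x \<in> Obj C \<Longrightarrow> module K (Alg A x)"
  using Alg_algebra[of x] by (simp add: assoc_algebra_def)

lemma Alg_group: "x \<in> Obj C \<Longrightarrow> abelian_group (Alg A x)"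
  using Alg_module[of x] by (simp add: module_def)

lemma Alg_closed:
  assumes "x \<in> Obj C" "a \<in> cA x" "b \<in> cA x"
  shows "a \<cdot>\<^bsub>x\<^esub> b \<in> cA x" "a \<oplus>\<^bsub>Alg A x\<^esub> b \<in> cA x"
  using assoc_algebra.mult_closed[OF Alg_algebra] abelian_groupE(1)[OF Alg_group] assms by auto

lemma Alg_zero_closed: "x \<in> Obj C \<Longrightarrow> \<zero>\<^bsub>Alg A x\<^esub> \<in> cA x"
  using abelian_groupE(2)[OF Alg_group] by auto

lemma smult_closed: "x \<in> Obj C \<Longrightarrow> c \<in> carrier K \<Longrightarrow> a \<in> cA x \<Longrightarrow> c \<odot>\<^bsub>Alg A x\<^esub> a \<in> cA x"
  using module.smult_closed[OF Alg_module] by auto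

lemma add_self:
  assumes x: "x \<in> Obj C" and a: "a \<in> cA x"
  shows "a \<oplus>\<^bsub>Alg A x\<^esub> a = \<zero>\<^bsub>Alg A x\<^esub>"
proof -
  interpret M: module K "Alg A x" by (rule Alg_module[OF x])
  \<comment> \<open>The characteristic is the order of 1 in the additive group, written
    multiplicatively: the square is \<open>1 + 1\<close> and the neutral element is zero.\<close>
  have "\<one>\<^bsub>K\<^esub> [^]\<^bsub>add_monoid K\<^esub> (2::nat) = \<one>\<^bsub>add_monoid K\<^esub>"
    using group.pow_ord_eq_1[OF add.is_group, of "\<one>\<^bsub>K\<^esub>"] char2
    by (simp add: ring_characteristic_def)
  then have "\<one>\<^bsub>K\<^esub> \<oplus>\<^bsub>K\<^esub> \<one>\<^bsub>K\<^esub> = \<zero>\<^bsub>K\<^esub>"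
    by (simp add: numeral_2_eq_2)
  then have "(\<one>\<^bsub>K\<^esub> \<oplus>\<^bsub>K\<^esub> \<one>\<^bsub>K\<^esub>) \<odot>\<^bsub>Alg A x\<^esub> a = \<zero>\<^bsub>Alg A x\<^esub>"
    using a by (simp add: M.smult_l_null)
  then show ?thesis using a by (simp add: M.smult_l_distr)
qed

lemma Map_facts:
  assumes "f \<in> Arr C"
  shows "a \<in> cA (Dom C f) \<Longrightarrow> Map A f a \<in> cA (Cod C f)"
    "a \<in> cA (Dom C f) \<Longrightarrow> b \<in> cA (Dom C f) \<Longrightarrow>
       Map A f (a \<oplus>\<^bsub>Alg A (Dom C f)\<^esub> b) = Map A f a \<oplus>\<^bsub>Alg A (Cod C f)\<^esub> Map A f b"
    "a \<in> cA (Dom C f) \<Longrightarrow> c \<in> carrier K \<Longrightarrow>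
       Map A f (c \<odot>\<^bsub>Alg A (Dom C f)\<^esub> a) = c \<odot>\<^bsub>Alg A (Cod C f)\<^esub> Map A f a"
    "a \<in> cA (Dom C f) \<Longrightarrow> b \<in> cA (Dom C f) \<Longrightarrow>
       Map A f (a \<cdot>\<^bsub>Dom C f\<^esub> b) = Map A f a \<cdot>\<^bsub>Cod C f\<^esub> Map A f b"
  using Map_hom[OF assms] by (auto simp: algebra_hom_def)

lemma T_closed: "composable x s \<Longrightarrow> a \<in> cA (tg x s) \<Longrightarrow> T s a \<in> cA x"
  by (induction s arbitrary: x) (auto simp: Map_facts)

lemma T_add:
  "composable x s \<Longrightarrow> a \<in> cA (tg x s) \<Longrightarrow> b \<in> cA (tg x s) \<Longrightarrow>
     T s (a \<oplus>\<^bsub>Alg A (tg x s)\<^esub> b) = T s a \<oplus>\<^bsub>Alg A x\<^esub> T s b"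
  by (induction s arbitrary: x) (auto simp: Map_facts T_closed)

lemma T_mult:
  "composable x s \<Longrightarrow> a \<in> cA (tg x s) \<Longrightarrow> b \<in> cA (tg x s) \<Longrightarrow>
     T s (a \<cdot>\<^bsub>tg x s\<^esub> b) = T s a \<cdot>\<^bsub>x\<^esub> T s b"
  by (induction s arbitrary: x) (auto simp: Map_facts T_closed)

lemma T_smult:
  "composable x s \<Longrightarrow> a \<in> cA (tg x s) \<Longrightarrow> c \<in> carrier K \<Longrightarrow>
     T s (c \<odot>\<^bsub>Alg A (tg x s)\<^esub> a) = c \<odot>\<^bsub>Alg A x\<^esub> T s a"
  by (induction s arbitrary: x) (auto simp: Map_facts T_closed)

lemma map_T_closed: "composable x s \<Longrightarrow> set as \<subseteq> cA (tg x s) \<Longrightarrow> set (map (T s) as) \<subseteq> cA x"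
  by (auto intro!: T_closed)

lemma Map_compose_from:
  "composable x s \<Longrightarrow> a \<in> cA (tg x s) \<Longrightarrow> Map A (compose_from C x s) a = T s a"
  by (induction s arbitrary: x) (auto simp: Map_Id Map_Comp compose_from_props)

lemma map_Map_compose_from:
  "composable x s \<Longrightarrow> set as \<subseteq> cA (tg x s) \<Longrightarrow> map (Map A (compose_from C x s)) as = map (T s) as"
  by (auto intro!: Map_compose_from)

text \<open>\<open>bit\<close> carries no \<open>K\<close>-structure, so additivity on the carrier
  is what can be demanded. It survives composition with structure maps and with one-sided
  multiplications.\<close>

definition chr :: "'o \<Rightarrow> ('a \<Rightarrow> bit) set" where
  "chr x = {\<chi>. \<forall>a\<in>cA x. \<forall>b\<in>cA x. \<chi> (a \<oplus>\<^bsub>Alg A x\<^esub> b) = \<chi> a + \<chi> b}"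

lemma chrD: "\<chi> \<in> chr x \<Longrightarrow> a \<in> cA x \<Longrightarrow> b \<in> cA x \<Longrightarrow> \<chi> (a \<oplus>\<^bsub>Alg A x\<^esub> b) = \<chi> a + \<chi> b"
  by (auto simp: chr_def)

lemma chr_zero:
  assumes "\<chi> \<in> chr x" "x \<in> Obj C"
  shows "\<chi> \<zero>\<^bsub>Alg A x\<^esub> = 0"
  using chrD[OF assms(1), of "\<zero>\<^bsub>Alg A x\<^esub>" "\<zero>\<^bsub>Alg A x\<^esub>"] add_self[OF assms(2)] Alg_zero_closed[OF assms(2)]
  by simp

lemma chr_finsum:
  assumes \<chi>: "\<chi> \<in> chr x" and x: "x \<in> Obj C" and "finite I" "\<And>i. i \<in> I \<Longrightarrow> g i \<in> cA x"
  shows "\<chi> (finsum (Alg A x) g I) = (\<Sum>i\<in>I. \<chi> (g i))"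
proof -
  interpret M: abelian_group "Alg A x" by (rule Alg_group[OF x])
  show ?thesis using assms(3,4)
    by (induction I) (simp_all add: chr_zero[OF \<chi> x] M.finsum_insert chrD[OF \<chi>] Pi_def)
qed

lemma finsum_closed:
  assumes x: "x \<in> Obj C" and "\<And>i. i \<in> I \<Longrightarrow> g i \<in> cA x"
  shows "finsum (Alg A x) g I \<in> cA x"
proof -
  interpret M: abelian_group "Alg A x" by (rule Alg_group[OF x])
  show ?thesis using assms(2) by (intro M.finsum_closed) auto
qed

text \<open>In exponent two, distinct \<open>a\<close> and \<open>b\<close> have a nonzero sum, and
  a character that is 1 at the sum tells them apart.\<close>

lemma chr_eqI:
  assumes x: "x \<in> Obj C" and ab: "a \<in> cA x" "b \<in> cA x" and eq: "\<And>\<chi>. \<chi> \<in> chr x \<Longrightarrow> \<chi> a = \<chi> b"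
  shows "a = b"
proof (rule ccontr)
  interpret M: abelian_group "Alg A x" by (rule Alg_group[OF x])
  assume "a \<noteq> b"
  have "a \<oplus>\<^bsub>Alg A x\<^esub> b \<noteq> \<zero>\<^bsub>Alg A x\<^esub>"
  proof
    assume "a \<oplus>\<^bsub>Alg A x\<^esub> b = \<zero>\<^bsub>Alg A x\<^esub>"
    then have "a \<oplus>\<^bsub>Alg A x\<^esub> b = b \<oplus>\<^bsub>Alg A x\<^esub> b" using add_self[OF x] ab by simp
    then show False using ab \<open>a \<noteq> b\<close> by simp
  qed
  then obtain \<chi> :: "'a \<Rightarrow> bit" where "\<chi> \<in> chr x" "\<chi> (a \<oplus>\<^bsub>Alg A x\<^esub> b) = 1"
    using exponent_two_character[OF Alg_group[OF x], of "a \<oplus>\<^bsub>Alg A x\<^esub> b"] add_self[OF x] ab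
    by (auto simp: chr_def)
  then show False using eq[of \<chi>] chrD[of \<chi> x a b] ab by simp
qed

text \<open>This and the next three lemmas allow an operation on values to be moved into the
  character, which is how the outer faces and the factors of a product are treated.\<close>

lemma chr_Map:
  "\<chi> \<in> chr (Cod C f) \<Longrightarrow> f \<in> Arr C \<Longrightarrow> (\<lambda>v. \<chi> (Map A f v)) \<in> chr (Dom C f)"
  by (auto simp: chr_def Map_facts)

lemma chr_T: "\<chi> \<in> chr x \<Longrightarrow> composable x s \<Longrightarrow> (\<lambda>v. \<chi> (T s v)) \<in> chr (tg x s)"
  by (auto simp: chr_def T_add T_closed)

lemma chr_lmult:
  "\<chi> \<in> chr x \<Longrightarrow> x \<in> Obj C \<Longrightarrow> b \<in> cA x \<Longrightarrow> (\<lambda>v. \<chi> (b \<cdot>\<^bsub>x\<^esub> v)) \<in> chr x"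
  using assoc_algebra.mult_r_distr[OF Alg_algebra] by (auto simp: chr_def Alg_closed)

lemma chr_rmult:
  "\<chi> \<in> chr x \<Longrightarrow> x \<in> Obj C \<Longrightarrow> b \<in> cA x \<Longrightarrow> (\<lambda>v. \<chi> (v \<cdot>\<^bsub>x\<^esub> b)) \<in> chr x"
  using assoc_algebra.mult_l_distr[OF Alg_algebra] by (auto simp: chr_def Alg_closed)


subsection \<open>Multilinear maps\<close>

text \<open>The conditions speak of carriers only, without extensionality, so that lambda terms for
  composites qualify as they stand.\<close>

definition lin :: "'o \<Rightarrow> 'o \<Rightarrow> ('a \<Rightarrow> 'a) set" where
  "lin y x = {h. (\<forall>a\<in>cA y. h a \<in> cA x) \<and>
     (\<forall>a\<in>cA y. \<forall>b\<in>cA y. h (a \<oplus>\<^bsub>Alg A y\<^esub> b) = h a \<oplus>\<^bsub>Alg A x\<^esub> h b) \<and>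
     (\<forall>c\<in>carrier K. \<forall>a\<in>cA y. h (c \<odot>\<^bsub>Alg A y\<^esub> a) = c \<odot>\<^bsub>Alg A x\<^esub> h a)}"

lemma linI:
  assumes "\<And>a. a \<in> cA y \<Longrightarrow> h a \<in> cA x"
    and "\<And>a b. a \<in> cA y \<Longrightarrow> b \<in> cA y \<Longrightarrow> h (a \<oplus>\<^bsub>Alg A y\<^esub> b) = h a \<oplus>\<^bsub>Alg A x\<^esub> h b"
    and "\<And>c a. c \<in> carrier K \<Longrightarrow> a \<in> cA y \<Longrightarrow> h (c \<odot>\<^bsub>Alg A y\<^esub> a) = c \<odot>\<^bsub>Alg A x\<^esub> h a"
  shows "h \<in> lin y x"
  using assms by (auto simp: lin_def)

lemma linD:
  assumes "h \<in> lin y x"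
  shows "\<And>a. a \<in> cA y \<Longrightarrow> h a \<in> cA x"
    and "\<And>a b. a \<in> cA y \<Longrightarrow> b \<in> cA y \<Longrightarrow> h (a \<oplus>\<^bsub>Alg A y\<^esub> b) = h a \<oplus>\<^bsub>Alg A x\<^esub> h b"
    and "\<And>c a. c \<in> carrier K \<Longrightarrow> a \<in> cA y \<Longrightarrow> h (c \<odot>\<^bsub>Alg A y\<^esub> a) = c \<odot>\<^bsub>Alg A x\<^esub> h a"
  using assms by (auto simp: lin_def)

lemma lin_comp: "h \<in> lin z y \<Longrightarrow> k \<in> lin y x \<Longrightarrow> (\<lambda>v. k (h v)) \<in> lin z x"
  by (auto simp: lin_def)

lemma lin_id: "(\<lambda>v. v) \<in> lin x x"
  by (auto simp: lin_def)

lemma lin_T: "composable x s \<Longrightarrow> T s \<in> lin (tg x s) x"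
  by (intro linI T_closed T_add T_smult)

lemma lin_lmult: "x \<in> Obj C \<Longrightarrow> b \<in> cA x \<Longrightarrow> (\<lambda>v. b \<cdot>\<^bsub>x\<^esub> v) \<in> lin x x"
  using assoc_algebra.mult_r_distr[OF Alg_algebra] assoc_algebra.smult_mult_r[OF Alg_algebra]
  by (intro linI) (auto simp: Alg_closed)

lemma lin_rmult: "x \<in> Obj C \<Longrightarrow> b \<in> cA x \<Longrightarrow> (\<lambda>v. v \<cdot>\<^bsub>x\<^esub> b) \<in> lin x x"
  using assoc_algebra.mult_l_distr[OF Alg_algebra] assoc_algebra.smult_mult_l[OF Alg_algebra]
  by (intro linI) (auto simp: Alg_closed)

lemma lin_add:
  assumes x: "x \<in> Obj C" and h: "h \<in> lin y x" "k \<in> lin y x"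
  shows "(\<lambda>v. h v \<oplus>\<^bsub>Alg A x\<^esub> k v) \<in> lin y x"
proof -
  interpret M: module K "Alg A x" by (rule Alg_module[OF x])
  show ?thesis
    by (rule linI) (simp_all add: linD[OF h(1)] linD[OF h(2)] M.a_ac M.smult_r_distr)
qed

lemma lin_zero: "x \<in> Obj C \<Longrightarrow> (\<lambda>v. \<zero>\<^bsub>Alg A x\<^esub>) \<in> lin y x"
  using add_self[OF _ Alg_zero_closed] module.smult_r_null[OF Alg_module]
    abelian_group.axioms(1)[OF Alg_group, THEN abelian_monoid.l_zero]
  by (intro linI) (auto simp: Alg_zero_closed)

lemma lin_finsum:
  assumes x: "x \<in> Obj C" and y: "y \<in> Obj C" and h: "finite I" "\<And>i. i \<in> I \<Longrightarrow> h i \<in> lin y x"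
  shows "(\<lambda>v. finsum (Alg A x) (\<lambda>i. h i v) I) \<in> lin y x"
proof -
  interpret M: abelian_group "Alg A x" by (rule Alg_group[OF x])
  \<comment> \<open>A finite sum can be unfolded only where its summands lie in the carrier, that
    is, for \<open>v\<close> in \<open>cA y\<close>. The induction therefore produces a linear map
    that agrees with the sum there.\<close>
  have "\<exists>k\<in>lin y x. \<forall>v\<in>cA y. finsum (Alg A x) (\<lambda>i. h i v) I = k v"
    using h
  proof (induction I)
    case empty
    show ?case using lin_zero[OF x] by (intro bexI[of _ "\<lambda>v. \<zero>\<^bsub>Alg A x\<^esub>"]) auto
  next
    case (insert j I)
    then obtain k where k: "k \<in> lin y x" "\<And>v. v \<in> cA y \<Longrightarrow> finsum (Alg A x) (\<lambda>i. h i v) I = k v"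
      by auto
    then show ?case
      using insert lin_add[OF x, of "h j" y k] linD(1)[of "h _" y x]
      by (intro bexI[of _ "\<lambda>v. h j v \<oplus>\<^bsub>Alg A x\<^esub> k v"])
        (auto simp: M.finsum_insert Pi_def)
  qed
  then obtain k where k: "k \<in> lin y x" "\<And>v. v \<in> cA y \<Longrightarrow> finsum (Alg A x) (\<lambda>i. h i v) I = k v"
    by auto
  show ?thesis
    by (rule linI) (simp_all add: k linD[OF k(1)] Alg_closed[OF y] smult_closed[OF y])
qed

text \<open>The varying argument sits in a decomposition \<open>l @ v # r\<close> instead of a list
  update; such words are easy to cut and to map.\<close>

definition multilin :: "nat \<Rightarrow> 'o \<Rightarrow> 'o \<Rightarrow> ('a list \<Rightarrow> 'a) set" where
  "multilin q y x = {h. (\<forall>as. length as = q \<longrightarrow> set as \<subseteq> cA y \<longrightarrow> h as \<in> cA x) \<and>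
     (\<forall>l r. Suc (length l + length r) = q \<longrightarrow> set l \<subseteq> cA y \<longrightarrow> set r \<subseteq> cA y \<longrightarrow>
        (\<lambda>v. h (l @ v # r)) \<in> lin y x)}"

lemma multilinI:
  assumes "\<And>as. length as = q \<Longrightarrow> set as \<subseteq> cA y \<Longrightarrow> h as \<in> cA x"
    and "\<And>l r. Suc (length l + length r) = q \<Longrightarrow> set l \<subseteq> cA y \<Longrightarrow> set r \<subseteq> cA y \<Longrightarrow>
        (\<lambda>v. h (l @ v # r)) \<in> lin y x"
  shows "h \<in> multilin q y x"
  using assms by (auto simp: multilin_def)

lemma multilinD:
  assumes "h \<in> multilin q y x"
  shows "\<And>as. length as = q \<Longrightarrow> set as \<subseteq> cA y \<Longrightarrow> h as \<in> cA x"
    and "\<And>l r. Suc (length l + length r) = q \<Longrightarrow> set l \<subseteq> cA y \<Longrightarrow> set r \<subseteq> cA y \<Longrightarrow>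
        (\<lambda>v. h (l @ v # r)) \<in> lin y x"
  using assms by (auto simp: multilin_def)

lemma lin_cong:
  assumes "h \<in> lin y x" "y \<in> Obj C" "\<And>v. v \<in> cA y \<Longrightarrow> h v = k v"
  shows "k \<in> lin y x"
proof (rule linI)
  note h = linD[OF assms(1)] and c = Alg_closed(2)[OF assms(2)] smult_closed[OF assms(2)]
  show "k a \<in> cA x" if "a \<in> cA y" for a
    using h(1)[OF that] assms(3)[OF that] by simp
  show "k (a \<oplus>\<^bsub>Alg A y\<^esub> b) = k a \<oplus>\<^bsub>Alg A x\<^esub> k b" if "a \<in> cA y" "b \<in> cA y" for a b
    using h(2)[OF that] that by (simp flip: assms(3) add: c)
  show "k (d \<odot>\<^bsub>Alg A y\<^esub> a) = d \<odot>\<^bsub>Alg A x\<^esub> k a" if "d \<in> carrier K" "a \<in> cA y" for d a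
    using h(3)[OF that] that by (simp flip: assms(3) add: c)
qed

lemma multilin_cong:
  assumes "h \<in> multilin q y x" "y \<in> Obj C"
    "\<And>as. length as = q \<Longrightarrow> set as \<subseteq> cA y \<Longrightarrow> h as = k as"
  shows "k \<in> multilin q y x"
proof (rule multilinI)
  show "k as \<in> cA x" if "length as = q" "set as \<subseteq> cA y" for as
    using multilinD(1)[OF assms(1)] assms(3) that by simp
  show "(\<lambda>v. k (l @ v # r)) \<in> lin y x"
    if "Suc (length l + length r) = q" "set l \<subseteq> cA y" "set r \<subseteq> cA y" for l r
    using multilinD(2)[OF assms(1) that] assms(2) by (rule lin_cong) (use that assms(3) in auto)
qed

lemma multilin_lin: "h \<in> multilin q z y \<Longrightarrow> k \<in> lin y x \<Longrightarrow> (\<lambda>as. k (h as)) \<in> multilin q z x"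
  using lin_comp[of "\<lambda>v. h (_ @ v # _)" z y k x]
  by (intro multilinI) (auto simp: multilinD linD(1))

lemma multilin_map:
  assumes h: "h \<in> multilin q y x" and t: "t \<in> lin z y"
  shows "(\<lambda>as. h (map t as)) \<in> multilin q z x"
proof (rule multilinI)
  show "h (map t as) \<in> cA x" if "length as = q" "set as \<subseteq> cA z" for as
    using that linD(1)[OF t] by (intro multilinD(1)[OF h]) auto
  show "(\<lambda>v. h (map t (l @ v # r))) \<in> lin z x"
    if "Suc (length l + length r) = q" "set l \<subseteq> cA z" "set r \<subseteq> cA z" for l r
    using that linD(1)[OF t] lin_comp[OF t multilinD(2)[OF h, of "map t l" "map t r"]] by auto
qed

lemma multilin_add: "x \<in> Obj C \<Longrightarrow> h \<in> multilin q y x \<Longrightarrow> k \<in> multilin q y x \<Longrightarrow>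
    (\<lambda>as. h as \<oplus>\<^bsub>Alg A x\<^esub> k as) \<in> multilin q y x"
  by (intro multilinI lin_add) (auto simp: multilinD Alg_closed)

lemma multilin_zero: "x \<in> Obj C \<Longrightarrow> (\<lambda>as. \<zero>\<^bsub>Alg A x\<^esub>) \<in> multilin q y x"
  by (intro multilinI lin_zero) (auto simp: Alg_zero_closed)

lemma multilin_finsum: "x \<in> Obj C \<Longrightarrow> y \<in> Obj C \<Longrightarrow> finite I \<Longrightarrow> (\<And>i. i \<in> I \<Longrightarrow> h i \<in> multilin q y x) \<Longrightarrow>
    (\<lambda>as. finsum (Alg A x) (\<lambda>i. h i as) I) \<in> multilin q y x"
  by (intro multilinI lin_finsum finsum_closed) (auto intro: multilinD(1)[OF _ refl] multilinD(2)[OF _ refl])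

lemma multilin_prod:
  assumes x: "x \<in> Obj C" and h: "h1 \<in> multilin q1 y x" "h2 \<in> multilin q2 y x"
  shows "(\<lambda>as. h1 (take q1 as) \<cdot>\<^bsub>x\<^esub> h2 (drop q1 as)) \<in> multilin (q1 + q2) y x"
proof (rule multilinI)
  show "h1 (take q1 as) \<cdot>\<^bsub>x\<^esub> h2 (drop q1 as) \<in> cA x"
    if "length as = q1 + q2" "set as \<subseteq> cA y" for as
    using that set_take_subset[of q1 as] set_drop_subset[of q1 as]
    by (intro Alg_closed x multilinD(1)[OF h(1)] multilinD(1)[OF h(2)]) auto
  fix l r assume lr: "Suc (length l + length r) = q1 + q2" "set l \<subseteq> cA y" "set r \<subseteq> cA y"
  have sub: "set (take n l) \<subseteq> cA y" "set (drop n l) \<subseteq> cA y"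
    "set (take n r) \<subseteq> cA y" "set (drop n r) \<subseteq> cA y" for n
    using lr set_take_subset[of n l] set_drop_subset[of n l] set_take_subset[of n r] set_drop_subset[of n r]
    by auto
  show "(\<lambda>v. h1 (take q1 (l @ v # r)) \<cdot>\<^bsub>x\<^esub> h2 (drop q1 (l @ v # r))) \<in> lin y x"
  \<comment> \<open>The varying argument belongs to the first or to the second factor; the other
    factor is then a constant of the algebra.\<close>
  proof (cases "length l < q1")
    case True
    then obtain d where d: "q1 = Suc (length l + d)" by (metis add_Suc_right less_iff_Suc_add)
    have r: "h2 (drop d r) \<in> cA x" using lr sub d by (intro multilinD(1)[OF h(2)]) auto
    have "(\<lambda>v. h1 (l @ v # take d r)) \<in> lin y x"
      using lr sub d by (intro multilinD(2)[OF h(1)]) auto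
    from lin_comp[OF this lin_rmult[OF x r]] show ?thesis by (simp add: d)
  next
    case False
    have l: "h1 (take q1 l) \<in> cA x" using lr sub False by (intro multilinD(1)[OF h(1)]) auto
    have "(\<lambda>v. h2 (drop q1 l @ v # r)) \<in> lin y x"
      using lr sub False by (intro multilinD(2)[OF h(2)]) auto
    from lin_comp[OF this lin_lmult[OF x l]] show ?thesis using False by simp
  qed
qed

lemma multilin_insert:
  assumes f: "f \<in> multilin (Suc (i + k)) y x" and g: "g \<in> multilin q z y" and t: "t \<in> lin z y"
  shows "(\<lambda>as. f (map t (take i as) @ g (take q (drop i as)) # map t (drop (i + q) as)))
    \<in> multilin (i + q + k) z x"
proof (rule multilinI)
  have tc: "set (map t as) \<subseteq> cA y" if "set as \<subseteq> cA z" for as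
    using that linD(1)[OF t] by auto
  show "f (map t (take i as) @ g (take q (drop i as)) # map t (drop (i + q) as)) \<in> cA x"
    if "length as = i + q + k" "set as \<subseteq> cA z" for as
    using that tc[OF order_trans[OF set_take_subset[of i as]]] tc[OF order_trans[OF set_drop_subset[of "i + q" as]]]
      set_take_subset[of q "drop i as"] set_drop_subset[of i as]
    by (intro multilinD(1)[OF f]) (auto intro!: multilinD(1)[OF g])
  fix l r assume lr: "Suc (length l + length r) = i + q + k" "set l \<subseteq> cA z" "set r \<subseteq> cA z"
  have sub: "set (take n l) \<subseteq> cA z" "set (drop n l) \<subseteq> cA z"
    "set (take n r) \<subseteq> cA z" "set (drop n r) \<subseteq> cA z" for n
    using lr set_take_subset[of n l] set_drop_subset[of n l] set_take_subset[of n r] set_drop_subset[of n r]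
    by auto
  have sub2: "set (take m (drop n l)) \<subseteq> cA z" "set (take m (drop n r)) \<subseteq> cA z" for m n
    using sub(2)[of n] sub(4)[of n] set_take_subset[of m "drop n l"] set_take_subset[of m "drop n r"] by auto
  \<comment> \<open>The varying argument lies before the inserted block, inside it, or after it.
    Only in the middle case does it pass through \<open>g\<close>; otherwise it passes through
    \<open>t\<close>.\<close>
  consider d where "i = Suc (length l + d)" | d where "\<not> length l < i" "i + q = Suc (length l + d)"
    | "i + q \<le> length l"
    by (metis add_Suc_right less_iff_Suc_add not_less)
  then show "(\<lambda>v. f (map t (take i (l @ v # r)) @ g (take q (drop i (l @ v # r))) #
      map t (drop (i + q) (l @ v # r)))) \<in> lin z x"
  proof cases
    case 1
    have "g (take q (drop d r)) \<in> cA y" using lr sub sub2 1 by (intro multilinD(1)[OF g]) auto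
    then have "(\<lambda>v. f (map t l @ v # (map t (take d r) @ g (take q (drop d r)) # map t (drop (d + q) r)))) \<in> lin y x"
      using lr sub 1 tc[OF lr(2)] tc[OF sub(3)] tc[OF sub(4)] by (intro multilinD(2)[OF f]) auto
    from lin_comp[OF t this] show ?thesis by (simp add: 1)
  next
    case 2
    have gl: "(\<lambda>v. g (drop i l @ v # take d r)) \<in> lin z y"
      using lr sub 2 by (intro multilinD(2)[OF g]) auto
    have "(\<lambda>v. f (map t (take i l) @ v # map t (drop d r))) \<in> lin y x"
      using lr sub 2 tc[OF sub(1)] tc[OF sub(4)] by (intro multilinD(2)[OF f]) auto
    from lin_comp[OF gl this]
    have *: "(\<lambda>v. f (map t (take i l) @ g (drop i l @ v # take d r) # map t (drop d r))) \<in> lin z x" .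
    have "q + i - length l = Suc d" "q - (length l - i) = Suc d" "i + q - length l = Suc d"
      "drop (i + q) l = []" "take q (drop i l) = drop i l"
      using 2 by auto
    with 2 * show ?thesis by simp
  next
    case 3
    have "g (take q (drop i l)) \<in> cA y" using lr sub sub2 3 by (intro multilinD(1)[OF g]) auto
    then have "(\<lambda>v. f ((map t (take i l) @ g (take q (drop i l)) # map t (drop (i + q) l)) @ v # map t r)) \<in> lin y x"
      using lr sub 3 tc[OF lr(3)] tc[OF sub(1)] tc[OF sub(2)] by (intro multilinD(2)[OF f]) auto
    from lin_comp[OF t this] show ?thesis using 3 by simp
  qed
qed


subsection \<open>Cochains\<close>

text \<open>No condition on the degree: every component of \<open>delta\<close> and of the products
  is a finite sum of components, so all identities make sense for arbitrary families.\<close>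

definition families :: "('o, 'm, 'a) total_cochain set" where
  "families = {F. \<forall>p q. F p q \<in> cochains K C A p q}"

text \<open>The bidegree is read off from the lengths of the two words, which removes
  \<open>p\<close> and \<open>q\<close> from all formulas.\<close>

definition ev :: "('o, 'm, 'a) total_cochain \<Rightarrow> 'o \<Rightarrow> 'm list \<Rightarrow> 'a list \<Rightarrow> 'a" where
  "ev F x s as = F (length s) (length as) (x, s) as"

lemma mem_strings: "(x, s) \<in> strings C p \<longleftrightarrow> length s = p \<and> composable x s"
  by (simp add: strings_def)

lemma vertex_ends: "vertex C (x, s) (length s) = tg x s" "vertex C (x, s) 0 = x"
  by (simp_all add: vertex_tgt)

lemma mem_tuples: "as \<in> tuples (Alg A x) q \<longleftrightarrow> length as = q \<and> set as \<subseteq> cA x"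
  by (simp add: tuples_def)

lemma mk_cochain_apply:
  "composable x s \<Longrightarrow> set as \<subseteq> cA (tg x s) \<Longrightarrow> length s = p \<Longrightarrow> length as = q \<Longrightarrow>
     mk_cochain C A p q g (x, s) as = g (x, s) as"
  by (auto simp: mk_cochain_def mem_strings mem_tuples vertex_ends)

lemma multilinear_multilin:
  assumes "h \<in> multilinear_maps K q (Alg A y) (Alg A x)"
  shows "h \<in> multilin q y x"
proof (rule multilinI)
  show "h as \<in> cA x" if "length as = q" "set as \<subseteq> cA y" for as
    using assms that by (auto simp: multilinear_maps_def mem_tuples)
  fix l r assume lr: "Suc (length l + length r) = q" "set l \<subseteq> cA y" "set r \<subseteq> cA y"
  show "(\<lambda>v. h (l @ v # r)) \<in> lin y x"
  proof (rule linI)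
    have *: "l @ a # r \<in> tuples (Alg A y) q" "length l < q" if "a \<in> cA y" for a
      using lr that by (auto simp: mem_tuples)
    then show "h (l @ a # r) \<in> cA x" if "a \<in> cA y" for a
      using assms that by (auto simp: multilinear_maps_def)
    fix a assume a: "a \<in> cA y"
    show "h (l @ (a \<oplus>\<^bsub>Alg A y\<^esub> b) # r) = h (l @ a # r) \<oplus>\<^bsub>Alg A x\<^esub> h (l @ b # r)" if "b \<in> cA y" for b
    proof -
      have "\<forall>x'\<in>cA y. \<forall>y'\<in>cA y. h ((l @ a # r)[length l := x' \<oplus>\<^bsub>Alg A y\<^esub> y']) =
          h ((l @ a # r)[length l := x']) \<oplus>\<^bsub>Alg A x\<^esub> h ((l @ a # r)[length l := y'])"
        using assms *[OF a] unfolding multilinear_maps_def by blast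
      then show ?thesis using a that by simp
    qed
    show "h (l @ (c \<odot>\<^bsub>Alg A y\<^esub> a) # r) = c \<odot>\<^bsub>Alg A x\<^esub> h (l @ a # r)" if "c \<in> carrier K" for c
    proof -
      have "\<forall>c\<in>carrier K. \<forall>x'\<in>cA y. h ((l @ a # r)[length l := c \<odot>\<^bsub>Alg A y\<^esub> x']) =
          c \<odot>\<^bsub>Alg A x\<^esub> h ((l @ a # r)[length l := x'])"
        using assms *[OF a] unfolding multilinear_maps_def by blast
      then show ?thesis using a that by simp
    qed
  qed
qed

lemma multilin_multilinear:
  assumes h: "h \<in> multilin q y x" and y: "y \<in> Obj C"
  shows "restrict h (tuples (Alg A y) q) \<in> multilinear_maps K q (Alg A y) (Alg A x)"
proof -
  let ?h = "restrict h (tuples (Alg A y) q)"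
  have "?h (as[i := a \<oplus>\<^bsub>Alg A y\<^esub> b]) = ?h (as[i := a]) \<oplus>\<^bsub>Alg A x\<^esub> ?h (as[i := b]) \<and>
      ?h (as[i := c \<odot>\<^bsub>Alg A y\<^esub> a]) = c \<odot>\<^bsub>Alg A x\<^esub> ?h (as[i := a])"
    if as: "as \<in> tuples (Alg A y) q" "i < q" and v: "a \<in> cA y" "b \<in> cA y" "c \<in> carrier K" for as i a b c
  proof -
    have in_t: "as[i := v] \<in> tuples (Alg A y) q" if "v \<in> cA y" for v
      using as that set_update_subset_insert[of as i v] by (auto simp: mem_tuples)
    have upd: "as[i := v] = take i as @ v # drop (Suc i) as" for v
      using as by (intro upd_conv_take_nth_drop) (auto simp: mem_tuples)
    have "(\<lambda>v. h (take i as @ v # drop (Suc i) as)) \<in> lin y x"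
      using as set_take_subset[of i as] set_drop_subset[of "Suc i" as]
      by (intro multilinD(2)[OF h]) (auto simp: mem_tuples)
    then have "(\<lambda>v. h (as[i := v])) \<in> lin y x" by (simp add: upd)
    from linD[OF this] show ?thesis
      using v by (simp add: in_t Alg_closed[OF y] smult_closed[OF y])
  qed
  moreover have "?h \<in> tuples (Alg A y) q \<rightarrow>\<^sub>E cA x"
    by (auto simp: mem_tuples intro!: multilinD(1)[OF h])
  \<comment> \<open>Additivity and homogeneity were shown jointly for \<open>a\<close>,
    \<open>b\<close>, \<open>c\<close>; zero elements serve for the variable that each of them
    leaves free.\<close>
  moreover have "\<zero>\<^bsub>K\<^esub> \<in> carrier K" by simp
  ultimately show ?thesis
    unfolding multilinear_maps_def using Alg_zero_closed[OF y] by blast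
qed

lemma mk_cochain_mem:
  assumes "\<And>x s. composable x s \<Longrightarrow> length s = p \<Longrightarrow> g (x, s) \<in> multilin q (tg x s) x"
  shows "mk_cochain C A p q g \<in> cochains K C A p q"
  unfolding cochains_def
proof (rule PiE_I)
  fix s assume "s \<in> strings C p"
  then obtain x s' where s: "s = (x, s')" "composable x s'" "length s' = p"
    by (cases s) (auto simp: mem_strings)
  then show "mk_cochain C A p q g s
      \<in> multilinear_maps K q (Alg A (vertex C s p)) (Alg A (vertex C s 0))"
    using multilin_multilinear[OF assms[OF s(2,3)]] vertex_ends[of x s']
    by (simp add: mk_cochain_def mem_strings composable_tgt_Obj)
qed (simp add: mk_cochain_def)

lemma cochain_multilin:
  assumes "f \<in> cochains K C A p q" "composable x s" "length s = p"
  shows "f (x, s) \<in> multilin q (tg x s) x"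
proof -
  have "f (x, s) \<in> multilinear_maps K q (Alg A (vertex C (x, s) p)) (Alg A (vertex C (x, s) 0))"
    using assms by (auto simp: cochains_def mem_strings)
  then show ?thesis using assms vertex_ends[of x s] by (simp add: multilinear_multilin)
qed

lemma cochain_eqI:
  assumes "f \<in> cochains K C A p q" "g \<in> cochains K C A p q"
    and "\<And>x s as. composable x s \<Longrightarrow> length s = p \<Longrightarrow> length as = q \<Longrightarrow> set as \<subseteq> cA (tg x s) \<Longrightarrow>
      f (x, s) as = g (x, s) as"
  shows "f = g"
proof (rule PiE_ext[OF assms(1)[unfolded cochains_def] assms(2)[unfolded cochains_def]])
  fix s assume s: "s \<in> strings C p"
  obtain x s' where [simp]: "s = (x, s')" by (cases s)
  have s': "composable x s'" "length s' = p" using s by (auto simp: mem_strings)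
  have "f s \<in> tuples (Alg A (vertex C s p)) q \<rightarrow>\<^sub>E cA (vertex C s 0)"
    "g s \<in> tuples (Alg A (vertex C s p)) q \<rightarrow>\<^sub>E cA (vertex C s 0)"
    using PiE_mem[OF assms(1)[unfolded cochains_def] s] PiE_mem[OF assms(2)[unfolded cochains_def] s]
    by (auto simp: multilinear_maps_def)
  then show "f s = g s"
    using assms(3)[OF s'] vertex_ends[of x s'] s'
    by (intro PiE_ext) (auto simp: mem_tuples)
qed

lemma ev_closed:
  "F \<in> families \<Longrightarrow> composable x s \<Longrightarrow> set as \<subseteq> cA (tg x s) \<Longrightarrow> ev F x s as \<in> cA x"
  unfolding ev_def by (rule multilinD(1)[OF cochain_multilin]) (auto simp: families_def)

lemma chr_lin: "h \<in> lin y x \<Longrightarrow> \<chi> \<in> chr x \<Longrightarrow> (\<lambda>v. \<chi> (h v)) \<in> chr y"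
  by (auto simp: chr_def lin_def)

lemma chr_ev:
  assumes "\<chi> \<in> chr x" "F \<in> families" "composable x s" "set l \<subseteq> cA (tg x s)" "set r \<subseteq> cA (tg x s)"
  shows "(\<lambda>v. \<chi> (ev F x s (l @ v # r))) \<in> chr (tg x s)"
proof -
  have "F (length s) (Suc (length l + length r)) (x, s) \<in> multilin (Suc (length l + length r)) (tg x s) x"
    using assms by (intro cochain_multilin) (auto simp: families_def)
  from multilinD(2)[OF this, of l r] show ?thesis
    using assms by (intro chr_lin[of _ "tg x s" x]) (simp_all add: ev_def)
qed

text \<open>Cochains are extensional, so values at composable strings and admissible arguments
  determine them, and characters separate values. Every identity between families is proved through
  this lemma or its variant for \<open>ok\<close> data.\<close>

lemma families_eqI:
  assumes "F \<in> families" "G \<in> families"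
    and "\<And>x s as \<chi>. composable x s \<Longrightarrow> set as \<subseteq> cA (tg x s) \<Longrightarrow> \<chi> \<in> chr x \<Longrightarrow>
      \<chi> (ev F x s as) = \<chi> (ev G x s as)"
  shows "F = G"
proof (intro ext[of F G] ext[of "F _"])
  fix p q
  show "F p q = G p q"
  proof (rule cochain_eqI)
    fix x s as assume *: "composable x s" "length s = p" "length as = q" "set as \<subseteq> cA (tg x s)"
    then have "ev F x s as = ev G x s as"
      using assms by (intro chr_eqI[OF composable_Obj]) (auto intro: ev_closed)
    then show "F p q (x, s) as = G p q (x, s) as" using * by (simp add: ev_def)
  qed (use assms in \<open>auto simp: families_def\<close>)
qed

lemma zero_cochain_mem: "zero_cochain C A p q \<in> cochains K C A p q"
  unfolding zero_cochain_def
  by (rule mk_cochain_mem) (simp add: vertex_ends multilin_zero composable_Obj)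

lemma add_cochain_mem:
  "f \<in> cochains K C A p q \<Longrightarrow> g \<in> cochains K C A p q \<Longrightarrow> add_cochain C A p q f g \<in> cochains K C A p q"
  unfolding add_cochain_def
  by (rule mk_cochain_mem)
    (auto simp: vertex_ends intro!: multilin_add[OF composable_Obj cochain_multilin cochain_multilin])

lemma total_zero_mem: "total_zero C A \<in> families"
  by (simp add: families_def total_zero_def zero_cochain_mem)

lemma total_add_mem: "F \<in> families \<Longrightarrow> G \<in> families \<Longrightarrow> total_add C A F G \<in> families"
  by (simp add: families_def total_add_def add_cochain_mem)

lemma ev_zero:
  "composable x s \<Longrightarrow> set as \<subseteq> cA (tg x s) \<Longrightarrow> ev (total_zero C A) x s as = \<zero>\<^bsub>Alg A x\<^esub>"
  by (simp add: ev_def total_zero_def zero_cochain_def mk_cochain_apply vertex_ends)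

lemma ev_add:
  "composable x s \<Longrightarrow> set as \<subseteq> cA (tg x s) \<Longrightarrow>
     ev (total_add C A F G) x s as = ev F x s as \<oplus>\<^bsub>Alg A x\<^esub> ev G x s as"
  by (simp add: ev_def total_add_def add_cochain_def mk_cochain_apply vertex_ends)


section \<open>The coboundary\<close>

lemma composable_arr: "composable x s \<Longrightarrow> set s \<subseteq> Arr C"
  by (induction s arbitrary: x) auto

lemma composable_take_drop:
  assumes "composable x s"
  shows "composable x (take i s)" "composable (tg x (take i s)) (drop i s)"
    "tg (tg x (take i s)) (drop i s) = tg x s"
  using assms composable_append[of x "take i s" "drop i s"] tgt_append[of C x "take i s" "drop i s"]
  by simp_all

lemma sub_arrow_single:
  assumes "composable x s" "j < length s"
  shows "sub_arrow C (x, s) j (Suc j) = s ! j"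
proof -
  have "take (Suc 0) (drop j s) = [s ! j]" using assms by (simp add: take_Suc_conv_app_nth)
  moreover have "s ! j \<in> Arr C" using composable_arr[OF assms(1)] assms(2) by auto
  ultimately show ?thesis using assms by (simp add: sub_arrow_eq Comp_Id_right)
qed

lemma sub_arrow_double:
  assumes "composable x s" "Suc j < length s"
  shows "sub_arrow C (x, s) j (Suc (Suc j)) = Comp C (s ! j) (s ! Suc j)"
proof -
  have "take 2 (drop j s) = [s ! j, s ! Suc j]"
    using assms by (simp add: take_Suc_conv_app_nth numeral_2_eq_2)
  moreover have "s ! Suc j \<in> Arr C" using composable_arr[OF assms(1)] assms(2) by auto
  ultimately show ?thesis using assms by (simp add: sub_arrow_eq Comp_Id_right flip: numeral_2_eq_2)
qed

lemma reindex_first: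
  assumes "composable x (f # s')"
  shows "reindex C (length s') (omit 0) (x, f # s') = (Dom C f, s')"
  using assms
  by (auto simp: reindex_def omit_def vertex_tgt sub_arrow_single intro!: nth_equalityI)

lemma reindex_last:
  assumes "composable x (s' @ [f])"
  shows "reindex C (length s') (omit (Suc (length s'))) (x, s' @ [f]) = (x, s')"
  using assms
  by (auto simp: reindex_def omit_def vertex_tgt sub_arrow_single nth_append intro!: nth_equalityI)

lemma reindex_inner:
  assumes s: "composable x s" "length s = Suc p" and i: "i \<in> {1..p}"
  shows "reindex C p (omit i) (x, s) =
    (x, take (i - 1) s @ Comp C (s ! (i - 1)) (s ! i) # drop (i + 1) s)"
proof -
  have "map (\<lambda>j. sub_arrow C (x, s) (omit i j) (omit i (Suc j))) [0..<p] =
      take (i - 1) s @ Comp C (s ! (i - 1)) (s ! i) # drop (i + 1) s"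
  proof (rule nth_equalityI)
    fix j assume "j < length (map (\<lambda>j. sub_arrow C (x, s) (omit i j) (omit i (Suc j))) [0..<p])"
    then have j: "j < p" by simp
    \<comment> \<open>Arrows before the omitted vertex stay in place, the two arrows at it are
      composed, and the later ones move down by one position.\<close>
    consider "Suc j < i" | "i = Suc j" | "i \<le> j" by linarith
    then show "map (\<lambda>j. sub_arrow C (x, s) (omit i j) (omit i (Suc j))) [0..<p] ! j =
        (take (i - 1) s @ Comp C (s ! (i - 1)) (s ! i) # drop (i + 1) s) ! j"
    proof cases
      case 1
      then have "j < i - 1" by simp
      then show ?thesis
        using j s 1 by (simp add: omit_def sub_arrow_single nth_append)
    next
      case 2
      then show ?thesis
        using j s by (simp add: omit_def sub_arrow_double nth_append)
    next
      case 3
      then have "\<not> j < i - 1" "j - (i - 1) = Suc (j - i)" "i + 1 + (j - i) = Suc j" using i by auto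
      then show ?thesis
        using j s i 3 by (simp add: omit_def sub_arrow_single nth_append)
    qed
  qed (use s i in \<open>auto simp: min_def\<close>)
  then show ?thesis using i by (simp add: reindex_def omit_def vertex_tgt)
qed

lemma finsum_cong2:
  assumes "x \<in> Obj C" "\<And>i. i \<in> I \<Longrightarrow> g i \<in> cA x" "\<And>i. i \<in> I \<Longrightarrow> f i = g i"
  shows "finsum (Alg A x) f I = finsum (Alg A x) g I"
proof -
  interpret M: abelian_group "Alg A x" by (rule Alg_group[OF assms(1)])
  show ?thesis using assms by (intro M.finsum_cong') auto
qed

lemma lin_Map: "f \<in> Arr C \<Longrightarrow> Map A f \<in> lin (Dom C f) (Cod C f)"
  by (intro linI) (auto simp: Map_facts)

text \<open>Multilinearity is shown for a readable formula \<open>h\<close> and carried over to the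
  defining one, with which it agrees on admissible arguments.\<close>

lemma mk_cochain_memI:
  assumes "\<And>x s as. composable x s \<Longrightarrow> length s = p \<Longrightarrow> length as = q \<Longrightarrow>
      set as \<subseteq> cA (tg x s) \<Longrightarrow> mk_cochain C A p q g (x, s) as = h x s as"
    and "\<And>x s. composable x s \<Longrightarrow> length s = p \<Longrightarrow> h x s \<in> multilin q (tg x s) x"
  shows "mk_cochain C A p q g \<in> cochains K C A p q"
proof (rule mk_cochain_mem)
  fix x s assume s: "composable x s" "length s = p"
  show "g (x, s) \<in> multilin q (tg x s) x"
    using assms(2)[OF s] composable_tgt_Obj[OF s(1)]
    by (rule multilin_cong) (use assms(1) s mk_cochain_apply[of x s _ p q g] in auto)
qed

text \<open>The summands of \<open>delta_S\<close> with all structure maps of identities removed.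
  Only the first face keeps a map on the value and only the last face one on the arguments.\<close>

definition face :: "('o, 'm, 'a) cochain \<Rightarrow> 'o \<Rightarrow> 'm list \<Rightarrow> nat \<Rightarrow> 'a list \<Rightarrow> 'a" where
  "face f x s i as =
     (if i = 0 then Map A (hd s) (f (Dom C (hd s), tl s) as)
      else if i = length s then f (x, butlast s) (map (Map A (last s)) as)
      else f (x, take (i - 1) s @ Comp C (s ! (i - 1)) (s ! i) # drop (i + 1) s) as)"

lemma contract_pair:
  assumes "composable x (l @ f # g # r)"
  shows "composable x (l @ Comp C f g # r)" "tg x (l @ Comp C f g # r) = tg x (l @ f # g # r)"
    "a \<in> cA (tg x (l @ f # g # r)) \<Longrightarrow> T (l @ Comp C f g # r) a = T (l @ f # g # r) a"
    "compose_from C x (l @ Comp C f g # r) = compose_from C x (l @ f # g # r)"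
proof -
  have fg: "f \<in> Arr C" "g \<in> Arr C" "Dom C f = Cod C g" "composable (Dom C g) r"
    using assms by auto
  show *: "composable x (l @ Comp C f g # r)" "tg x (l @ Comp C f g # r) = tg x (l @ f # g # r)"
    using assms by (auto simp: Comp_closed Dom_Comp Cod_Comp)
  show "T (l @ Comp C f g # r) a = T (l @ f # g # r) a" if "a \<in> cA (tg x (l @ f # g # r))"
    using that fg T_closed[OF fg(4)] by (simp add: Map_Comp)
  have "Comp C (Comp C f g) (compose_from C (Dom C g) r) = Comp C f (Comp C g (compose_from C (Dom C g) r))"
    using fg compose_from_props[OF fg(4)] by (intro Comp_assoc) auto
  then show "compose_from C x (l @ Comp C f g # r) = compose_from C x (l @ f # g # r)"
    using assms *(1) fg by (simp add: compose_from_append Dom_Comp)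
qed

lemma nth_decomp: "Suc i < length xs \<Longrightarrow> xs = take i xs @ xs ! i # xs ! Suc i # drop (Suc (Suc i)) xs"
  by (metis Cons_nth_drop_Suc Suc_lessD append_take_drop_id)

lemma face_multilin:
  assumes f: "f \<in> cochains K C A p q" and s: "composable x s" "length s = Suc p" and i: "i \<le> Suc p"
  shows "face f x s i \<in> multilin q (tg x s) x"
proof -
  consider "i = 0" | "i = Suc p" | "i \<in> {1..p}" using i by force
  then show ?thesis
  proof cases
    case 1
    obtain g s' where s': "s = g # s'" using s by (cases s) auto
    then have "f (Dom C g, s') \<in> multilin q (tg x s) (Dom C g)"
      using s cochain_multilin[OF f, of "Dom C g" s'] by simp
    moreover have "Map A g \<in> lin (Dom C g) x" using s s' lin_Map[of g] by simp
    ultimately have "(\<lambda>as. Map A g (f (Dom C g, s') as)) \<in> multilin q (tg x s) x" by (rule multilin_lin)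
    then show ?thesis using 1 s' by (simp add: face_def[abs_def])
  next
    case 2
    obtain g s' where s': "s = s' @ [g]" using s by (cases s rule: rev_cases) auto
    then have "f (x, s') \<in> multilin q (tg x s') x" using s cochain_multilin[OF f, of x s'] by simp
    moreover have "Map A g \<in> lin (tg x s) (tg x s')" using s s' lin_Map[of g] by simp
    ultimately have "(\<lambda>as. f (x, s') (map (Map A g) as)) \<in> multilin q (tg x s) x" by (rule multilin_map)
    then show ?thesis using 2 s s' by (simp add: face_def[abs_def])
  next
    case 3
    define l a b r where d: "l = take (i - 1) s" "a = s ! (i - 1)" "b = s ! i" "r = drop (Suc i) s"
    have i': "Suc (i - 1) = i" "i < length s" using s 3 by auto
    have eq: "s = l @ a # b # r"
      unfolding d by (rule nth_decomp[of "i - 1" s, unfolded i'(1), OF i'(2)])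
    have "length (l @ Comp C a b # r) = p" using s(2) eq by simp
    moreover have "composable x (l @ Comp C a b # r)" "tg x (l @ Comp C a b # r) = tg x s"
      using contract_pair(1,2)[of x l a b r] s(1) eq by auto
    ultimately have "f (x, l @ Comp C a b # r) \<in> multilin q (tg x s) x"
      using cochain_multilin[OF f, of x "l @ Comp C a b # r"] by simp
    then show ?thesis using 3 s by (simp add: face_def[abs_def] d)
  qed
qed

lemma delta_S_face:
  assumes f: "f \<in> cochains K C A p q" and s: "composable x s" "length s = Suc p"
    and as: "length as = q" "set as \<subseteq> cA (tg x s)" and i: "i \<le> Suc p"
  shows "Map A (sub_arrow C (x, s) 0 (omit i 0)) (f (reindex C p (omit i) (x, s))
      (map (Map A (sub_arrow C (x, s) (omit i p) (Suc p))) as)) = face f x s i as"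
proof -
  have x: "x \<in> Obj C" "tg x s \<in> Obj C" using s by (auto intro: composable_Obj composable_tgt_Obj)
  have cl: "face f x s i as \<in> cA x" using multilinD(1)[OF face_multilin[OF f s i]] as by simp
  have id: "map (Map A (sub_arrow C (x, s) (Suc p) (Suc p))) as = as"
    using as s x by (intro map_idI) (auto simp: sub_arrow_eq Map_Id)
  have id0: "Map A (sub_arrow C (x, s) 0 0) a = a" if "a \<in> cA x" for a
    using that x by (simp add: sub_arrow_eq Map_Id)
  consider "i = 0" | "i = Suc p" | "i \<in> {1..p}" using i by force
  then show ?thesis
  proof cases
    case 1
    obtain g s' where s': "s = g # s'" using s by (cases s) auto
    then show ?thesis using 1 id s reindex_first[of x g s'] sub_arrow_single[of x s 0]
      by (simp add: face_def omit_def)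
  next
    case 2
    obtain g s' where s': "s = s' @ [g]" using s by (cases s rule: rev_cases) auto
    then show ?thesis using 2 cl s reindex_last[of x s' g] sub_arrow_single[of x s p] id0
      by (simp add: face_def omit_def nth_append)
  next
    case 3
    then show ?thesis using id id0 cl reindex_inner[OF s 3] s by (simp add: face_def omit_def)
  qed
qed

lemma delta_S_apply:
  assumes f: "f \<in> cochains K C A p q" and s: "composable x s" "length s = Suc p"
    and as: "length as = q" "set as \<subseteq> cA (tg x s)"
  shows "delta_S C A p q f (x, s) as = finsum (Alg A x) (\<lambda>i. face f x s i as) {0..Suc p}"
  unfolding delta_S_def
  using assms
  by (simp add: mk_cochain_apply vertex_ends)
    (auto intro!: finsum_cong2 composable_Obj delta_S_face multilinD(1)[OF face_multilin] simp del: One_nat_def)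

lemma delta_S_mem: "f \<in> cochains K C A p q \<Longrightarrow> delta_S C A p q f \<in> cochains K C A (Suc p) q"
  using delta_S_apply[of f p q] unfolding delta_S_def
  by (rule mk_cochain_memI) (auto intro!: multilin_finsum face_multilin composable_Obj composable_tgt_Obj)

section \<open>The Hochschild direction\<close>

lemma multilin_nth0: "(\<lambda>as. as ! 0) \<in> multilin 1 x x"
proof (rule multilinI)
  show "as ! 0 \<in> cA x" if "length as = 1" "set as \<subseteq> cA x" for as
    using that by (cases as) auto
  show "(\<lambda>v. (l @ v # r) ! 0) \<in> lin x x" if "Suc (length l + length r) = 1" for l r
    using that lin_id by simp
qed

lemma multilin_id: "f \<in> multilin q y x \<Longrightarrow> q = q' \<Longrightarrow> f \<in> multilin q' y x"
  by simp

definition inner_mult :: "('a list \<Rightarrow> 'a) \<Rightarrow> 'o \<Rightarrow> nat \<Rightarrow> 'a list \<Rightarrow> 'a" where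
  "inner_mult h y i as =
     h (take (i - 1) as @ (as ! (i - 1) \<cdot>\<^bsub>y\<^esub> as ! i) # drop (i + 1) as)"

lemma inner_mult_multilin:
  assumes h: "h \<in> multilin q y x" and y: "y \<in> Obj C" and i: "i \<in> {1..q}"
  shows "inner_mult h y i \<in> multilin (Suc q) y x"
proof -
  have h': "h \<in> multilin (Suc (i - 1 + (q - i))) y x" using h by (rule multilin_id) (use i in simp)
  \<comment> \<open>Multiplying two neighbouring arguments is the insertion of a bilinear map of
    arity 2 along the identity structure map.\<close>
  have "(\<lambda>bs. take 1 bs ! 0 \<cdot>\<^bsub>y\<^esub> drop 1 bs ! 0) \<in> multilin (1 + 1) y y"
    by (rule multilin_prod[OF y multilin_nth0 multilin_nth0])
  from multilin_insert[OF h' this lin_id]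
  have "(\<lambda>as. h (map (\<lambda>v. v) (take (i - 1) as) @
      (take 1 (take (1 + 1) (drop (i - 1) as)) ! 0 \<cdot>\<^bsub>y\<^esub> drop 1 (take (1 + 1) (drop (i - 1) as)) ! 0) #
      map (\<lambda>v. v) (drop (i - 1 + (1 + 1)) as))) \<in> multilin (i - 1 + (1 + 1) + (q - i)) y x" .
  then have *: "(\<lambda>as. h (map (\<lambda>v. v) (take (i - 1) as) @
      (take 1 (take (1 + 1) (drop (i - 1) as)) ! 0 \<cdot>\<^bsub>y\<^esub> drop 1 (take (1 + 1) (drop (i - 1) as)) ! 0) #
      map (\<lambda>v. v) (drop (i - 1 + (1 + 1)) as))) \<in> multilin (Suc q) y x"
    by (rule multilin_id) (use i in simp)
  show ?thesis
    by (rule multilin_cong[OF * y]) (use i in \<open>auto simp: inner_mult_def nth_append\<close>)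
qed

definition left_mult :: "('a list \<Rightarrow> 'a) \<Rightarrow> 'o \<Rightarrow> ('a \<Rightarrow> 'a) \<Rightarrow> 'a list \<Rightarrow> 'a" where
  "left_mult h x t as = t (as ! 0) \<cdot>\<^bsub>x\<^esub> h (drop 1 as)"

definition right_mult :: "('a list \<Rightarrow> 'a) \<Rightarrow> 'o \<Rightarrow> ('a \<Rightarrow> 'a) \<Rightarrow> nat \<Rightarrow> 'a list \<Rightarrow> 'a" where
  "right_mult h x t q as = h (take q as) \<cdot>\<^bsub>x\<^esub> t (as ! q)"

lemma left_mult_multilin:
  assumes h: "h \<in> multilin q y x" and xy: "x \<in> Obj C" "y \<in> Obj C" and t: "t \<in> lin y x"
  shows "left_mult h x t \<in> multilin (Suc q) y x"
proof -
  have "(\<lambda>as. t (take 1 as ! 0) \<cdot>\<^bsub>x\<^esub> h (drop 1 as)) \<in> multilin (Suc q) y x"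
    using multilin_prod[OF xy(1) multilin_lin[OF multilin_nth0 t] h] by simp
  then show ?thesis using xy(2) by (rule multilin_cong) (auto simp: left_mult_def)
qed

lemma right_mult_multilin:
  assumes h: "h \<in> multilin q y x" and xy: "x \<in> Obj C" "y \<in> Obj C" and t: "t \<in> lin y x"
  shows "right_mult h x t q \<in> multilin (Suc q) y x"
proof -
  have "(\<lambda>as. h (take q as) \<cdot>\<^bsub>x\<^esub> t (drop q as ! 0)) \<in> multilin (Suc q) y x"
    using multilin_prod[OF xy(1) h multilin_lin[OF multilin_nth0 t]] by simp
  then show ?thesis using xy(2) by (rule multilin_cong) (auto simp: right_mult_def)
qed

lemma delta_H_apply:
  assumes f: "f \<in> cochains K C A p q" and s: "composable x s" "length s = p"
    and as: "length as = Suc q" "set as \<subseteq> cA (tg x s)"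
  shows "delta_H C A p q f (x, s) as =
    left_mult (f (x, s)) x (T s) as \<oplus>\<^bsub>Alg A x\<^esub>
    finsum (Alg A x) (\<lambda>i. inner_mult (f (x, s)) (tg x s) i as) {1..q} \<oplus>\<^bsub>Alg A x\<^esub>
    right_mult (f (x, s)) x (T s) q as"
proof -
  have x: "x \<in> Obj C" "tg x s \<in> Obj C" using s by (auto intro: composable_Obj composable_tgt_Obj)
  have T: "Map A (compose_from C x s) (as ! i) = T s (as ! i)" if "i \<le> q" for i
    using that as s nth_mem[of i as] by (intro Map_compose_from) auto
  show ?thesis
    unfolding delta_H_def
    using multilinD(1)[OF inner_mult_multilin[OF cochain_multilin[OF f s] x(2)] as]
      vertex_ends[of x s] s as T[of 0] T[of q]
    by (simp add: mk_cochain_apply Let_def left_mult_def right_mult_def sub_arrow_eq)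
      (simp add: inner_mult_def)
qed

lemma delta_H_mem: "f \<in> cochains K C A p q \<Longrightarrow> delta_H C A p q f \<in> cochains K C A p (Suc q)"
  using delta_H_apply[of f p q] unfolding delta_H_def
proof (rule mk_cochain_memI)
  fix x s assume f: "f \<in> cochains K C A p q" and s: "composable x s" "length s = p"
  note x = composable_Obj[OF s(1)] composable_tgt_Obj[OF s(1)]
  note h = cochain_multilin[OF f s]
  show "(\<lambda>as. left_mult (f (x, s)) x (T s) as \<oplus>\<^bsub>Alg A x\<^esub>
      finsum (Alg A x) (\<lambda>i. inner_mult (f (x, s)) (tg x s) i as) {1..q} \<oplus>\<^bsub>Alg A x\<^esub>
      right_mult (f (x, s)) x (T s) q as) \<in> multilin (Suc q) (tg x s) x"
    by (intro multilin_add multilin_finsum x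
      inner_mult_multilin[OF h] left_mult_multilin[OF h] right_mult_multilin[OF h] lin_T s) auto
qed auto

lemma delta_mem:
  assumes "F \<in> families"
  shows "delta C A F \<in> families"
proof -
  have "F p q \<in> cochains K C A p q" for p q using assms by (auto simp: families_def)
  then show ?thesis
    unfolding families_def delta_def
    by (auto intro!: add_cochain_mem zero_cochain_mem delta_S_mem delta_H_mem split: nat.split)
qed

section \<open>The coboundary as an operator on evaluations\<close>

abbreviation val :: "('o, 'm, 'a) total_cochain \<Rightarrow> ('o, 'm, 'a) evaluation" where
  "val F \<equiv> (\<lambda>\<chi> x s as. \<chi> (ev F x s as))"

text \<open>The three sums are the first face, the last face and the inner faces. The first face
  shortens the string from the left, so the base object and the character change with it.\<close>

definition DS :: "('o, 'm, 'a) evaluation \<Rightarrow> ('o, 'm, 'a) evaluation" where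
  "DS e \<chi> x s as = head_sum (\<lambda>f s'. e (\<lambda>v. \<chi> (Map A f v)) (Dom C f) s' as) s +
     last_sum (\<lambda>s' f. e \<chi> x s' (map (Map A f) as)) s +
     pair_sum (Comp C) (\<lambda>s'. e \<chi> x s' as) s"

definition DH :: "('o, 'm, 'a) evaluation \<Rightarrow> ('o, 'm, 'a) evaluation" where
  "DH e \<chi> x s as = head_sum (\<lambda>a. e (\<lambda>v. \<chi> (T s a \<cdot>\<^bsub>x\<^esub> v)) x s) as +
     last_sum (\<lambda>bs a. e (\<lambda>v. \<chi> (v \<cdot>\<^bsub>x\<^esub> T s a)) x s bs) as +
     pair_sum (\<otimes>\<^bsub>Alg A (tg x s)\<^esub>) (e \<chi> x s) as"

lemma chr_delta_S:
  assumes F: "F \<in> families" and s: "composable x s" "length s = Suc p"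
    and as: "length as = q" "set as \<subseteq> cA (tg x s)" and \<chi>: "\<chi> \<in> chr x"
  shows "\<chi> (delta_S C A p q (F p q) (x, s) as) = DS (val F) \<chi> x s as"
proof -
  have f: "F p q \<in> cochains K C A p q" using F by (auto simp: families_def)
  let ?t = "\<lambda>i. \<chi> (face (F p q) x s i as)"
  have "\<chi> (delta_S C A p q (F p q) (x, s) as) = (\<Sum>i\<in>{0..Suc p}. ?t i)"
    unfolding delta_S_apply[OF f s as]
    using multilinD(1)[OF face_multilin[OF f s] as] by (intro chr_finsum[OF \<chi> composable_Obj[OF s(1)]]) auto
  also have "\<dots> = ?t 0 + ?t (Suc p) + (\<Sum>i\<in>{1..p}. ?t i)"
    by (simp add: sum.atLeast_Suc_atMost[of 0] ac_simps)
  also have "?t 0 = head_sum (\<lambda>f s'. \<chi> (Map A f (ev F (Dom C f) s' as))) s"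
    using s as by (cases s) (auto simp: face_def ev_def)
  also have "?t (Suc p) = last_sum (\<lambda>s' f. \<chi> (ev F x s' (map (Map A f) as))) s"
    using s as by (auto simp: face_def ev_def last_sum_def)
  also have "(\<Sum>i\<in>{1..p}. ?t i) = pair_sum (Comp C) (\<lambda>s'. \<chi> (ev F x s' as)) s"
    using s as by (auto simp: face_def ev_def pair_sum_conv intro!: sum.cong)
  finally show ?thesis by (simp add: DS_def)
qed

lemma chr_delta_H:
  assumes F: "F \<in> families" and s: "composable x s" "length s = p"
    and as: "length as = Suc q" "set as \<subseteq> cA (tg x s)" and \<chi>: "\<chi> \<in> chr x"
  shows "\<chi> (delta_H C A p q (F p q) (x, s) as) = DH (val F) \<chi> x s as"
proof -
  have f: "F p q \<in> cochains K C A p q" using F by (auto simp: families_def)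
  have x: "x \<in> Obj C" "tg x s \<in> Obj C" using s by (auto intro: composable_Obj composable_tgt_Obj)
  let ?t = "\<lambda>i. inner_mult (F p q (x, s)) (tg x s) i as"
  have t: "?t i \<in> cA x" if "i \<in> {1..q}" for i
    using multilinD(1)[OF inner_mult_multilin[OF cochain_multilin[OF f s] x(2) that] as] .
  have l: "left_mult (F p q (x, s)) x (T s) as \<in> cA x" "right_mult (F p q (x, s)) x (T s) q as \<in> cA x"
    using multilinD(1)[OF left_mult_multilin[OF cochain_multilin[OF f s] x lin_T[OF s(1)]] as]
      multilinD(1)[OF right_mult_multilin[OF cochain_multilin[OF f s] x lin_T[OF s(1)]] as] by auto
  have sb: "finsum (Alg A x) ?t {1..q} \<in> cA x" by (rule finsum_closed[OF x(1) t])
  have cs: "\<chi> (finsum (Alg A x) ?t {1..q}) = (\<Sum>i\<in>{1..q}. \<chi> (?t i))"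
    by (rule chr_finsum[OF \<chi> x(1) finite_atLeastAtMost t])
  have "\<chi> (delta_H C A p q (F p q) (x, s) as) =
      \<chi> (left_mult (F p q (x, s)) x (T s) as) + \<chi> (right_mult (F p q (x, s)) x (T s) q as) +
      (\<Sum>i\<in>{1..q}. \<chi> (?t i))"
    using l x sb by (simp add: delta_H_apply[OF f s as] chrD[OF \<chi>] Alg_closed cs ac_simps del: One_nat_def)
  also have "\<chi> (left_mult (F p q (x, s)) x (T s) as) =
      head_sum (\<lambda>a bs. \<chi> (T s a \<cdot>\<^bsub>x\<^esub> ev F x s bs)) as"
    using s as by (cases as) (auto simp: left_mult_def ev_def)
  also have "\<chi> (right_mult (F p q (x, s)) x (T s) q as) =
      last_sum (\<lambda>bs a. \<chi> (ev F x s bs \<cdot>\<^bsub>x\<^esub> T s a)) as"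
    using s as by (cases as rule: rev_cases) (auto simp: right_mult_def ev_def nth_append)
  also have "(\<Sum>i\<in>{1..q}. \<chi> (?t i)) = pair_sum (\<otimes>\<^bsub>Alg A (tg x s)\<^esub>) (\<lambda>bs. \<chi> (ev F x s bs)) as"
    using s as by (auto simp: inner_mult_def ev_def pair_sum_conv intro!: sum.cong)
  finally show ?thesis by (simp add: DH_def)
qed

lemma chr_delta:
  assumes F: "F \<in> families" and s: "composable x s" and as: "set as \<subseteq> cA (tg x s)" and \<chi>: "\<chi> \<in> chr x"
  shows "\<chi> (ev (delta C A F) x s as) = DS (val F) \<chi> x s as + DH (val F) \<chi> x s as"
proof -
  have x: "x \<in> Obj C" using s by (rule composable_Obj)
  have f: "F p q \<in> cochains K C A p q" for p q using F by (auto simp: families_def)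
  define ds where "ds = (case length s of 0 \<Rightarrow> zero_cochain C A (length s) (length as)
    | Suc p \<Rightarrow> delta_S C A p (length as) (F p (length as)))"
  define h where "h = (case length as of 0 \<Rightarrow> zero_cochain C A (length s) (length as)
    | Suc q \<Rightarrow> delta_H C A (length s) q (F (length s) q))"
  have z: "zero_cochain C A (length s) (length as) (x, s) as = \<zero>\<^bsub>Alg A x\<^esub>"
    using s as by (simp add: zero_cochain_def mk_cochain_apply vertex_ends)
  have "ds \<in> cochains K C A (length s) (length as)" "h \<in> cochains K C A (length s) (length as)"
    unfolding ds_def h_def using zero_cochain_mem[of "length s" "length as"] delta_S_mem[OF f] delta_H_mem[OF f]
    by (auto split: nat.split)
  then have "ds (x, s) as \<in> cA x" "h (x, s) as \<in> cA x"
    using multilinD(1)[OF cochain_multilin] s as by auto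
  moreover have "ev (delta C A F) x s as = ds (x, s) as \<oplus>\<^bsub>Alg A x\<^esub> h (x, s) as"
    using s as by (simp add: ev_def delta_def add_cochain_def mk_cochain_apply vertex_ends ds_def h_def)
  moreover have "\<chi> (ds (x, s) as) = DS (val F) \<chi> x s as"
    using chr_delta_S[OF F s _ refl as \<chi>] chr_zero[OF \<chi> x] z
    by (cases s) (auto simp: ds_def DS_def)
  moreover have "\<chi> (h (x, s) as) = DH (val F) \<chi> x s as"
    using chr_delta_H[OF F s refl _ as \<chi>] chr_zero[OF \<chi> x] z
    by (cases as) (auto simp: h_def DH_def)
  ultimately show ?thesis using chrD[OF \<chi>] by simp
qed

end


section \<open>The composition product and the cup product\<close>

text \<open>A summand of \<open>u\<close> is given by the cut of the string, the number
  \<open>i\<close> of arguments before the inserted cochain and the number \<open>j\<close> that it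
  takes. Since its value replaces \<open>j\<close> arguments by one,
  \<open>q1 = q + 1 - j\<close>.\<close>

lemma sum_insertions:
  fixes k :: "nat \<Rightarrow> nat \<Rightarrow> nat \<Rightarrow> 'b::comm_monoid_add"
  shows "(\<Sum>(p1, q1, p2, q2) \<in> {(p1, q1, p2, q2). p1 + p2 = p \<and> q1 + q2 = q + 1}.
      \<Sum>i\<in>{1..q1}. k p1 (i - 1) q2) = (\<Sum>p1\<in>{0..p}. \<Sum>i\<in>{0..q}. \<Sum>j\<in>{0..q - i}. k p1 i j)"
    (is "?l = ?r")
    and finite_insertions: "finite {(p1, q1, p2, q2). p1 + p2 = p \<and> q1 + q2 = q + (1::nat)}"
proof -
  let ?S = "{(p1, q1, p2, q2). p1 + p2 = p \<and> q1 + q2 = q + (1::nat)}"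
  have "?S \<subseteq> {0..p} \<times> {0..q + 1} \<times> {0..p} \<times> {0..q + 1}" by auto
  then show fin: "finite ?S" by (rule finite_subset) simp
  have "?l = (\<Sum>t\<in>?S. \<Sum>i\<in>{1..fst (snd t)}. k (fst t) (i - 1) (snd (snd (snd t))))"
    by (simp add: split_def)
  also have "\<dots> = (\<Sum>(t, i)\<in>Sigma ?S (\<lambda>t. {1..fst (snd t)}). k (fst t) (i - 1) (snd (snd (snd t))))"
    by (rule sum.Sigma) (use fin in auto)
  also have "\<dots> = (\<Sum>(p1, i, j)\<in>Sigma {0..p} (\<lambda>p1. Sigma {0..q} (\<lambda>i. {0..q - i})). k p1 i j)"
    by (rule sum.reindex_bij_witness[of _ "\<lambda>(p1, i, j). ((p1, q + 1 - j, p - p1, j), i + 1)"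
          "\<lambda>((p1, q1, p2, q2), i). (p1, i - 1, q2)"]) auto
  also have "\<dots> = ?r" by (simp add: sum.Sigma)
  finally show "?l = ?r" .
qed

text \<open>The data are the number \<open>i\<close> of arrows before the contracted string, its
  length \<open>j\<close>, and the number of arguments of the inner cochain. The composite arrow
  counts for the outer cochain, so \<open>p1 = p + 1 - j\<close> is positive by itself and only
  \<open>j = 0\<close> has to be excluded.\<close>

lemma sum_contractions:
  fixes k :: "nat \<Rightarrow> nat \<Rightarrow> nat \<Rightarrow> 'b::comm_monoid_add"
  shows "(\<Sum>(p1, q1, p2, q2) \<in> {(p1, q1, p2, q2). p1 > 0 \<and> p2 > 0 \<and> p1 + p2 = p + 1 \<and> q1 + q2 = q}.
      \<Sum>i\<in>{1..p1}. k (i - 1) p2 q2) =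
    (\<Sum>i\<in>{0..p}. \<Sum>j\<in>{0..p - i}. if j = 0 then 0 else \<Sum>q2\<in>{0..q}. k i j q2)"
    (is "?l = ?r")
    and finite_contractions:
      "finite {(p1, q1, p2, q2). p1 > 0 \<and> p2 > 0 \<and> p1 + p2 = p + (1::nat) \<and> q1 + q2 = (q::nat)}"
proof -
  let ?S = "{(p1, q1, p2, q2). p1 > 0 \<and> p2 > 0 \<and> p1 + p2 = p + (1::nat) \<and> q1 + q2 = q}"
  have "?S \<subseteq> {0..p + 1} \<times> {0..q} \<times> {0..p + 1} \<times> {0..q}" by auto
  then show fin: "finite ?S" by (rule finite_subset) simp
  have "?l = (\<Sum>t\<in>?S. \<Sum>i\<in>{1..fst t}. k (i - 1) (fst (snd (snd t))) (snd (snd (snd t))))"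
    by (simp add: split_def)
  also have "\<dots> = (\<Sum>(t, i)\<in>Sigma ?S (\<lambda>t. {1..fst t}). k (i - 1) (fst (snd (snd t))) (snd (snd (snd t))))"
    by (rule sum.Sigma) (use fin in auto)
  also have "\<dots> = (\<Sum>(i, j, q2)\<in>Sigma {0..p} (\<lambda>i. Sigma {1..p - i} (\<lambda>j. {0..q})). k i j q2)"
    by (rule sum.reindex_bij_witness[of _ "\<lambda>(i, j, q2). ((p + 1 - j, q - q2, j, q2), i + 1)"
          "\<lambda>((p1, q1, p2, q2), i). (i - 1, p2, q2)"]) auto
  also have "\<dots> = (\<Sum>i\<in>{0..p}. \<Sum>j\<in>{1..p - i}. \<Sum>q2\<in>{0..q}. k i j q2)" by (simp add: sum.Sigma)
  also have "\<dots> = ?r"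
    by (rule sum.cong[OF refl], rule sum.mono_neutral_cong_left) auto
  finally show "?l = ?r" .
qed

context char2_diagram
begin

abbreviation contracted :: "'o \<Rightarrow> 'm list \<Rightarrow> 'm list \<Rightarrow> 'm list \<Rightarrow> 'm list" where
  "contracted x s1 s2 s3 \<equiv> s1 @ compose_from C (tg x s1) s2 # s3"

lemma composable3:
  assumes "composable x (s1 @ s2 @ s3)"
  shows "composable x (contracted x s1 s2 s3)"
    "tg x (contracted x s1 s2 s3) = tg x (s1 @ s2 @ s3)"
  using assms by (auto simp: compose_from_props)

section \<open>The component \<open>u\<close>: inserting a value among the arguments\<close>

definition insertion where
  "insertion f g x s p1 i q2 as =
     f (x, take p1 s) (map (T (drop p1 s)) (take i as) @
       g (tg x (take p1 s), drop p1 s) (take q2 (drop i as)) # map (T (drop p1 s)) (drop (i + q2) as))"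

lemma insertion_multilin:
  assumes f: "f \<in> cochains K C A p1 q1" and g: "g \<in> cochains K C A p2 q2"
    and s: "composable x s" "length s = p1 + p2" and i: "i < q1" "Suc q = q1 + q2"
  shows "insertion f g x s p1 i q2 \<in> multilin q (tg x s) x"
proof -
  note c = composable_take_drop[OF s(1), of p1]
  have f': "f (x, take p1 s) \<in> multilin (Suc (i + (q1 - Suc i))) (tg x (take p1 s)) x"
    using i s cochain_multilin[OF f c(1)] by simp
  have g': "g (tg x (take p1 s), drop p1 s) \<in> multilin q2 (tg x s) (tg x (take p1 s))"
    using s cochain_multilin[OF g c(2)] c(3) by simp
  have T: "T (drop p1 s) \<in> lin (tg x s) (tg x (take p1 s))"
    using lin_T[OF c(2)] c(3) by simp
  have "insertion f g x s p1 i q2 \<in> multilin (i + q2 + (q1 - Suc i)) (tg x s) x"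
    unfolding insertion_def[abs_def] by (rule multilin_insert[OF f' g' T])
  then show ?thesis by (rule multilin_id) (use i in simp)
qed

lemma comp_u_apply:
  assumes f: "f \<in> cochains K C A p1 q1" and g: "g \<in> cochains K C A p2 q2"
    and s: "composable x s" "length s = p1 + p2"
    and as: "length as = q1 + q2 - 1" "set as \<subseteq> cA (tg x s)"
  shows "comp_u C A p1 q1 p2 q2 f g (x, s) as =
    finsum (Alg A x) (\<lambda>i. insertion f g x s p1 (i - 1) q2 as) {1..q1}"
proof -
  note c = composable_take_drop[OF s(1), of p1]
  have m: "map (Map A (sub_arrow C (x, s) p1 (p1 + p2))) bs = map (T (drop p1 s)) bs"
    if "set bs \<subseteq> set as" for bs
    using map_Map_compose_from[OF c(2)] s c(3) that as by (auto simp: sub_arrow_eq)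
  have sb: "sub_string C (x, s) 0 p1 = (x, take p1 s)"
    "sub_string C (x, s) p1 (p1 + p2) = (tg x (take p1 s), drop p1 s)"
    using s by (simp_all add: sub_string_eq)
  let ?t = "\<lambda>i. f (x, take p1 s) (map (T (drop p1 s)) (take (i - 1) as) @
       g (tg x (take p1 s), drop p1 s) (take q2 (drop (i - 1) as)) # map (T (drop p1 s)) (drop (i - 1 + q2) as))"
  have "comp_u C A p1 q1 p2 q2 f g (x, s) as = finsum (Alg A x) ?t {1..q1}"
    unfolding comp_u_def using s as
    by (simp add: mk_cochain_apply vertex_ends Let_def sb m set_take_subset set_drop_subset)
  also have "\<dots> = finsum (Alg A x) (\<lambda>i. insertion f g x s p1 (i - 1) q2 as) {1..q1}"
    using as by (intro finsum_cong2 composable_Obj[OF s(1)]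
        multilinD(1)[OF insertion_multilin[OF f g s, of _ "length as"]])
      (auto simp: insertion_def)
  finally show ?thesis .
qed

lemma comp_u_mem:
  assumes f: "f \<in> cochains K C A p1 q1" and g: "g \<in> cochains K C A p2 q2" and q: "Suc q = q1 + q2"
  shows "comp_u C A p1 q1 p2 q2 f g \<in> cochains K C A (p1 + p2) q"
proof -
  have "q1 + q2 - 1 = q" using q by simp
  note a = comp_u_apply[OF f g, unfolded comp_u_def this]
  show ?thesis
    unfolding comp_u_def \<open>q1 + q2 - 1 = q\<close>
  proof (rule mk_cochain_memI[where h = "\<lambda>x s as. finsum (Alg A x) (\<lambda>i. insertion f g x s p1 (i - 1) q2 as) {1..q1}"])
    fix x s assume s: "composable x s" "length s = p1 + p2"
    show "(\<lambda>as. finsum (Alg A x) (\<lambda>i. insertion f g x s p1 (i - 1) q2 as) {1..q1}) \<in> multilin q (tg x s) x"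
      using q by (intro multilin_finsum composable_Obj[OF s(1)] composable_tgt_Obj[OF s(1)]
        insertion_multilin[OF f g]) (auto simp: s)
  qed (rule a)
qed

section \<open>The component \<open>v\<close>: contracting a substring\<close>

definition contraction where
  "contraction f g x s i p2 q2 as =
     T (take i s) (g (tg x (take i s), take p2 (drop i s)) (map (T (drop (i + p2) s)) (take q2 as)))
     \<otimes>\<^bsub>Alg A x\<^esub>
     f (x, take i s @ compose_from C (tg x (take i s)) (take p2 (drop i s)) # drop (i + p2) s) (drop q2 as)"

lemma split3:
  assumes "composable x s"
  shows "s = take i s @ take j (drop i s) @ drop (i + j) s"
    "composable (tg x (take i s)) (take j (drop i s))"
    "composable (tg (tg x (take i s)) (take j (drop i s))) (drop (i + j) s)"
    "tg (tg (tg x (take i s)) (take j (drop i s))) (drop (i + j) s) = tg x s"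
proof -
  show eq: "s = take i s @ take j (drop i s) @ drop (i + j) s"
    by (metis append_take_drop_id drop_drop add.commute)
  show "composable (tg x (take i s)) (take j (drop i s))"
    "composable (tg (tg x (take i s)) (take j (drop i s))) (drop (i + j) s)"
    using assms by (subst (asm) eq, simp)+
  show "tg (tg (tg x (take i s)) (take j (drop i s))) (drop (i + j) s) = tg x s"
    using arg_cong[OF eq, of "tg x"] by simp
qed

lemma contraction_multilin:
  assumes f: "f \<in> cochains K C A p1 q1" and g: "g \<in> cochains K C A p2 q2"
    and s: "composable x s" "Suc (length s) = p1 + p2" and i: "i < p1" "0 < p2"
  shows "contraction f g x s i p2 q2 \<in> multilin (q1 + q2) (tg x s) x"
proof -
  note sb0 = composable_take_drop(1)[OF s(1), of i]
  note sb = split3[OF s(1), of i p2]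
  have x: "x \<in> Obj C" using s by (auto intro: composable_Obj)
  have c: "composable x (take i s @ compose_from C (tg x (take i s)) (take p2 (drop i s)) # drop (i + p2) s)"
    "tg x (take i s @ compose_from C (tg x (take i s)) (take p2 (drop i s)) # drop (i + p2) s) = tg x s"
    using s(1) sb composable3[of x "take i s" "take p2 (drop i s)" "drop (i + p2) s"] by auto
  have f': "f (x, take i s @ compose_from C (tg x (take i s)) (take p2 (drop i s)) # drop (i + p2) s)
      \<in> multilin q1 (tg x s) x"
    using cochain_multilin[OF f c(1)] c(2) s i by simp
  have g': "g (tg x (take i s), take p2 (drop i s))
      \<in> multilin q2 (tg (tg x (take i s)) (take p2 (drop i s))) (tg x (take i s))"
    using cochain_multilin[OF g sb(2)] s i by simp
  have "(\<lambda>as. T (take i s) (g (tg x (take i s), take p2 (drop i s)) (map (T (drop (i + p2) s)) as)))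
      \<in> multilin q2 (tg x s) x"
    using lin_T[OF sb(3)] sb(4) by (intro multilin_lin[OF multilin_map[OF g'] lin_T] sb sb0) simp
  from multilin_prod[OF x this f'] show ?thesis
    unfolding contraction_def[abs_def] by (rule multilin_id) simp
qed

lemma comp_v_apply:
  assumes f: "f \<in> cochains K C A p1 q1" and g: "g \<in> cochains K C A p2 q2"
    and s: "composable x s" "Suc (length s) = p1 + p2" and p2: "0 < p2"
    and as: "length as = q1 + q2" "set as \<subseteq> cA (tg x s)"
  shows "comp_v C A p1 q1 p2 q2 f g (x, s) as =
    finsum (Alg A x) (\<lambda>i. contraction f g x s (i - 1) p2 q2 as) {1..p1}"
proof -
  have x: "x \<in> Obj C" using s by (auto intro: composable_Obj)
  have len: "p1 + p2 - 1 = length s" using s by simp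
  let ?t = "\<lambda>k. Map A (sub_arrow C (x, s) 0 (k - 1))
         (g (sub_string C (x, s) (k - 1) (k + p2 - 1))
            (map (Map A (sub_arrow C (x, s) (k + p2 - 1) (length s))) (take q2 as)))
       \<otimes>\<^bsub>Alg A x\<^esub> f (contract C (k - 1) (k + p2 - 1) (x, s)) (drop q2 as)"
  have t: "?t k = contraction f g x s (k - 1) p2 q2 as" if "k \<in> {1..p1}" for k
  proof -
    define i where "i = k - 1"
    have i: "k = Suc i" "i + p2 \<le> length s" using that s by (auto simp: i_def)
    note sb0 = composable_take_drop(1)[OF s(1), of i]
  note sb = split3[OF s(1), of i p2]
    have tk: "tg x (take (i + p2) s) = tg (tg x (take i s)) (take p2 (drop i s))"
      by (simp add: take_add)
    have m: "map (Map A (compose_from C (tg x (take (i + p2) s)) (drop (i + p2) s))) (take q2 as) =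
        map (T (drop (i + p2) s)) (take q2 as)"
      using map_Map_compose_from[OF sb(3), of "take q2 as"] sb(4) as(2) set_take_subset[of q2 as] i
      by (simp add: tk)
    have "set (map (T (drop (i + p2) s)) (take q2 as)) \<subseteq> cA (tg (tg x (take i s)) (take p2 (drop i s)))"
      using sb(4) as(2) set_take_subset[of q2 as] by (intro map_T_closed[OF sb(3)]) auto
    then have "g (tg x (take i s), take p2 (drop i s)) (map (T (drop (i + p2) s)) (take q2 as)) \<in> cA (tg x (take i s))"
      using as i by (intro multilinD(1)[OF cochain_multilin[OF g sb(2)]]) auto
    then show ?thesis
      using i Map_compose_from[OF sb0]
      by (simp add: m contraction_def contract_def sub_string_eq sub_arrow_eq)
  qed
  have "comp_v C A p1 q1 p2 q2 f g (x, s) as = finsum (Alg A x) ?t {1..p1}"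
    unfolding comp_v_def using s as len by (simp add: mk_cochain_apply vertex_ends Let_def)
  also have "\<dots> = finsum (Alg A x) (\<lambda>i. contraction f g x s (i - 1) p2 q2 as) {1..p1}"
    using as p2 by (intro finsum_cong2[OF x] t multilinD(1)[OF contraction_multilin[OF f g s]]) auto
  finally show ?thesis .
qed

lemma comp_v_mem:
  assumes f: "f \<in> cochains K C A p1 q1" and g: "g \<in> cochains K C A p2 q2"
    and p: "0 < p2" "Suc p = p1 + p2"
  shows "comp_v C A p1 q1 p2 q2 f g \<in> cochains K C A p (q1 + q2)"
proof -
  have "p1 + p2 - 1 = p" using p by simp
  note a = comp_v_apply[OF f g, unfolded comp_v_def this]
  show ?thesis
    unfolding comp_v_def \<open>p1 + p2 - 1 = p\<close>
  proof (rule mk_cochain_memI[where h = "\<lambda>x s as. finsum (Alg A x) (\<lambda>i. contraction f g x s (i - 1) p2 q2 as) {1..p1}"])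
    fix x s assume s: "composable x s" "length s = p"
    show "(\<lambda>as. finsum (Alg A x) (\<lambda>i. contraction f g x s (i - 1) p2 q2 as) {1..p1})
        \<in> multilin (q1 + q2) (tg x s) x"
      using p by (intro multilin_finsum composable_Obj[OF s(1)] composable_tgt_Obj[OF s(1)] contraction_multilin[OF f g])
        (auto simp: s)
  qed (rule a; use p in simp)
qed

abbreviation inserted ::
    "('o, 'm, 'a) total_cochain \<Rightarrow> 'o \<Rightarrow> 'm list \<Rightarrow> 'm list \<Rightarrow> 'a list \<Rightarrow> 'a list \<Rightarrow> 'a list \<Rightarrow> 'a list" where
  "inserted G x s1 s2 a b c \<equiv> map (T s2) a @ ev G (tg x s1) s2 b # map (T s2) c"

definition u_val :: "('o, 'm, 'a) total_cochain \<Rightarrow> ('o, 'm, 'a) total_cochain \<Rightarrow> ('o, 'm, 'a) evaluation" where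
  "u_val F G \<chi> x s as = split_sum (\<lambda>s1 s2. split3_sum (\<lambda>a b c.
     \<chi> (ev F x s1 (inserted G x s1 s2 a b c))) as) s"

definition v_val :: "('o, 'm, 'a) total_cochain \<Rightarrow> ('o, 'm, 'a) total_cochain \<Rightarrow> ('o, 'm, 'a) evaluation" where
  "v_val F G \<chi> x s as = split3_sum (\<lambda>s1 s2 s3. on_nonempty s2 (split_sum (\<lambda>a b.
     \<chi> (T s1 (ev G (tg x s1) s2 (map (T s3) a)) \<cdot>\<^bsub>x\<^esub>
       ev F x (contracted x s1 s2 s3) b)) as)) s"

lemma chr_comp_product:
  assumes F: "F \<in> families" "G \<in> families"
    and s: "composable x s" and as: "set as \<subseteq> cA (tg x s)" and \<chi>: "\<chi> \<in> chr x"
  shows "\<chi> (ev (comp_product C A F G) x s as) = u_val F G \<chi> x s as + v_val F G \<chi> x s as"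
proof -
  have x: "x \<in> Obj C" using s by (rule composable_Obj)
  have f: "F p q \<in> cochains K C A p q" "G p q \<in> cochains K C A p q" for p q
    using F by (auto simp: families_def)
  define p q where "p = length s" "q = length as"
  let ?S = "{(p1, q1, p2, q2). p1 + p2 = p \<and> q1 + q2 = q + 1}"
  let ?V = "{(p1, q1, p2, q2). p1 > 0 \<and> p2 > 0 \<and> p1 + p2 = p + 1 \<and> q1 + q2 = q}"
  let ?u = "\<lambda>(p1, q1, p2, q2). comp_u C A p1 q1 p2 q2 (F p1 q1) (G p2 q2) (x, s) as"
  let ?v = "\<lambda>(p1, q1, p2, q2). comp_v C A p1 q1 p2 q2 (F p1 q1) (G p2 q2) (x, s) as"
  have u: "?u t \<in> cA x" if "t \<in> ?S" for t
    using that as s multilinD(1)[OF cochain_multilin[OF comp_u_mem[OF f]]] by (auto simp: p_q_def)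
  have v: "?v t \<in> cA x" if "t \<in> ?V" for t
    using that as s multilinD(1)[OF cochain_multilin[OF comp_v_mem[OF f]]] by (auto simp: p_q_def)
  have "ev (comp_product C A F G) x s as = finsum (Alg A x) ?u ?S \<oplus>\<^bsub>Alg A x\<^esub> finsum (Alg A x) ?v ?V"
    using s as by (simp add: ev_def comp_product_def mk_cochain_apply vertex_ends Let_def p_q_def)
  moreover have "finsum (Alg A x) ?u ?S \<in> cA x" "finsum (Alg A x) ?v ?V \<in> cA x"
    by (rule finsum_closed[OF x u], assumption) (rule finsum_closed[OF x v], assumption)
  moreover have "\<chi> (finsum (Alg A x) ?u ?S) = (\<Sum>t\<in>?S. \<chi> (?u t))"
    by (rule chr_finsum[OF \<chi> x finite_insertions u])
  moreover have "\<chi> (finsum (Alg A x) ?v ?V) = (\<Sum>t\<in>?V. \<chi> (?v t))"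
    by (rule chr_finsum[OF \<chi> x finite_contractions v])
  ultimately have "\<chi> (ev (comp_product C A F G) x s as) = (\<Sum>t\<in>?S. \<chi> (?u t)) + (\<Sum>t\<in>?V. \<chi> (?v t))"
    using chrD[OF \<chi>] by (simp only:)
  \<comment> \<open>Writing \<open>q1\<close> as \<open>q + 1 - q2\<close> and \<open>p2\<close> as
    \<open>p - p1\<close> makes the summand a function of \<open>p1\<close>, \<open>i\<close> and
    \<open>q2\<close> alone, the shape required by \<open>sum_insertions\<close>.\<close>
  also have "(\<Sum>t\<in>?S. \<chi> (?u t)) = (\<Sum>(p1, q1, p2, q2)\<in>?S. \<Sum>i\<in>{1..q1}.
      \<chi> (insertion (F p1 (q + 1 - q2)) (G (p - p1) q2) x s p1 (i - 1) q2 as))"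
  proof (rule sum.cong[OF refl], clarify)
    fix p1 q1 p2 q2 assume pq: "p = p1 + p2" "q1 + q2 = q + 1"
    have "\<chi> (comp_u C A p1 q1 p2 q2 (F p1 q1) (G p2 q2) (x, s) as) =
        (\<Sum>i\<in>{1..q1}. \<chi> (insertion (F p1 q1) (G p2 q2) x s p1 (i - 1) q2 as))"
      using pq s as
      by (subst comp_u_apply[OF f s]) (auto simp: p_q_def
          intro!: chr_finsum[OF \<chi> x] multilinD(1)[OF insertion_multilin[OF f s]])
    moreover have "q + 1 - q2 = q1" "p - p1 = p2" "q2 \<le> q + 1" using pq by auto
    ultimately show "\<chi> (comp_u C A p1 q1 p2 q2 (F p1 q1) (G p2 q2) (x, s) as) =
        (\<Sum>i\<in>{1..q1}. \<chi> (insertion (F p1 (q + 1 - q2)) (G (p1 + p2 - p1) q2) x s p1 (i - 1) q2 as))"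
      by simp
  qed
  also have "\<dots> = u_val F G \<chi> x s as"
    unfolding u_val_def split3_sum_def split_sum_conv
      sum_insertions(1)[where k = "\<lambda>p1 i q2. \<chi> (insertion (F p1 (q + 1 - q2)) (G (p - p1) q2) x s p1 i q2 as)"]
    by (intro sum.cong refl) (auto simp: insertion_def ev_def p_q_def add.commute Suc_diff_le)
  \<comment> \<open>Here \<open>p1\<close> and \<open>q1\<close> are eliminated, which leaves the
    position, \<open>p2\<close> and \<open>q2\<close>.\<close>
  also have "(\<Sum>t\<in>?V. \<chi> (?v t)) = (\<Sum>(p1, q1, p2, q2)\<in>?V. \<Sum>i\<in>{1..p1}.
      \<chi> (contraction (F (p + 1 - p2) (q - q2)) (G p2 q2) x s (i - 1) p2 q2 as))"
  proof (rule sum.cong[OF refl], clarify)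
    fix p1 q1 p2 q2 assume pq: "0 < p1" "0 < p2" "p1 + p2 = p + 1" "q = q1 + q2"
    have "\<chi> (comp_v C A p1 q1 p2 q2 (F p1 q1) (G p2 q2) (x, s) as) =
        (\<Sum>i\<in>{1..p1}. \<chi> (contraction (F p1 q1) (G p2 q2) x s (i - 1) p2 q2 as))"
      using pq s as
      by (subst comp_v_apply[OF f s]) (auto simp: p_q_def
          intro!: chr_finsum[OF \<chi> x] multilinD(1)[OF contraction_multilin[OF f s]])
    moreover have "p + 1 - p2 = p1" "q - q2 = q1" using pq by auto
    ultimately show "\<chi> (comp_v C A p1 q1 p2 q2 (F p1 q1) (G p2 q2) (x, s) as) =
        (\<Sum>i\<in>{1..p1}. \<chi> (contraction (F (p + 1 - p2) (q1 + q2 - q2)) (G p2 q2) x s (i - 1) p2 q2 as))"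
      by simp
  qed
  also have "\<dots> = v_val F G \<chi> x s as"
    unfolding v_val_def split3_sum_def split_sum_conv on_nonempty_def
      sum_contractions(1)[where k = "\<lambda>i p2 q2. \<chi> (contraction (F (p + 1 - p2) (q - q2)) (G p2 q2) x s i p2 q2 as)"]
    by (intro sum.cong refl) (auto simp: contraction_def ev_def p_q_def add.commute Suc_diff_le intro!: sum.cong)
  finally show ?thesis .
qed

lemma comp_product_mem:
  assumes F: "F \<in> families" "G \<in> families"
  shows "comp_product C A F G \<in> families"
proof -
  have f: "F p q \<in> cochains K C A p q" "G p q \<in> cochains K C A p q" for p q
    using F by (auto simp: families_def)
  have "comp_product C A F G p q \<in> cochains K C A p q" for p q
    unfolding comp_product_def Let_def
  proof (rule mk_cochain_mem)
    fix x s assume s: "composable x s" "length s = p"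
    have "(\<lambda>as. (case t of (p1, q1, p2, q2) \<Rightarrow> comp_u C A p1 q1 p2 q2 (F p1 q1) (G p2 q2) (x, s) as))
        \<in> multilin q (tg x s) x"
      if "t \<in> {(p1, q1, p2, q2). p1 + p2 = p \<and> q1 + q2 = q + 1}" for t
      using that s cochain_multilin[OF comp_u_mem[OF f]] by auto
    moreover have "(\<lambda>as. (case t of (p1, q1, p2, q2) \<Rightarrow> comp_v C A p1 q1 p2 q2 (F p1 q1) (G p2 q2) (x, s) as))
        \<in> multilin q (tg x s) x"
      if "t \<in> {(p1, q1, p2, q2). p1 > 0 \<and> p2 > 0 \<and> p1 + p2 = p + 1 \<and> q1 + q2 = q}" for t
      using that s cochain_multilin[OF comp_v_mem[OF f]] by auto
    ultimately show "(\<lambda>as. finsum (Alg A (vertex C (x, s) 0)) (\<lambda>(p1, q1, p2, q2). comp_u C A p1 q1 p2 q2 (F p1 q1) (G p2 q2) (x, s) as)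
       {(p1, q1, p2, q2). p1 + p2 = p \<and> q1 + q2 = q + 1}
     \<oplus>\<^bsub>Alg A (vertex C (x, s) 0)\<^esub>
     finsum (Alg A (vertex C (x, s) 0)) (\<lambda>(p1, q1, p2, q2). comp_v C A p1 q1 p2 q2 (F p1 q1) (G p2 q2) (x, s) as)
       {(p1, q1, p2, q2). p1 > 0 \<and> p2 > 0 \<and> p1 + p2 = p + 1 \<and> q1 + q2 = q}) \<in> multilin q (tg x s) x"
      unfolding vertex_ends
      by (intro multilin_add multilin_finsum composable_Obj[OF s(1)]
          composable_tgt_Obj[OF s(1)] finite_insertions finite_contractions)
  qed
  then show ?thesis by (simp add: families_def)
qed

section \<open>The cup product\<close>

definition cup_term where
  "cup_term F G x s q i j as =
     F i j (x, take i s) (map (T (drop i s)) (take j as)) \<cdot>\<^bsub>x\<^esub>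
     T (take i s) (G (length s - i) (q - j) (tg x (take i s), drop i s) (drop j as))"

text \<open>The first factor uses the first part of the string, so its arguments are transported
  along the rest; the second factor uses that rest, so its value is transported along the first
  part.\<close>

definition cup_product :: "('o, 'm, 'a) total_cochain \<Rightarrow> ('o, 'm, 'a) total_cochain \<Rightarrow> ('o, 'm, 'a) total_cochain" where
  "cup_product F G = (\<lambda>p q. mk_cochain C A p q (\<lambda>(x, s) as.
     finsum (Alg A x) (\<lambda>(i, j). cup_term F G x s q i j as) ({0..p} \<times> {0..q})))"

definition cup_val :: "('o, 'm, 'a) total_cochain \<Rightarrow> ('o, 'm, 'a) total_cochain \<Rightarrow> ('o, 'm, 'a) evaluation" where
  "cup_val F G \<chi> x s as = split_sum (\<lambda>s1 s2. split_sum (\<lambda>a b.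
     \<chi> (ev F x s1 (map (T s2) a) \<cdot>\<^bsub>x\<^esub> T s1 (ev G (tg x s1) s2 b))) as) s"

lemma cup_term_multilin:
  assumes F: "F \<in> families" "G \<in> families" and s: "composable x s" and ij: "i \<le> length s" "j \<le> q"
  shows "cup_term F G x s q i j \<in> multilin q (tg x s) x"
proof -
  have f: "F p q \<in> cochains K C A p q" "G p q \<in> cochains K C A p q" for p q
    using F by (auto simp: families_def)
  have x: "x \<in> Obj C" using s by (rule composable_Obj)
  note c = composable_take_drop[OF s, of i]
  have "F i j (x, take i s) \<in> multilin j (tg x (take i s)) x"
    using cochain_multilin[OF f(1) c(1)] ij by simp
  from multilin_map[OF this, of "T (drop i s)" "tg x s"]
  have 1: "(\<lambda>as. F i j (x, take i s) (map (T (drop i s)) as)) \<in> multilin j (tg x s) x"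
    using lin_T[OF c(2)] c(3) by simp
  have "G (length s - i) (q - j) (tg x (take i s), drop i s) \<in> multilin (q - j) (tg x s) (tg x (take i s))"
    using cochain_multilin[OF f(2) c(2)] c(3) ij by simp
  from multilin_prod[OF x 1 multilin_lin[OF this lin_T[OF c(1)]]] show ?thesis
    unfolding cup_term_def[abs_def] by (rule multilin_id) (use ij in simp)
qed

lemma cup_product_mem:
  assumes F: "F \<in> families" "G \<in> families"
  shows "cup_product F G \<in> families"
proof -
  have "(\<lambda>as. finsum (Alg A x) (\<lambda>(i, j). cup_term F G x s q i j as) ({0..p} \<times> {0..q})) \<in> multilin q (tg x s) x"
    if s: "composable x s" "length s = p" for x s p q
    unfolding split_def
    by (intro multilin_finsum composable_Obj[OF s(1)] composable_tgt_Obj[OF s(1)] cup_term_multilin F s) (auto simp: s)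
  then show ?thesis
    unfolding families_def cup_product_def by (auto intro!: mk_cochain_mem)
qed

lemma chr_cup_product:
  assumes F: "F \<in> families" "G \<in> families"
    and s: "composable x s" and as: "set as \<subseteq> cA (tg x s)" and \<chi>: "\<chi> \<in> chr x"
  shows "\<chi> (ev (cup_product F G) x s as) = cup_val F G \<chi> x s as"
proof -
  have x: "x \<in> Obj C" using s by (rule composable_Obj)
  let ?I = "{0..length s} \<times> {0..length as}"
  have "ev (cup_product F G) x s as = finsum (Alg A x) (\<lambda>(i, j). cup_term F G x s (length as) i j as) ?I"
    using s as by (simp add: ev_def cup_product_def mk_cochain_apply)
  also have "\<chi> \<dots> = (\<Sum>t\<in>?I. \<chi> (case t of (i, j) \<Rightarrow> cup_term F G x s (length as) i j as))"
    using as by (intro chr_finsum[OF \<chi> x]) (auto intro!: multilinD(1)[OF cup_term_multilin[OF F s]])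
  also have "\<dots> = cup_val F G \<chi> x s as"
    unfolding cup_val_def split_sum_conv sum.cartesian_product
    by (intro sum.cong refl) (auto simp: cup_term_def ev_def)
  finally show ?thesis .
qed


section \<open>The coboundary squares to zero\<close>

text \<open>Every face in either direction preserves these typing conditions, provided that the
  character is pulled back along it; this is the content of \<open>ok_head\<close> to
  \<open>ok_arg_pair\<close>.\<close>

definition ok :: "('a \<Rightarrow> bit) \<Rightarrow> 'o \<Rightarrow> 'm list \<Rightarrow> 'a list \<Rightarrow> bool" where
  "ok \<chi> x s as \<longleftrightarrow> \<chi> \<in> chr x \<and> composable x s \<and> set as \<subseteq> cA (tg x s)"

lemma okD:
  assumes "ok \<chi> x s as"
  shows "\<chi> \<in> chr x" "composable x s" "set as \<subseteq> cA (tg x s)" "x \<in> Obj C" "tg x s \<in> Obj C"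
  using assms by (auto simp: ok_def intro: composable_Obj composable_tgt_Obj)

lemma ok_head: "ok \<chi> x (f # s') as \<Longrightarrow> ok (\<lambda>v. \<chi> (Map A f v)) (Dom C f) s' as"
  using chr_Map[of \<chi> f] by (auto simp: ok_def)

lemma ok_last: "ok \<chi> x (s' @ [f]) as \<Longrightarrow> ok \<chi> x s' (map (Map A f) as)"
  using Map_facts(1)[of f] by (auto simp: ok_def)

lemma ok_pair: "ok \<chi> x (l @ f # g # r) as \<Longrightarrow> ok \<chi> x (l @ Comp C f g # r) as"
  unfolding ok_def using contract_pair(1,2)[of x l f g r] by metis

lemma ok_arg_head: "ok \<chi> x s (a # bs) \<Longrightarrow> ok (\<lambda>v. \<chi> (T s a \<cdot>\<^bsub>x\<^esub> v)) x s bs"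
  by (auto simp: ok_def intro!: chr_lmult T_closed composable_Obj)

lemma ok_arg_last: "ok \<chi> x s (bs @ [a]) \<Longrightarrow> ok (\<lambda>v. \<chi> (v \<cdot>\<^bsub>x\<^esub> T s a)) x s bs"
  by (auto simp: ok_def intro!: chr_rmult T_closed composable_Obj)

lemma ok_arg_pair: "ok \<chi> x s (l @ a # b # r) \<Longrightarrow> ok \<chi> x s (l @ (a \<cdot>\<^bsub>tg x s\<^esub> b) # r)"
  by (auto simp: ok_def intro!: Alg_closed composable_tgt_Obj)

lemma Map_mult_rev: "f \<in> Arr C \<Longrightarrow> Cod C f = y \<Longrightarrow> a \<in> cA (Dom C f) \<Longrightarrow> b \<in> cA (Dom C f) \<Longrightarrow>
    Map A f a \<cdot>\<^bsub>y\<^esub> Map A f b = Map A f (a \<cdot>\<^bsub>Dom C f\<^esub> b)"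
  by (auto simp: Map_facts)

text \<open>Formulas for evaluations are valid for \<open>ok\<close> data only. At \<open>ok\<close>
  data \<open>DS\<close> reads its operand at \<open>ok\<close> data, so such a formula can be
  substituted under it.\<close>

lemma DS_cong:
  assumes e: "\<And>\<chi> x s as. ok \<chi> x s as \<Longrightarrow> e \<chi> x s as = e' \<chi> x s as" and ok: "ok \<chi> x s as"
  shows "DS e \<chi> x s as = DS e' \<chi> x s as"
  unfolding DS_def
  using ok
  by (intro arg_cong2[where f = "(+)"] head_sum_cong last_sum_cong pair_sum_cong e)
    (auto intro: ok_head ok_last ok_pair)

lemma DH_cong:
  assumes e: "\<And>\<chi> x s as. ok \<chi> x s as \<Longrightarrow> e \<chi> x s as = e' \<chi> x s as" and ok: "ok \<chi> x s as"
  shows "DH e \<chi> x s as = DH e' \<chi> x s as"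
  unfolding DH_def
  using ok
  by (intro arg_cong2[where f = "(+)"] head_sum_cong last_sum_cong pair_sum_cong e)
    (auto intro: ok_arg_head ok_arg_last ok_arg_pair)

lemma DS_add: "DS (\<lambda>\<chi> x s as. e \<chi> x s as + e' \<chi> x s as) \<chi> x s as = DS e \<chi> x s as + DS e' \<chi> x s as"
  by (simp add: DS_def word_sum_add ac_simps)

lemma DH_add: "DH (\<lambda>\<chi> x s as. e \<chi> x s as + e' \<chi> x s as) \<chi> x s as = DH e \<chi> x s as + DH e' \<chi> x s as"
  by (simp add: DH_def word_sum_add ac_simps)

abbreviation dval :: "('o, 'm, 'a) total_cochain \<Rightarrow> ('o, 'm, 'a) evaluation" where
  "dval F \<equiv> (\<lambda>\<chi> x s as. DS (val F) \<chi> x s as + DH (val F) \<chi> x s as)"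

lemma val_delta: "F \<in> families \<Longrightarrow> ok \<chi> x s as \<Longrightarrow>
    val (delta C A F) \<chi> x s as = DS (val F) \<chi> x s as + DH (val F) \<chi> x s as"
  by (simp add: chr_delta okD)

lemma val_delta_all: "F \<in> families \<Longrightarrow>
    \<forall>\<chi> x s as. ok \<chi> x s as \<longrightarrow> val (delta C A F) \<chi> x s as = dval F \<chi> x s as"
  by (intro allI impI) (rule val_delta)

lemma Alg_assoc: "x \<in> Obj C \<Longrightarrow> a \<in> cA x \<Longrightarrow> b \<in> cA x \<Longrightarrow> c \<in> cA x \<Longrightarrow>
    (a \<cdot>\<^bsub>x\<^esub> b) \<cdot>\<^bsub>x\<^esub> c = a \<cdot>\<^bsub>x\<^esub> (b \<cdot>\<^bsub>x\<^esub> c)"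
  using assoc_algebra.mult_assoc[OF Alg_algebra] .

text \<open>Sorting the summands brings equal ones together, where they cancel in characteristic
  2.\<close>

lemmas cancel = ac_simps bit_add_same add_0 add_0_right

text \<open>The simplicial identities modulo 2. Functoriality enters twice: removing two arrows at
  an end one after the other agrees with removing their composite, on values (1) and on arguments
  (2).\<close>

lemma DS_DS:
  assumes F: "F \<in> families" and ok: "ok \<chi> x s as"
  shows "DS (DS (val F)) \<chi> x s as = 0"
proof -
  have 1: "head_sum (\<lambda>f. head_sum (\<lambda>g s'. \<chi> (Map A f (Map A g (ev F (Dom C g) s' as))))) s =
    head_sum (\<lambda>f. head_sum (\<lambda>g s'. \<chi> (Map A (Comp C f g) (ev F (Dom C (Comp C f g)) s' as)))) s"
    using okD[OF ok] F by (intro head_sum_cong) (auto simp: Map_Comp Dom_Comp ev_closed)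
  have 2: "last_sum (\<lambda>s' f. last_sum (\<lambda>s'' g. \<chi> (ev F x s'' (map (Map A g) (map (Map A f) as)))) s') s =
    last_sum (\<lambda>s' f. last_sum (\<lambda>s'' g. \<chi> (ev F x s'' (map (Map A (Comp C g f)) as))) s') s"
    using okD[OF ok] by (intro last_sum_cong arg_cong[where f = \<chi>] arg_cong[where f = "ev F x _"])
      (auto simp: Map_Comp)
  have 3: "pair_sum (Comp C) (pair_sum (Comp C) (\<lambda>s'. \<chi> (ev F x s' as))) s = 0"
    using okD[OF ok] by (intro pair_pair) (auto simp: Comp_assoc)
  show ?thesis
    unfolding DS_def
    by (simp only: word_sum_add head_pair last_pair head_last 1 2 3 cancel)
qed

lemma DH_DH:
  assumes F: "F \<in> families" and ok: "ok \<chi> x s as"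
  shows "DH (DH (val F)) \<chi> x s as = 0"
proof -
  note ok' = okD[OF ok]
  have 1: "head_sum (\<lambda>a. head_sum (\<lambda>b bs. \<chi> (T s a \<cdot>\<^bsub>x\<^esub> (T s b \<cdot>\<^bsub>x\<^esub> ev F x s bs)))) as =
    head_sum (\<lambda>a. head_sum (\<lambda>b bs. \<chi> (T s (a \<cdot>\<^bsub>tg x s\<^esub> b) \<cdot>\<^bsub>x\<^esub> ev F x s bs))) as"
    using ok' F by (intro head_sum_cong) (auto simp: T_mult Alg_assoc ev_closed T_closed)
  have 2: "last_sum (\<lambda>bs b. last_sum (\<lambda>cs a. \<chi> ((ev F x s cs \<cdot>\<^bsub>x\<^esub> T s a) \<cdot>\<^bsub>x\<^esub> T s b)) bs) as =
    last_sum (\<lambda>bs b. last_sum (\<lambda>cs a. \<chi> (ev F x s cs \<cdot>\<^bsub>x\<^esub> T s (a \<cdot>\<^bsub>tg x s\<^esub> b))) bs) as"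
    using ok' F by (intro last_sum_cong) (auto simp: T_mult Alg_assoc ev_closed T_closed)
  have 3: "pair_sum (\<otimes>\<^bsub>Alg A (tg x s)\<^esub>) (pair_sum (\<otimes>\<^bsub>Alg A (tg x s)\<^esub>) (\<lambda>bs. \<chi> (ev F x s bs))) as = 0"
    using ok' by (intro pair_pair) (auto simp: Alg_assoc)
  have 4: "last_sum (\<lambda>bs b. head_sum (\<lambda>a cs. \<chi> ((T s a \<cdot>\<^bsub>x\<^esub> ev F x s cs) \<cdot>\<^bsub>x\<^esub> T s b)) bs) as =
    last_sum (\<lambda>bs b. head_sum (\<lambda>a cs. \<chi> (T s a \<cdot>\<^bsub>x\<^esub> (ev F x s cs \<cdot>\<^bsub>x\<^esub> T s b))) bs) as"
    using ok' F by (intro last_sum_cong head_sum_cong) (auto simp: Alg_assoc ev_closed T_closed)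
  show ?thesis
    unfolding DH_def
    by (simp only: word_sum_add head_pair last_pair head_last 1 2 3 4 cancel)
qed

text \<open>The two operators work on different words, so the sums may be interchanged. The outer
  faces are compatible because structure maps are multiplicative and composing two arrows of the
  string does not change its structure map.\<close>

lemma DS_DH:
  assumes F: "F \<in> families" and ok: "ok \<chi> x s as"
  shows "DS (DH (val F)) \<chi> x s as = DH (DS (val F)) \<chi> x s as"
proof -
  let ?m = "(\<otimes>\<^bsub>Alg A (tg x s)\<^esub>)"
  have "DH (DS (val F)) \<chi> x s as =
    head_sum (\<lambda>f s'. head_sum (\<lambda>a bs. \<chi> (T s a \<cdot>\<^bsub>x\<^esub> Map A f (ev F (Dom C f) s' bs))) as +
      last_sum (\<lambda>bs a. \<chi> (Map A f (ev F (Dom C f) s' bs) \<cdot>\<^bsub>x\<^esub> T s a)) as +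
      pair_sum ?m (\<lambda>bs. \<chi> (Map A f (ev F (Dom C f) s' bs))) as) s +
    last_sum (\<lambda>s' f. head_sum (\<lambda>a bs. \<chi> (T s a \<cdot>\<^bsub>x\<^esub> ev F x s' (map (Map A f) bs))) as +
      last_sum (\<lambda>bs a. \<chi> (ev F x s' (map (Map A f) bs) \<cdot>\<^bsub>x\<^esub> T s a)) as +
      pair_sum ?m (\<lambda>bs. \<chi> (ev F x s' (map (Map A f) bs))) as) s +
    pair_sum (Comp C) (\<lambda>s'. head_sum (\<lambda>a bs. \<chi> (T s a \<cdot>\<^bsub>x\<^esub> ev F x s' bs)) as +
      last_sum (\<lambda>bs a. \<chi> (ev F x s' bs \<cdot>\<^bsub>x\<^esub> T s a)) as + pair_sum ?m (\<lambda>bs. \<chi> (ev F x s' bs)) as) s"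
    unfolding DH_def DS_def
    by (simp only: word_sum_add head_head_swap[of _ as] last_last_swap[of _ as] pair_pair_swap[of _ _ _ as]
      pair_head_swap pair_last_swap head_last_swap ac_simps)
  also have "\<dots> = DS (DH (val F)) \<chi> x s as"
    unfolding DS_def DH_def head_sum_map last_sum_map
    by (intro arg_cong2[where f = "(+)"] head_sum_cong last_sum_cong pair_sum_cong pair_sum_map[symmetric];
      use okD[OF ok] F in \<open>auto simp: Map_mult_rev Map_facts(1) T_closed ev_closed subset_iff Map_Comp Dom_Comp\<close>)
  finally show ?thesis ..
qed

text \<open>Besides the two squares there are two mixed terms, which are equal and cancel.\<close>

lemma delta_delta:
  assumes F: "F \<in> families"
  shows "delta C A (delta C A F) = total_zero C A"
proof (rule families_eqI)
  fix x s as \<chi> assume "composable x s" "set as \<subseteq> cA (tg x s)" "\<chi> \<in> chr x"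
  then have ok: "ok \<chi> x s as" by (simp add: ok_def)
  have "DS (val (delta C A F)) \<chi> x s as =
      DS (\<lambda>\<chi> x s as. DS (val F) \<chi> x s as + DH (val F) \<chi> x s as) \<chi> x s as"
    by (rule DS_cong[OF val_delta[OF F] ok])
  moreover have "DH (val (delta C A F)) \<chi> x s as =
      DH (\<lambda>\<chi> x s as. DS (val F) \<chi> x s as + DH (val F) \<chi> x s as) \<chi> x s as"
    by (rule DH_cong[OF val_delta[OF F] ok])
  ultimately show "\<chi> (ev (delta C A (delta C A F)) x s as) = \<chi> (ev (total_zero C A) x s as)"
    using val_delta[OF delta_mem[OF F] ok] okD[OF ok]
    by (simp add: DS_add DH_add DS_DS[OF F ok] DH_DH[OF F ok] DS_DH[OF F ok] ev_zero chr_zero)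
qed (intro delta_mem F total_zero_mem)+


section \<open>The coboundary is a derivation of the cup product\<close>

lemma contract_pair_eqs:
  assumes "composable x s" "s = l @ f # g # r"
  shows "tg x (l @ Comp C f g # r) = tg x s" "a \<in> cA (tg x s) \<Longrightarrow> T (l @ Comp C f g # r) a = T s a"
    "set as \<subseteq> cA (tg x s) \<Longrightarrow> map (T (l @ Comp C f g # r)) as = map (T s) as"
    "composable x (l @ Comp C f g # r)"
  using assms contract_pair[of x l f g r] by (auto intro!: map_cong simp del: foldr_append foldr.simps)

lemma T_snoc: "T (s @ [f]) = (\<lambda>a. T s (Map A f a))"
  by (rule ext) simp

lemma split_cut:
  assumes F: "F \<in> families" "G \<in> families" and ok: "ok \<chi> x s as" and s: "s = s1 @ s2"
  shows "composable x s1" "composable (tg x s1) s2" "tg (tg x s1) s2 = tg x s"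
    and "set bs \<subseteq> cA (tg x s) \<Longrightarrow> set (map (T s2) bs) \<subseteq> cA (tg x s1)"
    and "set bs \<subseteq> cA (tg x s) \<Longrightarrow> ev G (tg x s1) s2 bs \<in> cA (tg x s1)"
    and "set bs \<subseteq> cA (tg x s) \<Longrightarrow> ev F x s1 (map (T s2) bs) \<in> cA x"
    and "set bs \<subseteq> cA (tg x s) \<Longrightarrow> T s1 (ev G (tg x s1) s2 bs) \<in> cA x"
proof -
  note ok' = okD[OF ok]
  show c: "composable x s1" "composable (tg x s1) s2" "tg (tg x s1) s2 = tg x s"
    using ok' s by auto
  show m: "set (map (T s2) bs) \<subseteq> cA (tg x s1)" if "set bs \<subseteq> cA (tg x s)" for bs
    using c that by (intro map_T_closed) simp_all
  show g: "ev G (tg x s1) s2 bs \<in> cA (tg x s1)" if "set bs \<subseteq> cA (tg x s)" for bs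
    using c that by (intro ev_closed F) simp_all
  show "ev F x s1 (map (T s2) bs) \<in> cA x" if "set bs \<subseteq> cA (tg x s)" for bs
    by (rule ev_closed[OF F(1) c(1) m[OF that]])
  show "T s1 (ev G (tg x s1) s2 bs) \<in> cA x" if "set bs \<subseteq> cA (tg x s)" for bs
    by (rule T_closed[OF c(1) g[OF that]])
qed

lemma cup_DS:
  assumes F: "F \<in> families" "G \<in> families" and ok: "ok \<chi> x s as"
  shows "DS (cup_val F G) \<chi> x s as = split_sum (\<lambda>s1 s2. split_sum (\<lambda>a b.
      DS (val F) (\<lambda>v. \<chi> (v \<cdot>\<^bsub>x\<^esub> T s1 (ev G (tg x s1) s2 b))) x s1 (map (T s2) a) +
      DS (val G) (\<lambda>v. \<chi> (ev F x s1 (map (T s2) a) \<cdot>\<^bsub>x\<^esub> T s1 v)) (tg x s1) s2 b) as) s"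
proof -
  note k = split_cut[OF F ok]
  \<comment> \<open>With the cut of the arguments held fixed, what remains is a single sum over cuts
    of the string, to which \<open>cut_leibniz\<close> applies.\<close>
  define q where "q \<chi> x s a b = split_sum (\<lambda>s1 s2.
     \<chi> (ev F x s1 (map (T s2) a) \<cdot>\<^bsub>x\<^esub> T s1 (ev G (tg x s1) s2 b))) s" for \<chi> :: "'a \<Rightarrow> bit" and x s a b
  have cup_val: "cup_val F G \<chi> x s as = split_sum (q \<chi> x s) as" for \<chi> x s as
    unfolding cup_val_def q_def by (rule split_split_swap)
  have inner: "head_sum (\<lambda>f s'. q (\<lambda>v. \<chi> (Map A f v)) (Dom C f) s' a b) s +
      last_sum (\<lambda>s' f. q \<chi> x s' (map (Map A f) a) (map (Map A f) b)) s +
      pair_sum (Comp C) (\<lambda>s'. q \<chi> x s' a b) s =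
    split_sum (\<lambda>s1 s2.
      DS (val F) (\<lambda>v. \<chi> (v \<cdot>\<^bsub>x\<^esub> T s1 (ev G (tg x s1) s2 b))) x s1 (map (T s2) a) +
      DS (val G) (\<lambda>v. \<chi> (ev F x s1 (map (T s2) a) \<cdot>\<^bsub>x\<^esub> T s1 v)) (tg x s1) s2 b) s"
    if "as = a @ b" for a b
  proof -
    have a: "set a \<subseteq> cA (tg x s)" and b: "set b \<subseteq> cA (tg x s)" using okD(3)[OF ok] that by auto
    show ?thesis
      \<comment> \<open>The arrow \<open>f\<close> at the cut acts on the arguments of
        \<open>F\<close> and on the value of \<open>G\<close>. The same term is the last face of
        \<open>F\<close> and the first face of \<open>G\<close>.\<close>
      unfolding q_def DS_def cut_leibniz[where mid = "\<lambda>s1 f s2. \<chi> (ev F x s1 (map (T (f # s2)) a) \<cdot>\<^bsub>x\<^esub>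
        T s1 (Map A f (ev G (Dom C f) s2 b)))"]
    proof (intro split_sum_cong arg_cong2[where f = "(+)"] head_sum_cong last_sum_cong pair_sum_cong)
      fix s1 s2 f s' assume s: "s = s1 @ s2" and f: "s1 = f # s'"
      have c: "f \<in> Arr C" "Cod C f = x" "composable (Dom C f) s'" and t: "tg (Dom C f) s' = tg x s1"
        using k(1)[OF s] unfolding f by auto
      have 1: "ev F (Dom C f) s' (map (T s2) a) \<in> cA (Dom C f)"
        by (rule ev_closed[OF F(1) c(3)]) (simp only: t k(4)[OF s a])
      have 2: "T s' (ev G (tg x s1) s2 b) \<in> cA (Dom C f)"
        by (rule T_closed[OF c(3)]) (simp only: t k(5)[OF s b])
      show "\<chi> (Map A f (ev F (Dom C f) s' (map (T s2) a) \<cdot>\<^bsub>Dom C f\<^esub>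
            T s' (ev G (tg (Dom C f) s') s2 b))) =
          \<chi> (Map A f (ev F (Dom C f) s' (map (T s2) a)) \<cdot>\<^bsub>x\<^esub> T s1 (ev G (tg x s1) s2 b))"
        using Map_facts(4)[OF c(1) 1 2] unfolding t c(2) by (simp add: f)
    next
      fix s1 s2 l f g r assume s: "s = s1 @ s2" "s1 = l @ f # g # r"
      note e = contract_pair_eqs[OF k(1)[OF s(1)] s(2)]
      show "\<chi> (ev F x (l @ Comp C f g # r) (map (T s2) a) \<cdot>\<^bsub>x\<^esub>
          T (l @ Comp C f g # r) (ev G (tg x (l @ Comp C f g # r)) s2 b)) =
        \<chi> (ev F x (l @ Comp C f g # r) (map (T s2) a) \<cdot>\<^bsub>x\<^esub> T s1 (ev G (tg x s1) s2 b))"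
        using e(2)[OF k(5)[OF s(1) b]] by (simp only: e(1))
    next
      fix s1 s2 l f g r assume s: "s = s1 @ s2" "s2 = l @ f # g # r"
      from contract_pair_eqs(3)[OF k(2)[OF s(1)] s(2), of a] a
      show "\<chi> (ev F x s1 (map (T (l @ Comp C f g # r)) a) \<cdot>\<^bsub>x\<^esub>
          T s1 (ev G (tg x s1) (l @ Comp C f g # r) b)) =
        \<chi> (ev F x s1 (map (T s2) a) \<cdot>\<^bsub>x\<^esub> T s1 (ev G (tg x s1) (l @ Comp C f g # r) b))"
        by (simp only: k(3)[OF s(1)])
    qed (auto simp: comp_def T_snoc)
  qed
  show ?thesis
    unfolding DS_def[of "cup_val F G"]
    unfolding cup_val split_sum_map split_head_swap[symmetric] split_last_swap[symmetric] split_pair_swap[symmetric]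
      split_sum_add[symmetric]
    by (rule trans[OF split_sum_cong[OF inner] split_split_swap])
qed

lemma cup_DH:
  assumes F: "F \<in> families" "G \<in> families" and ok: "ok \<chi> x s as"
  shows "DH (cup_val F G) \<chi> x s as = split_sum (\<lambda>s1 s2. split_sum (\<lambda>a b.
      DH (val F) (\<lambda>v. \<chi> (v \<cdot>\<^bsub>x\<^esub> T s1 (ev G (tg x s1) s2 b))) x s1 (map (T s2) a) +
      DH (val G) (\<lambda>v. \<chi> (ev F x s1 (map (T s2) a) \<cdot>\<^bsub>x\<^esub> T s1 v)) (tg x s1) s2 b) as) s"
  unfolding DH_def[of "cup_val F G"]
  unfolding cup_val_def split_head_swap[symmetric] split_last_swap[symmetric] split_pair_swap[symmetric]
    split_sum_add[symmetric]
proof (rule split_sum_cong)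
  fix s1 s2 assume s: "s = s1 @ s2"
  note ok' = okD[OF ok] and k = split_cut[OF F ok s]
  let ?l = "\<lambda>a. ev F x s1 (map (T s2) a)" and ?g = "ev G (tg x s1) s2"
  have T2: "T s2 a \<in> cA (tg x s1)" if "a \<in> cA (tg x s)" for a
    using T_closed[OF k(2)] k(3) that by simp
  have T1: "T s a = T s1 (T s2 a)" for a by (simp add: s)
  have T1': "T s1 (T s2 a) \<in> cA x" if "a \<in> cA (tg x s)" for a
    using T_closed[OF k(1) T2[OF that]] .
  have args: "set a \<subseteq> cA (tg x s)" "set b \<subseteq> cA (tg x s)" if "as = a @ b" for a b
    using ok'(3) that by auto
  note closed = k(6,7) T1' Alg_assoc ok'(4)
  show "head_sum (\<lambda>a0. split_sum (\<lambda>a b. \<chi> (T s a0 \<cdot>\<^bsub>x\<^esub> (?l a \<cdot>\<^bsub>x\<^esub> T s1 (?g b))))) as +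
      last_sum (\<lambda>bs a0. split_sum (\<lambda>a b. \<chi> ((?l a \<cdot>\<^bsub>x\<^esub> T s1 (?g b)) \<cdot>\<^bsub>x\<^esub> T s a0)) bs) as +
      pair_sum (\<otimes>\<^bsub>Alg A (tg x s)\<^esub>) (split_sum (\<lambda>a b. \<chi> (?l a \<cdot>\<^bsub>x\<^esub> T s1 (?g b)))) as =
    split_sum (\<lambda>a b. DH (val F) (\<lambda>v. \<chi> (v \<cdot>\<^bsub>x\<^esub> T s1 (?g b))) x s1 (map (T s2) a) +
      DH (val G) (\<lambda>v. \<chi> (?l a \<cdot>\<^bsub>x\<^esub> T s1 v)) (tg x s1) s2 b) as"
    \<comment> \<open>The argument at the cut stands between the two factors; by associativity it
      belongs to the right outer face of \<open>F\<close> as well as to the left outer face of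
      \<open>G\<close>.\<close>
    unfolding cut_leibniz[where mid = "\<lambda>a a0 b. \<chi> ((?l a \<cdot>\<^bsub>x\<^esub> T s a0) \<cdot>\<^bsub>x\<^esub> T s1 (?g b))"]
      DH_def head_sum_map last_sum_map T1 k(3)
  proof (intro split_sum_cong arg_cong2[where f = "(+)"] head_sum_cong last_sum_cong pair_sum_map[symmetric] refl)
    fix a b a0 a1 assume "as = a @ b" "a0 \<in> set a" "a1 \<in> set a"
    then have "a0 \<in> cA (tg x s)" "a1 \<in> cA (tg x s)" using args by blast+
    then show "T s2 a0 \<cdot>\<^bsub>tg x s1\<^esub> T s2 a1 = T s2 (a0 \<cdot>\<^bsub>tg x s\<^esub> a1)"
      using T_mult[OF k(2)] k(3) by simp
  qed (use ok'(3) in \<open>auto simp: closed T2 k(5) T_mult[OF k(1)]\<close>)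
qed

lemma ok_cup:
  assumes F: "F \<in> families" "G \<in> families" and ok: "ok \<chi> x s as" and *: "s = s1 @ s2" "as = a @ b"
  shows "ok (\<lambda>v. \<chi> (v \<cdot>\<^bsub>x\<^esub> T s1 (ev G (tg x s1) s2 b))) x s1 (map (T s2) a)"
    and "ok (\<lambda>v. \<chi> (ev F x s1 (map (T s2) a) \<cdot>\<^bsub>x\<^esub> T s1 v)) (tg x s1) s2 b"
proof -
  note ok' = okD[OF ok] and k = split_cut[OF F ok *(1)]
  have sb: "set a \<subseteq> cA (tg x s)" "set b \<subseteq> cA (tg x s)" using ok' * by auto
  then show "ok (\<lambda>v. \<chi> (v \<cdot>\<^bsub>x\<^esub> T s1 (ev G (tg x s1) s2 b))) x s1 (map (T s2) a)"
    unfolding ok_def using k(1,4) chr_rmult[OF ok'(1,4) k(7)] by (simp only: simp_thms)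
  show "ok (\<lambda>v. \<chi> (ev F x s1 (map (T s2) a) \<cdot>\<^bsub>x\<^esub> T s1 v)) (tg x s1) s2 b"
    unfolding ok_def using sb k(2,3) chr_T[OF chr_lmult[OF ok'(1,4) k(6)] k(1)] by (simp only: simp_thms)
qed

text \<open>Each summand is an evaluation of \<open>F\<close> at a pulled-back character, so any
  formula for \<open>val F\<close> can be substituted. It serves to replace
  \<open>val (delta C A F)\<close> by \<open>dval F\<close> inside a product.\<close>

lemma cup_val_left_cong:
  assumes F: "F \<in> families" "G \<in> families" and ok: "ok \<chi> x s as"
    and e: "\<forall>\<chi> x s as. ok \<chi> x s as \<longrightarrow> val F \<chi> x s as = e \<chi> x s as"
  shows "cup_val F G \<chi> x s as = split_sum (\<lambda>s1 s2. split_sum (\<lambda>a b.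
      e (\<lambda>v. \<chi> (v \<cdot>\<^bsub>x\<^esub> T s1 (ev G (tg x s1) s2 b))) x s1 (map (T s2) a)) as) s"
  unfolding cup_val_def by (intro split_sum_cong) (rule e[rule_format, OF ok_cup(1)[OF F ok]])

lemma cup_val_right_cong:
  assumes F: "F \<in> families" "G \<in> families" and ok: "ok \<chi> x s as"
    and e: "\<forall>\<chi> x s as. ok \<chi> x s as \<longrightarrow> val G \<chi> x s as = e \<chi> x s as"
  shows "cup_val F G \<chi> x s as = split_sum (\<lambda>s1 s2. split_sum (\<lambda>a b.
      e (\<lambda>v. \<chi> (ev F x s1 (map (T s2) a) \<cdot>\<^bsub>x\<^esub> T s1 v)) (tg x s1) s2 b) as) s"
  unfolding cup_val_def by (intro split_sum_cong) (rule e[rule_format, OF ok_cup(2)[OF F ok]])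

lemma val_cup: "F \<in> families \<Longrightarrow> G \<in> families \<Longrightarrow> ok \<chi> x s as \<Longrightarrow>
    val (cup_product F G) \<chi> x s as = cup_val F G \<chi> x s as"
  by (simp add: chr_cup_product okD)

lemma cup_leibniz:
  assumes F: "F \<in> families" "G \<in> families" and ok: "ok \<chi> x s as"
  shows "val (delta C A (cup_product F G)) \<chi> x s as =
    val (cup_product (delta C A F) G) \<chi> x s as + val (cup_product F (delta C A G)) \<chi> x s as"
proof -
  have "val (delta C A (cup_product F G)) \<chi> x s as =
      DS (val (cup_product F G)) \<chi> x s as + DH (val (cup_product F G)) \<chi> x s as"
    by (rule val_delta[OF cup_product_mem[OF F] ok])
  moreover have "DS (val (cup_product F G)) \<chi> x s as = DS (cup_val F G) \<chi> x s as"
    by (rule DS_cong[OF val_cup[OF F] ok])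
  moreover have "DH (val (cup_product F G)) \<chi> x s as = DH (cup_val F G) \<chi> x s as"
    by (rule DH_cong[OF val_cup[OF F] ok])
  ultimately show ?thesis
    unfolding val_cup[OF delta_mem[OF F(1)] F(2) ok] val_cup[OF F(1) delta_mem[OF F(2)] ok]
      cup_DS[OF F ok] cup_DH[OF F ok]
        cup_val_left_cong[where e = "dval F", OF delta_mem[OF F(1)] F(2) ok val_delta_all[OF F(1)]]
      cup_val_right_cong[where e = "dval G", OF F(1) delta_mem[OF F(2)] ok val_delta_all[OF F(2)]]
    by (simp add: split_sum_add ext[OF split_sum_add] ac_simps)
qed


section \<open>The coboundary of a composition product\<close>

lemma ok_u_val:
  assumes F: "F \<in> families" "G \<in> families" and ok: "ok \<chi> x s as"
    and *: "s = s1 @ s2" "as = a @ b @ c"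
  shows "ok \<chi> x s1 (inserted G x s1 s2 a b c)"
    and "ok (\<lambda>v. \<chi> (ev F x s1 (map (T s2) a @ v # map (T s2) c))) (tg x s1) s2 b"
proof -
  note k = split_cut[OF F ok *(1)] and ok' = okD[OF ok]
  have sb: "set a \<subseteq> cA (tg x s)" "set b \<subseteq> cA (tg x s)" "set c \<subseteq> cA (tg x s)" using ok' * by auto
  then show "ok \<chi> x s1 (inserted G x s1 s2 a b c)"
    using k(1) k(4)[of a] k(4)[of c] k(5)[of b] ok'(1) by (simp add: ok_def)
  show "ok (\<lambda>v. \<chi> (ev F x s1 (map (T s2) a @ v # map (T s2) c))) (tg x s1) s2 b"
    using sb k(1,2,3) chr_ev[OF ok'(1) F(1) k(1) k(4)[of a] k(4)[of c]] by (simp add: ok_def)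
qed

lemma u_val_left_cong:
  assumes F: "F \<in> families" "G \<in> families" and ok: "ok \<chi> x s as"
    and e: "\<forall>\<chi> x s as. ok \<chi> x s as \<longrightarrow> val F \<chi> x s as = e \<chi> x s as"
  shows "u_val F G \<chi> x s as = split_sum (\<lambda>s1 s2. split3_sum (\<lambda>a b c.
      e \<chi> x s1 (inserted G x s1 s2 a b c)) as) s"
  unfolding u_val_def by (intro split_sum_cong split3_sum_cong) (rule e[rule_format, OF ok_u_val(1)[OF F ok]])

lemma u_val_right_cong:
  assumes F: "F \<in> families" "G \<in> families" and ok: "ok \<chi> x s as"
    and e: "\<forall>\<chi> x s as. ok \<chi> x s as \<longrightarrow> val G \<chi> x s as = e \<chi> x s as"
  shows "u_val F G \<chi> x s as = split_sum (\<lambda>s1 s2. split3_sum (\<lambda>a b c.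
      e (\<lambda>v. \<chi> (ev F x s1 (map (T s2) a @ v # map (T s2) c))) (tg x s1) s2 b) as) s"
  unfolding u_val_def by (intro split_sum_cong split3_sum_cong) (rule e[rule_format, OF ok_u_val(2)[OF F ok]])

text \<open>In \<open>u\<close> the string is merely cut in two, as in a cup product, so the Leibniz
  rule has no extra terms in this direction. The common term has the arrow at the cut acting on the
  value of \<open>G\<close> and on the outer arguments.\<close>

lemma insertion_DS:
  assumes F: "F \<in> families" "G \<in> families" and ok: "ok \<chi> x s as"
  shows "DS (u_val F G) \<chi> x s as = split_sum (\<lambda>s1 s2. split3_sum (\<lambda>a b c.
      DS (val F) \<chi> x s1 (inserted G x s1 s2 a b c) +
      DS (val G) (\<lambda>v. \<chi> (ev F x s1 (map (T s2) a @ v # map (T s2) c))) (tg x s1) s2 b) as) s"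
proof -
  note k = split_cut[OF F ok]
  define q where "q \<chi> x s a b c = split_sum (\<lambda>s1 s2.
     \<chi> (ev F x s1 (inserted G x s1 s2 a b c))) s"
    for \<chi> :: "'a \<Rightarrow> bit" and x s a b c
  have u_val: "u_val F G \<chi> x s as = split3_sum (q \<chi> x s) as" for \<chi> x s as
    unfolding u_val_def q_def by (rule split3_split_swap[symmetric])
  have inner: "head_sum (\<lambda>f s'. q (\<lambda>v. \<chi> (Map A f v)) (Dom C f) s' a b c) s +
      last_sum (\<lambda>s' f. q \<chi> x s' (map (Map A f) a) (map (Map A f) b) (map (Map A f) c)) s +
      pair_sum (Comp C) (\<lambda>s'. q \<chi> x s' a b c) s =
    split_sum (\<lambda>s1 s2.
      DS (val F) \<chi> x s1 (inserted G x s1 s2 a b c) +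
      DS (val G) (\<lambda>v. \<chi> (ev F x s1 (map (T s2) a @ v # map (T s2) c))) (tg x s1) s2 b) s"
    if "as = a @ b @ c" for a b c
  proof -
    have a: "set a \<subseteq> cA (tg x s)" and c: "set c \<subseteq> cA (tg x s)" using okD(3)[OF ok] that by auto
    show ?thesis
      unfolding q_def DS_def cut_leibniz[where mid = "\<lambda>s1 f s2. \<chi> (ev F x s1
        (map (T (f # s2)) a @ Map A f (ev G (Dom C f) s2 b) # map (T (f # s2)) c))"]
    proof (intro split_sum_cong arg_cong2[where f = "(+)"] head_sum_cong last_sum_cong pair_sum_cong)
      fix s1 s2 l f g r assume s: "s = s1 @ s2" "s1 = l @ f # g # r"
      note e = contract_pair_eqs(1)[OF k(1)[OF s(1)] s(2)]
      show "\<chi> (ev F x (l @ Comp C f g # r) (map (T s2) a @ ev G (tg x (l @ Comp C f g # r)) s2 b # map (T s2) c)) =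
        \<chi> (ev F x (l @ Comp C f g # r) (inserted G x s1 s2 a b c))"
        by (simp only: e)
    next
      fix s1 s2 l f g r assume s: "s = s1 @ s2" "s2 = l @ f # g # r"
      note e = contract_pair_eqs(3)[OF k(2)[OF s(1)] s(2)]
      from e[of a] e[of c] a c
      show "\<chi> (ev F x s1 (map (T (l @ Comp C f g # r)) a @ ev G (tg x s1) (l @ Comp C f g # r) b #
          map (T (l @ Comp C f g # r)) c)) =
        \<chi> (ev F x s1 (map (T s2) a @ ev G (tg x s1) (l @ Comp C f g # r) b # map (T s2) c))"
        by (simp only: k(3)[OF s(1)])
    qed (auto simp: comp_def T_snoc)
  qed
  show ?thesis
    unfolding DS_def[of "u_val F G"]
    unfolding u_val split3_sum_map split3_head_swap[symmetric] split3_last_swap[symmetric] split3_pair_swap[symmetric]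
      split3_sum_add[symmetric]
    by (rule trans[OF split3_sum_cong[OF inner] split3_split_swap])
qed

text \<open>The mixed product that the two components of the composition product have in common.\<close>

definition reversed_cup :: "('o, 'm, 'a) total_cochain \<Rightarrow> ('o, 'm, 'a) total_cochain \<Rightarrow> ('o, 'm, 'a) evaluation" where
  "reversed_cup F G \<chi> x s as = split_sum (\<lambda>s1 s2. split_sum (\<lambda>a b.
     \<chi> (T s1 (ev G (tg x s1) s2 a) \<cdot>\<^bsub>x\<^esub> ev F x s1 (map (T s2) b))) as) s"

text \<open>The extra terms arise when an outer face of \<open>F\<close> removes the inserted value:
  at the front of the arguments this gives the reversed product, at the end the cup product of
  \<open>F\<close> and \<open>G\<close>.\<close>

lemma insertion_DH:
  assumes F: "F \<in> families" "G \<in> families" and ok: "ok \<chi> x s as"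
  shows "DH (u_val F G) \<chi> x s as = split_sum (\<lambda>s1 s2. split3_sum (\<lambda>a b c.
      DH (val F) \<chi> x s1 (inserted G x s1 s2 a b c) +
      DH (val G) (\<lambda>v. \<chi> (ev F x s1 (map (T s2) a @ v # map (T s2) c))) (tg x s1) s2 b) as) s +
    reversed_cup F G \<chi> x s as + cup_val F G \<chi> x s as"
proof -
  have inner: "head_sum (\<lambda>a0. split3_sum (\<lambda>a b c. \<chi> (T s a0 \<cdot>\<^bsub>x\<^esub>
        ev F x s1 (inserted G x s1 s2 a b c)))) as +
      last_sum (\<lambda>bs a0. split3_sum (\<lambda>a b c. \<chi> (
        ev F x s1 (inserted G x s1 s2 a b c) \<cdot>\<^bsub>x\<^esub> T s a0)) bs) as +
      pair_sum (\<otimes>\<^bsub>Alg A (tg x s)\<^esub>) (split3_sum (\<lambda>a b c. \<chi> (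
        ev F x s1 (inserted G x s1 s2 a b c)))) as =
    split3_sum (\<lambda>a b c.
      DH (val F) \<chi> x s1 (inserted G x s1 s2 a b c) +
      DH (val G) (\<lambda>v. \<chi> (ev F x s1 (map (T s2) a @ v # map (T s2) c))) (tg x s1) s2 b) as +
    split_sum (\<lambda>a b. \<chi> (T s1 (ev G (tg x s1) s2 a) \<cdot>\<^bsub>x\<^esub> ev F x s1 (map (T s2) b))) as +
    split_sum (\<lambda>a b. \<chi> (ev F x s1 (map (T s2) a) \<cdot>\<^bsub>x\<^esub> T s1 (ev G (tg x s1) s2 b))) as"
    (is "?h + ?l + ?p = ?d + ?r + ?c")
    if s: "s = s1 @ s2" for s1 s2
  proof -
    note k = split_cut[OF F ok s]
    have t: "T s2 a \<cdot>\<^bsub>tg x s1\<^esub> T s2 b = T s2 (a \<cdot>\<^bsub>tg x s\<^esub> b)"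
      if "a \<in> set as" "b \<in> set as" for a b
    proof -
      have "a \<in> cA (tg x s)" "b \<in> cA (tg x s)" using okD(3)[OF ok] that by auto
      then show ?thesis using T_mult[OF k(2), of a b] k(3) by simp
    qed
    have T1: "T s a = T s1 (T s2 a)" for a by (simp add: s)
    \<comment> \<open>The word identity puts all derivation terms on one side; adding
      \<open>?d\<close> once more moves them across.\<close>
    have "?h + ?l + ?p + ?d = ?r + ?c"
      using insertion_leibniz[where as = as and t = "T s2" and g = "ev G (tg x s1) s2" and
        my = "\<lambda>a b. a \<cdot>\<^bsub>tg x s1\<^esub> b" and mz = "\<lambda>a b. a \<cdot>\<^bsub>tg x s\<^esub> b" and
        L = "\<lambda>v w. \<chi> (T s1 v \<cdot>\<^bsub>x\<^esub> ev F x s1 w)" and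
        R = "\<lambda>w v. \<chi> (ev F x s1 w \<cdot>\<^bsub>x\<^esub> T s1 v)" and
        N = "\<lambda>w. \<chi> (ev F x s1 w)", OF t]
      unfolding DH_def split3_sum_add T1 k(3) by (simp only: ac_simps)
    then have "?h + ?l + ?p + ?d + ?d = ?r + ?c + ?d" by (simp only:)
    then show ?thesis by (simp only: cancel)
  qed
  show ?thesis
    unfolding DH_def[of "u_val F G"] reversed_cup_def cup_val_def
    unfolding u_val_def split_head_swap[symmetric] split_last_swap[symmetric] split_pair_swap[symmetric]
      split_sum_add[of _ _ s, symmetric]
    by (rule split_sum_cong[OF inner])
qed

lemma split_cut3:
  assumes F: "F \<in> families" "G \<in> families" and ok: "ok \<chi> x s as" and s: "s = s1 @ s2 @ s3"
  defines "w \<equiv> s1 @ compose_from C (tg x s1) s2 # s3"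
  shows "composable x s1" "composable (tg x s1) s2" "composable (tg (tg x s1) s2) s3"
      "tg (tg (tg x s1) s2) s3 = tg x s"
    and "composable x w" "tg x w = tg x s" "\<And>a. a \<in> cA (tg x s) \<Longrightarrow> T w a = T s a"
    and "\<And>bs. set bs \<subseteq> cA (tg x s) \<Longrightarrow> set (map (T s3) bs) \<subseteq> cA (tg (tg x s1) s2)"
    and "\<And>bs. set bs \<subseteq> cA (tg x s) \<Longrightarrow> ev G (tg x s1) s2 (map (T s3) bs) \<in> cA (tg x s1)"
    and "\<And>bs. set bs \<subseteq> cA (tg x s) \<Longrightarrow> T s1 (ev G (tg x s1) s2 (map (T s3) bs)) \<in> cA x"
    and "\<And>bs. set bs \<subseteq> cA (tg x s) \<Longrightarrow> ev F x w bs \<in> cA x"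
proof -
  note ok' = okD[OF ok]
  show c: "composable x s1" "composable (tg x s1) s2" "composable (tg (tg x s1) s2) s3"
      "tg (tg (tg x s1) s2) s3 = tg x s"
    using ok' s by auto
  show w: "composable x w" "tg x w = tg x s"
    unfolding w_def s using composable3[OF ok'(2)[unfolded s]] .
  show "T w a = T s a" if "a \<in> cA (tg x s)" for a
  proof -
    have "T s3 a \<in> cA (tg (tg x s1) s2)" by (rule T_closed[OF c(3)]) (simp only: c(4) that)
    from Map_compose_from[OF c(2) this] show ?thesis unfolding w_def s by simp
  qed
  show m: "set (map (T s3) bs) \<subseteq> cA (tg (tg x s1) s2)" if "set bs \<subseteq> cA (tg x s)" for bs
    by (rule map_T_closed[OF c(3)]) (simp only: c(4) that)
  show g: "ev G (tg x s1) s2 (map (T s3) bs) \<in> cA (tg x s1)" if "set bs \<subseteq> cA (tg x s)" for bs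
    by (rule ev_closed[OF F(2) c(2) m[OF that]])
  show "T s1 (ev G (tg x s1) s2 (map (T s3) bs)) \<in> cA x" if "set bs \<subseteq> cA (tg x s)" for bs
    by (rule T_closed[OF c(1) g[OF that]])
  show "ev F x w bs \<in> cA x" if "set bs \<subseteq> cA (tg x s)" for bs
    using that w by (intro ev_closed F) simp_all
qed

lemma ok_v_val:
  assumes F: "F \<in> families" "G \<in> families" and ok: "ok \<chi> x s as"
    and *: "s = s1 @ s2 @ s3" "as = a @ b"
  shows "ok (\<lambda>v. \<chi> (T s1 (ev G (tg x s1) s2 (map (T s3) a)) \<cdot>\<^bsub>x\<^esub> v)) x
      (contracted x s1 s2 s3) b"
    and "ok (\<lambda>v. \<chi> (T s1 v \<cdot>\<^bsub>x\<^esub> ev F x (contracted x s1 s2 s3) b))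
      (tg x s1) s2 (map (T s3) a)"
proof -
  note k = split_cut3[OF F ok *(1)] and ok' = okD[OF ok]
  have sb: "set a \<subseteq> cA (tg x s)" "set b \<subseteq> cA (tg x s)" using ok' * by auto
  then show "ok (\<lambda>v. \<chi> (T s1 (ev G (tg x s1) s2 (map (T s3) a)) \<cdot>\<^bsub>x\<^esub> v)) x
      (contracted x s1 s2 s3) b"
    unfolding ok_def using k(5,6) chr_lmult[OF ok'(1,4) k(10)] by (simp only: simp_thms)
  show "ok (\<lambda>v. \<chi> (T s1 v \<cdot>\<^bsub>x\<^esub> ev F x (contracted x s1 s2 s3) b))
      (tg x s1) s2 (map (T s3) a)"
    unfolding ok_def using sb k(2,8) chr_T[OF chr_rmult[OF ok'(1,4) k(11)] k(1)] by (simp only: simp_thms)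
qed

lemma v_val_left_cong:
  assumes F: "F \<in> families" "G \<in> families" and ok: "ok \<chi> x s as"
    and e: "\<forall>\<chi> x s as. ok \<chi> x s as \<longrightarrow> val F \<chi> x s as = e \<chi> x s as"
  shows "v_val F G \<chi> x s as = split3_sum (\<lambda>s1 s2 s3. on_nonempty s2 (split_sum (\<lambda>a b.
      e (\<lambda>v. \<chi> (T s1 (ev G (tg x s1) s2 (map (T s3) a)) \<cdot>\<^bsub>x\<^esub> v)) x
        (contracted x s1 s2 s3) b) as)) s"
  unfolding v_val_def
  by (intro split3_sum_cong arg_cong[where f = "on_nonempty _"] split_sum_cong)
    (rule e[rule_format, OF ok_v_val(1)[OF F ok]])

lemma v_val_right_cong:
  assumes F: "F \<in> families" "G \<in> families" and ok: "ok \<chi> x s as"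
    and e: "\<forall>\<chi> x s as. ok \<chi> x s as \<longrightarrow> val G \<chi> x s as = e \<chi> x s as"
  shows "v_val F G \<chi> x s as = split3_sum (\<lambda>s1 s2 s3. on_nonempty s2 (split_sum (\<lambda>a b.
      e (\<lambda>v. \<chi> (T s1 v \<cdot>\<^bsub>x\<^esub> ev F x (contracted x s1 s2 s3) b))
        (tg x s1) s2 (map (T s3) a)) as)) s"
  unfolding v_val_def
  by (intro split3_sum_cong arg_cong[where f = "on_nonempty _"] split_sum_cong)
    (rule e[rule_format, OF ok_v_val(2)[OF F ok]])

lemma on_nonempty_word_sums:
  "head_sum (\<lambda>x r. on_nonempty s2 (h x r)) xs = on_nonempty s2 (head_sum h xs)"
  "last_sum (\<lambda>r x. on_nonempty s2 (k r x)) xs = on_nonempty s2 (last_sum k xs)"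
  "pair_sum m (\<lambda>w. on_nonempty s2 (j w)) xs = on_nonempty s2 (pair_sum m j xs)"
  "split_sum (\<lambda>a b. on_nonempty s2 (i a b)) xs = on_nonempty s2 (split_sum i xs)"
  by (cases "s2 = []"; simp add: on_nonempty_def)+

text \<open>With the string data fixed, the arguments are merely cut into those of \<open>G\<close>
  and those of \<open>F\<close>, so there are no extra terms. By associativity the argument at the
  cut may be multiplied to either value.\<close>

lemma contraction_DH:
  assumes F: "F \<in> families" "G \<in> families" and ok: "ok \<chi> x s as"
  shows "DH (v_val F G) \<chi> x s as = split3_sum (\<lambda>s1 s2 s3. on_nonempty s2 (split_sum (\<lambda>a b.
      DH (val G) (\<lambda>v. \<chi> (T s1 v \<cdot>\<^bsub>x\<^esub> ev F x (contracted x s1 s2 s3) b))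
        (tg x s1) s2 (map (T s3) a) +
      DH (val F) (\<lambda>v. \<chi> (T s1 (ev G (tg x s1) s2 (map (T s3) a)) \<cdot>\<^bsub>x\<^esub> v)) x
        (contracted x s1 s2 s3) b) as)) s"
  unfolding DH_def[of "v_val F G"]
  unfolding v_val_def split3_head_swap[symmetric] split3_last_swap[symmetric] split3_pair_swap[symmetric]
    split3_sum_add[symmetric] on_nonempty_word_sums on_nonempty_add[symmetric]
proof (intro split3_sum_cong arg_cong[where f = "on_nonempty _"])
  fix s1 s2 s3 assume s: "s = s1 @ s2 @ s3"
  define y where "y = tg x s1"
  define w where "w = s1 @ compose_from C y s2 # s3"
  note ok' = okD[OF ok] and k = split_cut3[OF F ok s, folded y_def, folded w_def]
  let ?g = "\<lambda>a. ev G y s2 (map (T s3) a)" and ?f = "ev F x w"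
  have Ts1: "T s1 (a \<cdot>\<^bsub>y\<^esub> b) = T s1 a \<cdot>\<^bsub>x\<^esub> T s1 b" if "a \<in> cA y" "b \<in> cA y" for a b
    using T_mult[OF k(1)] that unfolding y_def by blast
  have Ts: "T s a = T s1 (T s2 (T s3 a))" for a by (simp add: s)
  have Ts2: "T s2 (T s3 a) \<in> cA y" if "a \<in> cA (tg x s)" for a
    using T_closed[OF k(2) T_closed[OF k(3)]] k(4) that by simp
  have Tw: "T w a = T s1 (T s2 (T s3 a))" if "a \<in> cA (tg x s)" for a
    using k(7)[OF that] Ts by simp
  have Ts': "T s1 (T s2 (T s3 a)) \<in> cA x" if "a \<in> cA (tg x s)" for a
    using T_closed[OF ok'(2) that] Ts by simp
  have args: "set a \<subseteq> cA (tg x s)" "set b \<subseteq> cA (tg x s)" if "as = a @ b" for a b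
    using ok'(3) that by auto
  show "head_sum (\<lambda>a0. split_sum (\<lambda>a b. \<chi> (T s a0 \<cdot>\<^bsub>x\<^esub> (T s1 (ev G (tg x s1) s2 (map (T s3) a)) \<cdot>\<^bsub>x\<^esub>
        ev F x (contracted x s1 s2 s3) b)))) as +
      last_sum (\<lambda>bs a0. split_sum (\<lambda>a b. \<chi> ((T s1 (ev G (tg x s1) s2 (map (T s3) a)) \<cdot>\<^bsub>x\<^esub>
        ev F x (contracted x s1 s2 s3) b) \<cdot>\<^bsub>x\<^esub> T s a0)) bs) as +
      pair_sum (\<otimes>\<^bsub>Alg A (tg x s)\<^esub>) (split_sum (\<lambda>a b. \<chi> (T s1 (ev G (tg x s1) s2 (map (T s3) a)) \<cdot>\<^bsub>x\<^esub>
        ev F x (contracted x s1 s2 s3) b))) as =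
    split_sum (\<lambda>a b.
      DH (val G) (\<lambda>v. \<chi> (T s1 v \<cdot>\<^bsub>x\<^esub> ev F x (contracted x s1 s2 s3) b))
        (tg x s1) s2 (map (T s3) a) +
      DH (val F) (\<lambda>v. \<chi> (T s1 (ev G (tg x s1) s2 (map (T s3) a)) \<cdot>\<^bsub>x\<^esub> v)) x
        (contracted x s1 s2 s3) b) as"
    unfolding y_def[symmetric]
    unfolding w_def[symmetric]
      cut_leibniz[where mid = "\<lambda>a a0 b. \<chi> ((T s1 (?g a) \<cdot>\<^bsub>x\<^esub> T s a0) \<cdot>\<^bsub>x\<^esub> ?f b)"]
      DH_def head_sum_map last_sum_map Ts k(6)
  proof (intro split_sum_cong arg_cong2[where f = "(+)"] head_sum_cong last_sum_cong pair_sum_map[symmetric] refl)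
    fix a b a0 a1 assume "as = a @ b" "a0 \<in> set a" "a1 \<in> set a"
    then have "a0 \<in> cA (tg x s)" "a1 \<in> cA (tg x s)" using args by blast+
    then show "T s3 a0 \<cdot>\<^bsub>tg y s2\<^esub> T s3 a1 = T s3 (a0 \<cdot>\<^bsub>tg x s\<^esub> a1)"
      using T_mult[OF k(3)] k(4) by simp
  qed (use ok'(3) in \<open>auto simp: k(9,10,11) Ts1 Ts2 Tw Ts' Alg_assoc ok'(4)\<close>)
qed

text \<open>The hard case, since the faces act on the word that is also contracted. Faces of the
  contracted word away from the composite arrow match faces of \<open>s\<close>; those meeting it
  are of four kinds, \<open>?A1\<close> to \<open>?A4\<close>. Two of them give the extra products
  and two cancel the outer faces of \<open>G\<close>.\<close>

lemma contraction_DS: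
  assumes F: "F \<in> families" "G \<in> families" and ok: "ok \<chi> x s as"
  shows "DS (v_val F G) \<chi> x s as = split3_sum (\<lambda>s1 s2 s3. on_nonempty s2 (split_sum (\<lambda>a b.
      DS (val F) (\<lambda>v. \<chi> (T s1 (ev G (tg x s1) s2 (map (T s3) a)) \<cdot>\<^bsub>x\<^esub> v)) x
        (contracted x s1 s2 s3) b +
      DS (val G) (\<lambda>v. \<chi> (T s1 v \<cdot>\<^bsub>x\<^esub> ev F x (contracted x s1 s2 s3) b))
        (tg x s1) s2 (map (T s3) a)) as)) s +
    reversed_cup F G \<chi> x s as + cup_val G F \<chi> x s as"
proof -
  note ok' = okD[OF ok]
  define q where "q \<chi> x s a b = split3_sum (\<lambda>s1 s2 s3. on_nonempty s2 (
     \<chi> (T s1 (ev G (tg x s1) s2 (map (T s3) a)) \<cdot>\<^bsub>x\<^esub>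
       ev F x (contracted x s1 s2 s3) b))) s"
    for \<chi> :: "'a \<Rightarrow> bit" and x s a b
  have v_val: "v_val F G \<chi> x s as = split_sum (q \<chi> x s) as" for \<chi> x s as
    unfolding v_val_def q_def on_nonempty_word_sums[symmetric] by (rule split3_split_swap)
  have inner: "head_sum (\<lambda>f s'. q (\<lambda>v. \<chi> (Map A f v)) (Dom C f) s' a b) s +
      last_sum (\<lambda>s' f. q \<chi> x s' (map (Map A f) a) (map (Map A f) b)) s +
      pair_sum (Comp C) (\<lambda>s'. q \<chi> x s' a b) s =
    split3_sum (\<lambda>s1 s2 s3. on_nonempty s2 (
      DS (val F) (\<lambda>v. \<chi> (T s1 (ev G (tg x s1) s2 (map (T s3) a)) \<cdot>\<^bsub>x\<^esub> v)) x
        (contracted x s1 s2 s3) b +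
      DS (val G) (\<lambda>v. \<chi> (T s1 v \<cdot>\<^bsub>x\<^esub> ev F x (contracted x s1 s2 s3) b))
        (tg x s1) s2 (map (T s3) a))) s +
    split_sum (\<lambda>s1 s2. \<chi> (T s1 (ev G (tg x s1) s2 a) \<cdot>\<^bsub>x\<^esub> ev F x s1 (map (T s2) b))) s +
    split_sum (\<lambda>s1 s2. \<chi> (ev G x s1 (map (T s2) a) \<cdot>\<^bsub>x\<^esub> T s1 (ev F (tg x s1) s2 b))) s"
    (is "?h + ?l + ?p = _ + ?R + ?C")
    if "as = a @ b" for a b
  proof -
    have ab: "set a \<subseteq> cA (tg x s)" "set b \<subseteq> cA (tg x s)" using ok' that by auto
    define c where "c s1 s2 = compose_from C (tg x s1) s2" for s1 s2
    define g where "g s1 s2 s3 = T s1 (ev G (tg x s1) s2 (map (T s3) a))" for s1 s2 s3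
    note k = split_cut3[OF F ok, folded c_def]
    let ?e = "\<lambda>v w. \<chi> (v \<cdot>\<^bsub>x\<^esub> ev F x w b)"
    have H: "?h =
      split3_sum (\<lambda>s1 s2 s3. on_nonempty s2 (head_sum (\<lambda>f s1'. \<chi> (g s1 s2 s3 \<cdot>\<^bsub>x\<^esub>
        Map A f (ev F (Dom C f) (s1' @ c s1 s2 # s3) b))) s1)) s"
      unfolding q_def head_split3 on_nonempty_word_sums[symmetric]
    proof (intro split3_sum_cong head_sum_cong arg_cong[where f = "on_nonempty _"] arg_cong[where f = \<chi>])
      fix s1 s2 s3 f s1' assume s: "s = s1 @ s2 @ s3" and s1: "s1 = f # s1'"
      have t: "tg (Dom C f) s1' = tg x s1" unfolding s1 by simp
      have f: "f \<in> Arr C" "Cod C f = x" "composable (Dom C f) s1'" using k(1)[OF s] unfolding s1 by auto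
      have "composable x (f # s1' @ c s1 s2 # s3)" "tg x (f # s1' @ c s1 s2 # s3) = tg x s"
        using k(5,6)[OF s] unfolding s1 by simp_all
      then have 1: "ev F (Dom C f) (s1' @ c s1 s2 # s3) b \<in> cA (Dom C f)"
        using ab(2) by (intro ev_closed F) simp_all
      have 2: "T s1' (ev G (tg x s1) s2 (map (T s3) a)) \<in> cA (Dom C f)"
        by (rule T_closed[OF f(3)]) (simp only: t k(9)[OF s ab(1)])
      show "Map A f (T s1' (ev G (tg (Dom C f) s1') s2 (map (T s3) a)) \<cdot>\<^bsub>Dom C f\<^esub>
           ev F (Dom C f) (s1' @ compose_from C (tg (Dom C f) s1') s2 # s3) b) =
        g s1 s2 s3 \<cdot>\<^bsub>x\<^esub> Map A f (ev F (Dom C f) (s1' @ c s1 s2 # s3) b)"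
        using Map_facts(4)[OF f(1) 2 1] unfolding t c_def[symmetric] f(2) g_def by (simp add: s1)
    qed
    have L: "?l =
      split3_sum (\<lambda>s1 s2 s3. on_nonempty s2 (last_sum (\<lambda>s3' f. \<chi> (g s1 s2 s3 \<cdot>\<^bsub>x\<^esub>
        ev F x (s1 @ c s1 s2 # s3') (map (Map A f) b))) s3)) s"
      unfolding q_def last_split3 on_nonempty_word_sums[symmetric]
      by (intro split3_sum_cong last_sum_cong) (simp add: T_snoc comp_def g_def c_def)
    have P: "?p =
      split3_sum (\<lambda>s1 s2 s3.
        on_nonempty s2 (pair_sum (Comp C) (\<lambda>s1'. ?e (g s1 s2 s3) (s1' @ c s1 s2 # s3)) s1) +
        (on_nonempty s2 (pair_sum (Comp C) (\<lambda>s2'. ?e (g s1 s2' s3) (s1 @ c s1 s2 # s3)) s2) +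
         on_nonempty s2 (pair_sum (Comp C) (\<lambda>s3'. ?e (g s1 s2 s3) (s1 @ c s1 s2 # s3')) s3))) s"
      unfolding q_def pair_split3 on_nonempty_word_sums[symmetric]
    proof (intro split3_sum_cong arg_cong2[where f = "(+)"] pair_sum_cong)
      fix s1 s2 s3 l f h r assume s: "s = s1 @ s2 @ s3" and s1: "s1 = l @ f # h # r"
      note e = contract_pair_eqs[OF k(1)[OF s] s1]
      show "on_nonempty s2 (?e (T (l @ Comp C f h # r) (ev G (tg x (l @ Comp C f h # r)) s2 (map (T s3) a)))
          ((l @ Comp C f h # r) @ compose_from C (tg x (l @ Comp C f h # r)) s2 # s3)) =
        on_nonempty s2 (?e (g s1 s2 s3) ((l @ Comp C f h # r) @ c s1 s2 # s3))"
        unfolding e(1) e(2)[OF k(9)[OF s ab(1)]] g_def c_def ..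
    next
      fix s1 s2 s3 l f h r assume s: "s = s1 @ s2 @ s3" and s2: "s2 = l @ f # h # r"
      \<comment> \<open>Composing two arrows inside the middle string leaves its composite alone, so
        only \<open>G\<close> sees this face.\<close>
      have "compose_from C (tg x s1) (l @ Comp C f h # r) = c s1 s2"
        unfolding c_def s2 using k(2)[OF s] unfolding s2 by (rule contract_pair(4))
      then show "on_nonempty (l @ Comp C f h # r) (?e (T s1 (ev G (tg x s1) (l @ Comp C f h # r) (map (T s3) a)))
          (s1 @ compose_from C (tg x s1) (l @ Comp C f h # r) # s3)) =
        on_nonempty s2 (?e (g s1 (l @ Comp C f h # r) s3) (s1 @ c s1 s2 # s3))"
        by (simp only: g_def) (simp add: on_nonempty_def s2)
    next
      fix s1 s2 s3 l f h r assume s: "s = s1 @ s2 @ s3" and s3: "s3 = l @ f # h # r"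
      note e = contract_pair_eqs(3)[OF k(3)[OF s] s3]
      have "map (T (l @ Comp C f h # r)) a = map (T s3) a"
        by (rule e) (simp only: k(4)[OF s] ab(1))
      then show "on_nonempty s2 (?e (T s1 (ev G (tg x s1) s2 (map (T (l @ Comp C f h # r)) a)))
          (s1 @ compose_from C (tg x s1) s2 # l @ Comp C f h # r)) =
        on_nonempty s2 (?e (g s1 s2 s3) (s1 @ c s1 s2 # l @ Comp C f h # r))"
        by (simp only: g_def c_def)
    qed
    \<comment> \<open>Here \<open>G\<close> sits at a bare object and \<open>F\<close> on the whole
      string. This is what an outer face of \<open>G\<close> leaves when the middle string is a
      single arrow; it is not a summand of \<open>v\<close>.\<close>
    define w where "w s1 s2 = ?e (T s1 (ev G (tg x s1) [] (map (T s2) a))) s" for s1 s2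
    let ?A1 = "split3_sum (\<lambda>s1 s2 s3. on_nonempty s2 (if s1 = [] then \<chi> (g s1 s2 s3 \<cdot>\<^bsub>x\<^esub>
      Map A (c s1 s2) (ev F (Dom C (c s1 s2)) s3 b)) else 0)) s"
    let ?A2 = "split3_sum (\<lambda>s1 s2 s3. on_nonempty s2 (if s3 = [] then \<chi> (g s1 s2 s3 \<cdot>\<^bsub>x\<^esub>
      ev F x s1 (map (Map A (c s1 s2)) b)) else 0)) s"
    let ?A3 = "split3_sum (\<lambda>s1 s2 s3. on_nonempty s2
      (last_sum (\<lambda>s1' f. ?e (g s1 s2 s3) (s1' @ Comp C f (c s1 s2) # s3)) s1)) s"
    let ?A4 = "split3_sum (\<lambda>s1 s2 s3. on_nonempty s2
      (head_sum (\<lambda>f s3'. ?e (g s1 s2 s3) (s1 @ Comp C (c s1 s2) f # s3')) s3)) s"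
    let ?B1 = "split3_sum (\<lambda>s1 s2 s3. on_nonempty s2
      (head_sum (\<lambda>f s2'. ?e (T s1 (Map A f (ev G (Dom C f) s2' (map (T s3) a))))
        (s1 @ c s1 s2 # s3)) s2)) s"
    let ?B2 = "split3_sum (\<lambda>s1 s2 s3. on_nonempty s2
      (last_sum (\<lambda>s2' f. ?e (T s1 (ev G (tg x s1) s2' (map (Map A f) (map (T s3) a))))
        (s1 @ c s1 s2 # s3)) s2)) s"
    let ?U1 = "split_sum (\<lambda>s1. head_sum (\<lambda>f s3. w (s1 @ [f]) s3)) s"
    let ?U2 = "split_sum (\<lambda>s1. head_sum (\<lambda>f s3. w s1 (f # s3))) s"
    \<comment> \<open>For empty \<open>s1\<close> the first face removes the composite arrow, which
      then acts on the value of \<open>F\<close>: the cup product of \<open>G\<close> and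
      \<open>F\<close>. Its cut with empty \<open>s2\<close> does not come from \<open>v\<close>,
      hence the correction \<open>w [] s\<close>.\<close>
    have A1: "?A1 = ?C + w [] s"
    proof -
      let ?z = "\<lambda>s2 s3. \<chi> (ev G x s2 (map (T s3) a) \<cdot>\<^bsub>x\<^esub> T s2 (ev F (tg x s2) s3 b))"
      have "?A1 = split3_sum (\<lambda>s1 s2 s3. if s1 = [] then on_nonempty s2 (?z s2 s3) else 0) s"
      proof (rule split3_sum_cong)
        fix s1 s2 s3 assume s: "s = s1 @ s2 @ s3"
        show "on_nonempty s2 (if s1 = [] then \<chi> (g s1 s2 s3 \<cdot>\<^bsub>x\<^esub>
            Map A (c s1 s2) (ev F (Dom C (c s1 s2)) s3 b)) else 0) =
          (if s1 = [] then on_nonempty s2 (?z s2 s3) else 0)"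
        proof (cases "s1 = []")
          case True
          have "ev F (tg x s2) s3 b \<in> cA (tg x s2)"
            using k(3,4)[OF s] True ab by (intro ev_closed F) auto
          then show ?thesis
            using k(2)[OF s] True Map_compose_from[of x s2] compose_from_props[of x s2] by (simp add: g_def c_def)
        qed (simp add: on_nonempty_def)
      qed
      also have "\<dots> = split_sum (\<lambda>s2 s3. on_nonempty s2 (?z s2 s3)) s" by (rule split3_sum_if_Nil)
      finally show ?thesis by (simp add: split_sum_on_nonempty w_def)
    qed
    \<comment> \<open>For empty \<open>s3\<close> the last face moves the composite arrow to the
      arguments of \<open>F\<close>, which gives the reversed product; again the cut with empty
      \<open>s2\<close> is missing.\<close>
    have A2: "?A2 = ?R + w s []"
    proof -
      let ?z = "\<lambda>s1 s2. \<chi> (T s1 (ev G (tg x s1) s2 a) \<cdot>\<^bsub>x\<^esub> ev F x s1 (map (T s2) b))"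
      have "?A2 = split3_sum (\<lambda>s1 s2 s3. if s3 = [] then on_nonempty s2 (?z s1 s2) else 0) s"
      proof (rule split3_sum_cong)
        fix s1 s2 s3 assume s: "s = s1 @ s2 @ s3"
        show "on_nonempty s2 (if s3 = [] then \<chi> (g s1 s2 s3 \<cdot>\<^bsub>x\<^esub>
            ev F x s1 (map (Map A (c s1 s2)) b)) else 0) =
          (if s3 = [] then on_nonempty s2 (?z s1 s2) else 0)"
        proof (cases "s3 = []")
          case True
          have m: "map (Map A (c s1 s2)) b = map (T s2) b"
            unfolding c_def by (rule map_Map_compose_from[OF k(2)[OF s]]) (use k(4)[OF s] True ab in simp)
          show ?thesis using True by (simp add: g_def m)
        qed (simp add: on_nonempty_def)
      qed
      also have "\<dots> = split_sum (\<lambda>s1 s2. on_nonempty s2 (?z s1 s2)) s" by (rule split3_sum_if_Nil)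
      finally show ?thesis by (simp add: split_sum_on_nonempty w_def)
    qed
    \<comment> \<open>Composing the last arrow of \<open>s1\<close> with the composite amounts to
      lengthening the middle string. This matches the first face of \<open>G\<close> except for
      middle strings of one arrow, where only the latter exists.\<close>
    have A3: "?A3 = ?B1 + ?U1"
    proof -
      let ?k = "\<lambda>s1 f s2 s3. ?e (T s1 (Map A f (ev G (Dom C f) s2 (map (T s3) a)))) (s1 @ c s1 (f # s2) # s3)"
      have "?A3 = split3_sum (\<lambda>s1 s2 s3. on_nonempty s2 (last_sum (\<lambda>s1' f. ?k s1' f s2 s3) s1)) s"
        by (intro split3_sum_cong arg_cong[where f = "on_nonempty _"] last_sum_cong) (simp add: g_def c_def)
      also have "\<dots> = split3_sum (\<lambda>s1 s2 s3. head_sum (\<lambda>f s2'. ?k s1 f s2' s3) s2) s +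
          split_sum (\<lambda>s1. head_sum (\<lambda>f s3. ?k s1 f [] s3)) s"
        by (rule split3_last_on_nonempty)
      also have "split3_sum (\<lambda>s1 s2 s3. head_sum (\<lambda>f s2'. ?k s1 f s2' s3) s2) s = ?B1"
        by (intro split3_sum_cong) (auto simp: on_nonempty_def intro!: head_sum_cong)
      also have "split_sum (\<lambda>s1. head_sum (\<lambda>f s3. ?k s1 f [] s3)) s = ?U1"
        using ok' by (intro split_sum_cong head_sum_cong) (auto simp: w_def c_def Comp_Id_right)
      finally show ?thesis .
    qed
    \<comment> \<open>The mirror image, with the first arrow of \<open>s3\<close> and the last face
      of \<open>G\<close>.\<close>
    have A4: "?A4 = ?B2 + ?U2"
    proof -
      let ?k = "\<lambda>s1 f s2 s3. ?e (T s1 (ev G (tg x s1) s2 (map (T (f # s3)) a))) (s1 @ c s1 (s2 @ [f]) # s3)"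
      have "?A4 = split3_sum (\<lambda>s1 s2 s3. on_nonempty s2 (head_sum (\<lambda>f s3'. ?k s1 f s2 s3') s3)) s"
      proof (intro split3_sum_cong arg_cong[where f = "on_nonempty _"] head_sum_cong)
        fix s1 s2 s3 f s3' assume s: "s = s1 @ s2 @ s3" and s3: "s3 = f # s3'"
        have "composable (tg x s1) (s2 @ [f])"
          using k(2,3)[OF s] unfolding s3 by (auto intro: Dom_closed)
        from compose_from_append[OF this]
        have "c s1 (s2 @ [f]) = Comp C (c s1 s2) f"
          using k(3)[OF s] unfolding c_def s3 by (simp add: Comp_Id_right)
        then show "?e (g s1 s2 s3) (s1 @ Comp C (c s1 s2) f # s3') = ?k s1 f s2 s3'"
          by (simp only: g_def s3)
      qed
      also have "\<dots> = split3_sum (\<lambda>s1 s2 s3. last_sum (\<lambda>s2' f. ?k s1 f s2' s3) s2) s +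
          split_sum (\<lambda>s1. head_sum (\<lambda>f s3. ?k s1 f [] s3)) s"
        by (rule split3_head_on_nonempty)
      also have "split3_sum (\<lambda>s1 s2 s3. last_sum (\<lambda>s2' f. ?k s1 f s2' s3) s2) s = ?B2"
        by (intro split3_sum_cong) (auto simp: on_nonempty_def comp_def intro!: last_sum_cong)
      also have "split_sum (\<lambda>s1. head_sum (\<lambda>f s3. ?k s1 f [] s3)) s = ?U2"
        using ok' by (intro split_sum_cong head_sum_cong) (auto simp: w_def c_def Comp_Id_right)
      finally show ?thesis .
    qed
    \<comment> \<open>The one-arrow leftovers telescope, and the two ends are precisely the
      corrections in \<open>A1\<close> and \<open>A2\<close>.\<close>
    have "?U1 = w [] s + w s [] + ?U2"
      using arg_cong[OF split_telescope[of w s], of "\<lambda>v. v + ?U2"] by (simp only: cancel)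
    then show ?thesis
      unfolding H L P DS_def g_def[symmetric] c_def[symmetric] head_sum_append last_sum_append pair_sum_append
      by (simp only: on_nonempty_add split3_sum_add A1 A2 A3 A4 cancel)
  qed
  show ?thesis
    unfolding DS_def[of "v_val F G"] reversed_cup_def cup_val_def on_nonempty_word_sums[symmetric]
      split3_split_swap split_split_swap[of _ as s]
    unfolding v_val split_sum_map split_head_swap[symmetric] split_last_swap[symmetric] split_pair_swap[symmetric]
      split_sum_add[symmetric]
    by (rule split_sum_cong[OF inner])
qed

lemma val_comp: "F \<in> families \<Longrightarrow> G \<in> families \<Longrightarrow> ok \<chi> x s as \<Longrightarrow>
    val (comp_product C A F G) \<chi> x s as = u_val F G \<chi> x s as + v_val F G \<chi> x s as"
  by (simp add: chr_comp_product okD)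

text \<open>The congruence rules expand the products with a coboundary into the same sums that the
  four Leibniz rules for \<open>u_val\<close> and \<open>v_val\<close> produce.\<close>

lemma delta_comp_product:
  assumes F: "F \<in> families" "G \<in> families" and ok: "ok \<chi> x s as"
  shows "val (delta C A (comp_product C A F G)) \<chi> x s as =
    val (comp_product C A (delta C A F) G) \<chi> x s as + val (comp_product C A F (delta C A G)) \<chi> x s as +
    val (cup_product F G) \<chi> x s as + val (cup_product G F) \<chi> x s as"
proof -
  have "val (delta C A (comp_product C A F G)) \<chi> x s as =
      DS (val (comp_product C A F G)) \<chi> x s as + DH (val (comp_product C A F G)) \<chi> x s as"
    by (rule val_delta[OF comp_product_mem[OF F] ok])
  moreover have "DS (val (comp_product C A F G)) \<chi> x s as = DS (u_val F G) \<chi> x s as + DS (v_val F G) \<chi> x s as"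
    unfolding DS_add[symmetric] by (rule DS_cong[OF val_comp[OF F] ok])
  moreover have "DH (val (comp_product C A F G)) \<chi> x s as = DH (u_val F G) \<chi> x s as + DH (v_val F G) \<chi> x s as"
    unfolding DH_add[symmetric] by (rule DH_cong[OF val_comp[OF F] ok])
  ultimately show ?thesis
    unfolding val_comp[OF delta_mem[OF F(1)] F(2) ok] val_comp[OF F(1) delta_mem[OF F(2)] ok]
      val_cup[OF F ok] val_cup[OF F(2,1) ok]
      u_val_left_cong[where e = "dval F", OF delta_mem[OF F(1)] F(2) ok val_delta_all[OF F(1)]]
      v_val_left_cong[where e = "dval F", OF delta_mem[OF F(1)] F(2) ok val_delta_all[OF F(1)]]
      u_val_right_cong[where e = "dval G", OF F(1) delta_mem[OF F(2)] ok val_delta_all[OF F(2)]]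
      v_val_right_cong[where e = "dval G", OF F(1) delta_mem[OF F(2)] ok val_delta_all[OF F(2)]]
      insertion_DS[OF F ok] insertion_DH[OF F ok] contraction_DS[OF F ok] contraction_DH[OF F ok]
    by (simp only: split_sum_add split3_sum_add on_nonempty_add cancel)
qed


section \<open>The square of a cocycle\<close>

lemma val_add: "F \<in> families \<Longrightarrow> G \<in> families \<Longrightarrow> ok \<chi> x s as \<Longrightarrow>
    val (total_add C A F G) \<chi> x s as = val F \<chi> x s as + val G \<chi> x s as"
  by (simp add: ev_add okD chrD ev_closed)

lemma val_add_all: "F \<in> families \<Longrightarrow> G \<in> families \<Longrightarrow> \<forall>\<chi> x s as. ok \<chi> x s as \<longrightarrow>
    val (total_add C A F G) \<chi> x s as = val F \<chi> x s as + val G \<chi> x s as"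
  by (intro allI impI) (rule val_add)

lemma val_zero: "ok \<chi> x s as \<Longrightarrow> val (total_zero C A) \<chi> x s as = 0"
  by (simp add: ev_zero okD chr_zero)

lemma val_comp_add_left:
  assumes F: "F \<in> families" "F' \<in> families" "G \<in> families" and ok: "ok \<chi> x s as"
  shows "val (comp_product C A (total_add C A F F') G) \<chi> x s as =
    val (comp_product C A F G) \<chi> x s as + val (comp_product C A F' G) \<chi> x s as"
  unfolding val_comp[OF total_add_mem[OF F(1,2)] F(3) ok] val_comp[OF F(1,3) ok] val_comp[OF F(2,3) ok]
    u_val_left_cong[where e = "\<lambda>\<chi> x s as. val F \<chi> x s as + val F' \<chi> x s as",
      OF total_add_mem[OF F(1,2)] F(3) ok val_add_all[OF F(1,2)]]
    v_val_left_cong[where e = "\<lambda>\<chi> x s as. val F \<chi> x s as + val F' \<chi> x s as",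
      OF total_add_mem[OF F(1,2)] F(3) ok val_add_all[OF F(1,2)]]
  by (simp only: split_sum_add split3_sum_add on_nonempty_add u_val_def v_val_def ac_simps)

lemma val_comp_add_right:
  assumes F: "F \<in> families" "G \<in> families" "G' \<in> families" and ok: "ok \<chi> x s as"
  shows "val (comp_product C A F (total_add C A G G')) \<chi> x s as =
    val (comp_product C A F G) \<chi> x s as + val (comp_product C A F G') \<chi> x s as"
  unfolding val_comp[OF F(1) total_add_mem[OF F(2,3)] ok] val_comp[OF F(1,2) ok] val_comp[OF F(1,3) ok]
    u_val_right_cong[where e = "\<lambda>\<chi> x s as. val G \<chi> x s as + val G' \<chi> x s as",
      OF F(1) total_add_mem[OF F(2,3)] ok val_add_all[OF F(2,3)]]
    v_val_right_cong[where e = "\<lambda>\<chi> x s as. val G \<chi> x s as + val G' \<chi> x s as",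
      OF F(1) total_add_mem[OF F(2,3)] ok val_add_all[OF F(2,3)]]
  by (simp only: split_sum_add split3_sum_add on_nonempty_add u_val_def v_val_def ac_simps)

lemma families_eqI':
  assumes "F \<in> families" "G \<in> families"
    and "\<And>\<chi> x s as. ok \<chi> x s as \<Longrightarrow> val F \<chi> x s as = val G \<chi> x s as"
  shows "F = G"
  using assms by (intro families_eqI) (auto simp: ok_def)

lemma add_self_zero:
  assumes F: "F \<in> families"
  shows "total_add C A F F = total_zero C A"
  using F by (intro families_eqI') (auto simp: val_add val_zero total_add_mem total_zero_mem)

text \<open>Zero is \<open>F + F\<close>, so additivity writes the product as twice the same
  bit.\<close>

lemma val_comp_zero:
  assumes F: "F \<in> families" and ok: "ok \<chi> x s as"
  shows "val (comp_product C A (total_zero C A) F) \<chi> x s as = 0"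
    and "val (comp_product C A F (total_zero C A)) \<chi> x s as = 0"
  using val_comp_add_left[OF F F F ok] val_comp_add_right[OF F F F ok] add_self_zero[OF F] by simp_all

lemma val_delta_add:
  assumes F: "F \<in> families" "G \<in> families" and ok: "ok \<chi> x s as"
  shows "val (delta C A (total_add C A F G)) \<chi> x s as =
    val (delta C A F) \<chi> x s as + val (delta C A G) \<chi> x s as"
proof -
  have "DS (val (total_add C A F G)) \<chi> x s as = DS (val F) \<chi> x s as + DS (val G) \<chi> x s as"
    unfolding DS_add[symmetric] by (rule DS_cong[OF val_add[OF F] ok])
  moreover have "DH (val (total_add C A F G)) \<chi> x s as = DH (val F) \<chi> x s as + DH (val G) \<chi> x s as"
    unfolding DH_add[symmetric] by (rule DH_cong[OF val_add[OF F] ok])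
  ultimately show ?thesis
    unfolding val_delta[OF total_add_mem[OF F] ok] val_delta[OF F(1) ok] val_delta[OF F(2) ok]
    by (simp only: ac_simps)
qed

lemma delta_add:
  "F \<in> families \<Longrightarrow> G \<in> families \<Longrightarrow>
     delta C A (total_add C A F G) = total_add C A (delta C A F) (delta C A G)"
  by (rule families_eqI') (simp_all only: val_delta_add val_add delta_mem total_add_mem)

lemma delta_Sq:
  assumes F: "F \<in> families" and cocycle: "delta C A F = total_zero C A"
  shows "delta C A (Sq C A F) = total_zero C A"
  unfolding Sq_def
proof (rule families_eqI')
  fix \<chi> x s as assume ok: "ok \<chi> x s as"
  show "val (delta C A (comp_product C A F F)) \<chi> x s as = val (total_zero C A) \<chi> x s as"
    unfolding delta_comp_product[OF F F ok] cocycle val_comp_zero[OF F ok] val_zero[OF ok] by simp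
qed (intro delta_mem comp_product_mem F total_zero_mem)+

text \<open>The first two products yield the mixed terms of \<open>F\<close> and the coboundary of
  \<open>h\<close>, and their cup terms coincide. The third yields the square of the coboundary
  together with cup products of \<open>h\<close> and its coboundary, which the coboundary of the
  last term cancels.\<close>

definition homotopy :: "('o, 'm, 'a) total_cochain \<Rightarrow> ('o, 'm, 'a) total_cochain \<Rightarrow> ('o, 'm, 'a) total_cochain" where
  "homotopy F h = total_add C A (total_add C A (comp_product C A F h) (comp_product C A h F))
     (total_add C A (comp_product C A h (delta C A h)) (cup_product h h))"

lemma homotopy_mem: "F \<in> families \<Longrightarrow> h \<in> families \<Longrightarrow> homotopy F h \<in> families"
  unfolding homotopy_def by (intro total_add_mem comp_product_mem cup_product_mem delta_mem)

text \<open>The coboundary stands on the left because cohomology classes are right cosets of the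
  coboundaries.\<close>

lemma Sq_add_coboundary:
  assumes F: "F \<in> families" and h: "h \<in> families" and cocycle: "delta C A F = total_zero C A"
  shows "Sq C A (total_add C A (delta C A h) F) = total_add C A (delta C A (homotopy F h)) (Sq C A F)"
  unfolding Sq_def
proof (rule families_eqI')
  let ?d = "delta C A h" and ?c = "comp_product C A"
  have d: "?d \<in> families" and sb: "total_add C A ?d F \<in> families" using F h by (auto intro: delta_mem total_add_mem)
  fix \<chi> x s as assume ok: "ok \<chi> x s as"
  note m = total_add_mem comp_product_mem cup_product_mem d F h
  have 1: "val (delta C A (?c F h)) \<chi> x s as =
      val (?c F ?d) \<chi> x s as + (val (cup_product F h) \<chi> x s as + val (cup_product h F) \<chi> x s as)"
    unfolding delta_comp_product[OF F h ok] cocycle val_comp_zero[OF h ok] by (simp only: cancel)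
  have 2: "val (delta C A (?c h F)) \<chi> x s as =
      val (?c ?d F) \<chi> x s as + (val (cup_product F h) \<chi> x s as + val (cup_product h F) \<chi> x s as)"
    unfolding delta_comp_product[OF h F ok] cocycle val_comp_zero[OF h ok] by (simp only: cancel)
  have 3: "val (delta C A (?c h ?d)) \<chi> x s as =
      val (?c ?d ?d) \<chi> x s as + (val (cup_product ?d h) \<chi> x s as + val (cup_product h ?d) \<chi> x s as)"
    unfolding delta_comp_product[OF h d ok] delta_delta[OF h] val_comp_zero[OF h ok] by (simp only: cancel)
  have "val (delta C A (homotopy F h)) \<chi> x s as =
      val (?c F ?d) \<chi> x s as + val (?c ?d F) \<chi> x s as + val (?c ?d ?d) \<chi> x s as"
    unfolding homotopy_def
    by (simp only: val_delta_add m ok 1 2 3 cup_leibniz[OF h h ok] cancel)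
  then show "val (?c (total_add C A ?d F) (total_add C A ?d F)) \<chi> x s as =
      val (total_add C A (delta C A (homotopy F h)) (?c F F)) \<chi> x s as"
    using val_add[OF delta_mem[OF homotopy_mem[OF F h]] comp_product_mem[OF F F] ok]
    unfolding val_comp_add_left[OF d F sb ok] val_comp_add_right[OF d d F ok] val_comp_add_right[OF F d F ok]
    by (simp only: cancel)
qed (intro comp_product_mem total_add_mem delta_mem homotopy_mem F h)+


subsection \<open>Total degree\<close>

text \<open>Homogeneity expressed by characters, so that it can be checked on sums over words. The
  degree is an integer; for negative \<open>k\<close> the condition forces all values to
  vanish.\<close>

definition vanishes_off :: "int \<Rightarrow> ('o, 'm, 'a) total_cochain \<Rightarrow> bool" where
  "vanishes_off k F \<longleftrightarrow> (\<forall>\<chi> x s as. ok \<chi> x s as \<longrightarrow> int (length s) + int (length as) \<noteq> k \<longrightarrow> val F \<chi> x s as = 0)"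

lemma vanishes_offD:
  "vanishes_off k F \<Longrightarrow> ok \<chi> x s as \<Longrightarrow> int (length s) + int (length as) \<noteq> k \<Longrightarrow> \<chi> (ev F x s as) = 0"
  by (auto simp: vanishes_off_def)

lemma total_cochains_iff:
  "F \<in> total_cochains K C A k \<longleftrightarrow> F \<in> families \<and> vanishes_off k F"
proof (intro iffI conjI)
  assume F: "F \<in> total_cochains K C A k"
  then show "F \<in> families" by (simp add: total_cochains_def families_def)
  show "vanishes_off k F"
    unfolding vanishes_off_def
  proof (intro allI impI)
    fix \<chi> x s as assume ok: "ok \<chi> x s as" and k: "int (length s) + int (length as) \<noteq> k"
    then have "F (length s) (length as) = total_zero C A (length s) (length as)"
      using F by (simp add: total_cochains_def total_zero_def)
    then show "val F \<chi> x s as = 0" using val_zero[OF ok] by (simp add: ev_def)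
  qed
next
  assume F: "F \<in> families \<and> vanishes_off k F"
  have "F p q = zero_cochain C A p q" if k: "int p + int q \<noteq> k" for p q
  proof (rule cochain_eqI)
    fix x s as assume *: "composable x s" "length s = p" "length as = q" "set as \<subseteq> cA (tg x s)"
    have "ev F x s as = ev (total_zero C A) x s as"
    proof (rule chr_eqI[OF composable_Obj[OF *(1)]])
      fix \<chi> assume "\<chi> \<in> chr x"
      then have ok: "ok \<chi> x s as" using * by (simp add: ok_def)
      then show "\<chi> (ev F x s as) = \<chi> (ev (total_zero C A) x s as)"
        using F vanishes_offD[of k F, OF _ ok] val_zero[OF ok] k * by simp
    qed (use F * in \<open>auto intro: ev_closed total_zero_mem\<close>)
    then show "F p q (x, s) as = zero_cochain C A p q (x, s) as"
      using * by (simp add: ev_def total_zero_def)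
  qed (use F zero_cochain_mem in \<open>auto simp: families_def\<close>)
  then show "F \<in> total_cochains K C A k" using F by (auto simp: total_cochains_def families_def)
qed

lemma word_sum_zero:
  "(\<And>x r. xs = x # r \<Longrightarrow> h x r = 0) \<Longrightarrow> head_sum h xs = 0"
  "(\<And>x r. xs = r @ [x] \<Longrightarrow> k r x = 0) \<Longrightarrow> last_sum k xs = 0"
  "(\<And>l x y r. xs = l @ x # y # r \<Longrightarrow> j (l @ m x y # r) = 0) \<Longrightarrow> pair_sum m j xs = 0"
  using head_sum_cong[of xs h "\<lambda>x r. 0"] last_sum_cong[of xs k "\<lambda>x r. 0"] pair_sum_cong[of xs j m "\<lambda>w. 0" m]
  by simp_all

lemma split_sum_zero: "(\<And>a b. xs = a @ b \<Longrightarrow> h a b = 0) \<Longrightarrow> split_sum h xs = 0"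
  using split_sum_cong[of xs h "\<lambda>a b. 0"] by simp

lemma split3_sum_zero: "(\<And>a b c. xs = a @ b @ c \<Longrightarrow> h a b c = 0) \<Longrightarrow> split3_sum h xs = 0"
  unfolding split3_sum_def by (intro split_sum_zero) simp

text \<open>Every face shortens exactly one of the two words by one letter.\<close>

lemma delta_vanishes:
  assumes F: "F \<in> families" and k: "vanishes_off k F"
  shows "vanishes_off (k + 1) (delta C A F)"
  unfolding vanishes_off_def
proof (intro allI impI)
  fix \<chi> x s as assume ok: "ok \<chi> x s as" and n: "int (length s) + int (length as) \<noteq> k + 1"
  have sum3: "a + b + c = 0" if "a = 0" "b = 0" "c = 0" for a b c :: bit using that by simp
  have "DS (val F) \<chi> x s as = 0"
    unfolding DS_def using ok n
    by (intro sum3 word_sum_zero vanishes_offD[OF k ok_head] vanishes_offD[OF k ok_last] vanishes_offD[OF k ok_pair]) auto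
  moreover have "DH (val F) \<chi> x s as = 0"
    unfolding DH_def using ok n
    by (intro sum3 word_sum_zero vanishes_offD[OF k ok_arg_head] vanishes_offD[OF k ok_arg_last]
        vanishes_offD[OF k ok_arg_pair]) auto
  ultimately show "val (delta C A F) \<chi> x s as = 0" by (simp only: val_delta[OF F ok]) simp
qed

lemma cup_vanishes:
  assumes F: "F \<in> families" "G \<in> families" and k: "vanishes_off k F" "vanishes_off l G"
  shows "vanishes_off (k + l) (cup_product F G)"
  unfolding vanishes_off_def
proof (intro allI impI)
  fix \<chi> x s as assume ok: "ok \<chi> x s as" and n: "int (length s) + int (length as) \<noteq> k + l"
  show "val (cup_product F G) \<chi> x s as = 0"
    unfolding val_cup[OF F ok] cup_val_def
  proof (intro split_sum_zero)
    fix s1 s2 a b assume *: "s = s1 @ s2" "as = a @ b"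
    show "\<chi> (ev F x s1 (map (T s2) a) \<cdot>\<^bsub>x\<^esub> T s1 (ev G (tg x s1) s2 b)) = 0"
      using vanishes_offD[OF k(1) ok_cup(1)[OF F ok *]] vanishes_offD[OF k(2) ok_cup(2)[OF F ok *]] n *
      by fastforce
  qed
qed

text \<open>The outer cochain has one letter more than remains of the two words: the inserted value
  in \<open>u\<close>, the composite arrow in \<open>v\<close>. So the lengths add up to one more
  than the total, and off degree \<open>k + l - 1\<close> one of the two values is killed.\<close>

lemma comp_vanishes:
  assumes F: "F \<in> families" "G \<in> families" and k: "vanishes_off k F" "vanishes_off l G"
  shows "vanishes_off (k + l - 1) (comp_product C A F G)"
  unfolding vanishes_off_def
proof (intro allI impI)
  fix \<chi> x s as assume ok: "ok \<chi> x s as" and n: "int (length s) + int (length as) \<noteq> k + l - 1"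
  have "u_val F G \<chi> x s as = 0"
    unfolding u_val_def
  proof (intro split_sum_zero split3_sum_zero)
    fix s1 s2 a b c assume *: "s = s1 @ s2" "as = a @ b @ c"
    show "\<chi> (ev F x s1 (inserted G x s1 s2 a b c)) = 0"
      using vanishes_offD[OF k(1) ok_u_val(1)[OF F ok *]] vanishes_offD[OF k(2) ok_u_val(2)[OF F ok *]] n *
      by fastforce
  qed
  moreover have "v_val F G \<chi> x s as = 0"
    unfolding v_val_def on_nonempty_word_sums[symmetric]
  proof (intro split_sum_zero split3_sum_zero)
    fix s1 s2 s3 a b assume *: "s = s1 @ s2 @ s3" "as = a @ b"
    have "\<chi> (T s1 (ev G (tg x s1) s2 (map (T s3) a)) \<cdot>\<^bsub>x\<^esub>
       ev F x (contracted x s1 s2 s3) b) = 0"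
      using vanishes_offD[OF k(1) ok_v_val(1)[OF F ok *]] vanishes_offD[OF k(2) ok_v_val(2)[OF F ok *]] n *
      by fastforce
    then show "on_nonempty s2 (\<chi> (T s1 (ev G (tg x s1) s2 (map (T s3) a)) \<cdot>\<^bsub>x\<^esub>
       ev F x (contracted x s1 s2 s3) b)) = 0" by (simp add: on_nonempty_def)
  qed
  ultimately show "val (comp_product C A F G) \<chi> x s as = 0" by (simp only: val_comp[OF F ok]) simp
qed

lemma add_vanishes:
  "F \<in> families \<Longrightarrow> G \<in> families \<Longrightarrow> vanishes_off k F \<Longrightarrow> vanishes_off k G \<Longrightarrow> vanishes_off k (total_add C A F G)"
  unfolding vanishes_off_def[of k "total_add C A F G"] by (simp add: val_add vanishes_offD)

lemma total_zero_total: "total_zero C A \<in> total_cochains K C A k"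
  by (simp add: total_cochains_iff total_zero_mem vanishes_off_def val_zero)

lemma total_add_total:
  "F \<in> total_cochains K C A k \<Longrightarrow> G \<in> total_cochains K C A k \<Longrightarrow> total_add C A F G \<in> total_cochains K C A k"
  by (simp add: total_cochains_iff total_add_mem add_vanishes)

lemma homotopy_total:
  assumes "F \<in> total_cochains K C A k" "h \<in> total_cochains K C A (k - 1)"
  shows "homotopy F h \<in> total_cochains K C A (2 * k - 1 - 1)"
proof -
  have F: "F \<in> families" "vanishes_off k F" and h: "h \<in> families" "vanishes_off (k - 1) h"
    using assms by (auto simp: total_cochains_iff)
  note d = delta_mem[OF h(1)]
  have dv: "vanishes_off k (delta C A h)" using delta_vanishes[OF h] by simp
  have "vanishes_off (2 * k - 1 - 1) (comp_product C A F h)" "vanishes_off (2 * k - 1 - 1) (comp_product C A h F)"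
    "vanishes_off (2 * k - 1 - 1) (comp_product C A h (delta C A h))" "vanishes_off (2 * k - 1 - 1) (cup_product h h)"
    using comp_vanishes[OF F(1) h(1) F(2) h(2)] comp_vanishes[OF h(1) F(1) h(2) F(2)]
      comp_vanishes[OF h(1) d h(2) dv] cup_vanishes[OF h(1) h(1) h(2) h(2)]
    by (simp_all add: algebra_simps)
  then show ?thesis
    unfolding total_cochains_iff homotopy_def
    by (intro conjI add_vanishes total_add_mem comp_product_mem cup_product_mem F h d)
qed


subsection \<open>The induced map on cohomology\<close>

lemma total_add_zero:
  assumes F: "F \<in> families"
  shows "total_add C A (total_zero C A) F = F"
  by (rule families_eqI') (simp_all add: val_add val_zero total_add_mem total_zero_mem F)

lemma total_add_assoc:
  assumes F: "F \<in> families" "G \<in> families" "H \<in> families"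
  shows "total_add C A (total_add C A F G) H = total_add C A F (total_add C A G H)"
  by (rule families_eqI') (simp_all add: val_add total_add_mem F ac_simps)

lemma mem_cohomology_class:
  "G \<in> cohomology_class K C A k F \<longleftrightarrow> (\<exists>h\<in>total_cochains K C A (k - 1). G = total_add C A (delta C A h) F)"
  by (auto simp: cohomology_class_def r_coset_def cocycles_def coboundaries_def)

lemma self_mem_class:
  assumes F: "F \<in> families"
  shows "F \<in> cohomology_class K C A k F"
proof -
  have "delta C A (total_zero C A) = total_zero C A"
    using delta_add[OF F F] add_self_zero[OF F] add_self_zero[OF delta_mem[OF F]] by simp
  then show ?thesis
    unfolding mem_cohomology_class using total_add_zero[OF F] total_zero_total by metis
qed

text \<open>Translation by \<open>h\<close> is its own inverse on cochains of degree
  \<open>k - 1\<close>, so the two cosets are reparametrizations of each other.\<close>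

lemma class_add_coboundary:
  assumes h: "h \<in> total_cochains K C A (k - 1)" and F: "F \<in> families"
  shows "cohomology_class K C A k (total_add C A (delta C A h) F) = cohomology_class K C A k F"
proof -
  have fam: "g \<in> families" if "g \<in> total_cochains K C A (k - 1)" for g
    using that by (simp add: total_cochains_iff)
  have 1: "total_add C A (delta C A g) (total_add C A (delta C A h) F) =
      total_add C A (delta C A (total_add C A g h)) F" if "g \<in> total_cochains K C A (k - 1)" for g
    using that h F by (simp add: delta_add fam total_add_assoc delta_mem)
  have 2: "total_add C A (total_add C A g h) h = g" if g: "g \<in> total_cochains K C A (k - 1)" for g
    by (rule families_eqI')
      (simp_all add: val_add total_add_mem fam[OF g] fam[OF h] add.assoc)
  show ?thesis
  proof (intro Set.set_eqI iffI)
    fix G assume "G \<in> cohomology_class K C A k (total_add C A (delta C A h) F)"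
    then show "G \<in> cohomology_class K C A k F"
      unfolding mem_cohomology_class using 1 total_add_total[OF _ h] by blast
  next
    fix G assume "G \<in> cohomology_class K C A k F"
    then obtain g where g: "g \<in> total_cochains K C A (k - 1)" "G = total_add C A (delta C A g) F"
      unfolding mem_cohomology_class by blast
    then have "G = total_add C A (delta C A (total_add C A g h)) (total_add C A (delta C A h) F)"
      using 1[OF total_add_total[OF g(1) h]] 2[OF g(1)] by simp
    then show "G \<in> cohomology_class K C A k (total_add C A (delta C A h) F)"
      unfolding mem_cohomology_class using total_add_total[OF g(1) h] by blast
  qed
qed

lemma mem_cocycles:
  "F \<in> carrier (cocycles K C A k) \<longleftrightarrow> F \<in> total_cochains K C A k \<and> delta C A F = total_zero C A"
  by (simp add: cocycles_def)

lemma Sq_cocycle: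
  assumes "F \<in> carrier (cocycles K C A k)"
  shows "Sq C A F \<in> carrier (cocycles K C A (2 * k - 1))"
proof -
  have F: "F \<in> families" "vanishes_off k F" "delta C A F = total_zero C A"
    using assms by (auto simp: mem_cocycles total_cochains_iff)
  have "vanishes_off (2 * k - 1) (Sq C A F)"
    using comp_vanishes[OF F(1,1,2,2)] by (simp add: Sq_def)
  then show ?thesis
    using delta_Sq[OF F(1,3)] comp_product_mem[OF F(1,1)] by (simp add: mem_cocycles total_cochains_iff Sq_def)
qed

text \<open>As \<open>F\<close> lies in its own class, equality of classes writes \<open>F\<close>
  as a coboundary plus \<open>G\<close>, and the homotopy formula applies.\<close>

lemma Sq_class:
  assumes F: "F \<in> carrier (cocycles K C A k)" and G: "G \<in> carrier (cocycles K C A k)"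
    and eq: "cohomology_class K C A k F = cohomology_class K C A k G"
  shows "cohomology_class K C A (2 * k - 1) (Sq C A F) = cohomology_class K C A (2 * k - 1) (Sq C A G)"
proof -
  have fam: "F \<in> families" "G \<in> families" "G \<in> total_cochains K C A k" "delta C A G = total_zero C A"
    using F G by (auto simp: mem_cocycles total_cochains_iff)
  have "F \<in> cohomology_class K C A k G" using self_mem_class[OF fam(1), of k] eq by simp
  then obtain h where h: "h \<in> total_cochains K C A (k - 1)" "F = total_add C A (delta C A h) G"
    unfolding mem_cohomology_class by blast
  then have "h \<in> families" by (simp add: total_cochains_iff)
  then have "Sq C A F = total_add C A (delta C A (homotopy G h)) (Sq C A G)"
    unfolding h(2) using fam by (intro Sq_add_coboundary)
  moreover have "Sq C A G \<in> families" unfolding Sq_def by (intro comp_product_mem fam)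
  ultimately show ?thesis
    using class_add_coboundary[OF homotopy_total[OF fam(3) h(1)]] by simp
qed

lemma carrier_cohomology:
  "carrier (cohomology K C A k) = cohomology_class K C A k ` carrier (cocycles K C A k)"
  by (auto simp: cohomology_def FactGroup_def RCOSETS_def cohomology_class_def)

end

theorem theorem6p14:
  fixes K :: "'k ring"
    and C :: "('o, 'm) category"
    and A :: "('o, 'm, 'k, 'a) diagram"
    and k :: int
  assumes "field K"
    and "ring_characteristic K = 2"
    and "small_category C"
    and "algebra_functor K C A"
  shows "Sq C A \<in> carrier (cocycles K C A k) \<rightarrow> carrier (cocycles K C A (2 * k - 1)) \<and>
    (\<exists>S \<in> carrier (cohomology K C A k) \<rightarrow> carrier (cohomology K C A (2 * k - 1)).
       \<forall>F \<in> carrier (cocycles K C A k).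
         S (cohomology_class K C A k F) = cohomology_class K C A (2 * k - 1) (Sq C A F))"
proof (intro conjI)
  interpret char2_diagram K C A
    using assms by (simp add: char2_diagram_def char2_diagram_axioms_def)
  let ?Z = "carrier (cocycles K C A k)" and ?cl = "cohomology_class K C A k"
  let ?cl' = "cohomology_class K C A (2 * k - 1)"
  show "Sq C A \<in> ?Z \<rightarrow> carrier (cocycles K C A (2 * k - 1))" using Sq_cocycle by blast
  \<comment> \<open>The induced map squares an arbitrary representative; that the choice made by
    \<open>inv_into\<close> does not matter is \<open>Sq_class\<close>.\<close>
  let ?S = "\<lambda>c. ?cl' (Sq C A (inv_into ?Z ?cl c))"
  have S: "?S (?cl F) = ?cl' (Sq C A F)" if F: "F \<in> ?Z" for F
  proof (rule Sq_class[OF _ F])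
    show "inv_into ?Z ?cl (?cl F) \<in> ?Z" by (rule inv_into_into) (use F in blast)
    show "?cl (inv_into ?Z ?cl (?cl F)) = ?cl F" by (rule f_inv_into_f[of _ ?cl ?Z]) (use F in blast)
  qed
  show "\<exists>S \<in> carrier (cohomology K C A k) \<rightarrow> carrier (cohomology K C A (2 * k - 1)).
      \<forall>F\<in>?Z. S (?cl F) = ?cl' (Sq C A F)"
  proof (intro bexI[of _ ?S] ballI S)
    show "?S \<in> carrier (cohomology K C A k) \<rightarrow> carrier (cohomology K C A (2 * k - 1))"
    proof
      fix c assume "c \<in> carrier (cohomology K C A k)"
      then obtain F where "F \<in> ?Z" "c = ?cl F" unfolding carrier_cohomology by blast
      then show "?S c \<in> carrier (cohomology K C A (2 * k - 1))"
        unfolding carrier_cohomology using S Sq_cocycle by auto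
    qed
  qed
qed

end
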